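(* Let $\mathcal V$ be a category with pullbacks and let $T=(T,m,e)$ be a cartesian monad on $\mathcal V$. Let $p\colon x\to y$ be a functor of $T$-categories internal to $\mathcal V$. If - $Tp_1$ is an effective descent morphism in $\mathcal V$, - $Tp_2$ is a descent morphism in $\mathcal V$, and - $p_3$ is an almost descent morphism in $\mathcal V$, then $p$ is an effective descent morphism in the category $\mathsf{Cat}(T,\mathcal V)$ of $T$-categories internal to $\mathcal V$.
   Context: A monad $(T,m,e)$ is cartesian if $T$ preserves pullbacks and all naturality squares of $m\colon TT\to T$ and $e\colon\mathrm{id}\to T$ are pullbacks. A $T$-category $x$ internal to $\mathcal V$ consists of objects $x_0$ (objects) and $x_1$ (arrows), morphisms $d_1\colon x_1\to Tx_0$ (domain), $d_0\colon x_1\to x_0$ (codomain), $s_0\colon x_0\to x_1$ (identities) and $c\colon x_2\to x_1$ (composition), where $x_2$ (2-chains) is the pullback of $d_1\colon x_1\to Tx_0$ and $Td_0\colon Tx_1\to Tx_0$, with projections $\pi_0\colon x_2\to x_1$, $\pi_2\colon x_2\to Tx_1$; and $x_3$ (3-chains) is the pullback of $\pi_2\colon x_2\to Tx_1$ and $T\pi_0\colon Tx_2\to Tx_1$, with projections $\rho_0\colon x_3\to x_2$, $\rho_3\colon x_3\to Tx_2$. Axioms: $d_0s_0=\mathrm{id}$, $d_1s_0=e_{x_0}$, $d_0c=d_0\pi_0$, $d_1c=m_{x_0}\circ Td_1\circ\pi_2$; unit laws $c\circ(s_0d_0,\,e_{x_1})=\mathrm{id}$ and $c\circ(\mathrm{id},\,Ts_0\circ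 d_1)=\mathrm{id}$; associativity $c\circ(\pi_0\rho_0,\,Tc\circ\rho_3)=c\circ(c\circ\rho_0,\,m_{x_1}\circ T\pi_2\circ\rho_3)$. A functor $p\colon x\to y$ of $T$-categories is a pair $p_0\colon x_0\to y_0$, $p_1\colon x_1\to y_1$ with $d_0p_1=p_0d_0$, $d_1p_1=Tp_0\circ d_1$, $p_1s_0=s_0p_0$, $p_1c=c\,p_2$, where $p_2\colon x_2\to y_2$ is induced by $p_1,Tp_1$, and $p_3\colon x_3\to y_3$ is induced by $p_2,Tp_2$. Descent: for a category $\mathcal A$ with pullbacks and $q\colon e\to b$, let $q^*\colon\mathcal A/b\to\mathcal A/e$ be the pullback functor, $q_!\dashv q^*$, $T^q$ the induced monad, $\mathcal K^q\colon\mathcal A/b\to T^q\text{-}\mathsf{Alg}$ the Eilenberg–Moore comparison functor. $q$ is an almost descent, descent, or effective descent morphism if $\mathcal K^q$ is faithful, fully faithful, or an equivalence, respectively. *)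

theory Defs
  imports Main
begin

section \<open>Categories, functors and natural transformations\<close>

text \<open>
  A category is a record whose operations are only meaningful on its objects and
  arrows; values outside are junk and no definition below depends on them.
  Composition is written in the usual applicative order: \<open>g \<cdot> f\<close> is \<open>f\<close> followed by \<open>g\<close>.
\<close>

record ('o, 'm) cat =
  Obj :: "'o set"
  Arr :: "'m set"
  Dom :: "'m \<Rightarrow> 'o"
  Cod :: "'m \<Rightarrow> 'o"
  Ident :: "'o \<Rightarrow> 'm"
  Comp :: "'m \<Rightarrow> 'm \<Rightarrow> 'm" (infixl \<open>\<cdot>\<index>\<close> 70)

definition Hom :: "('o, 'm) cat \<Rightarrow> 'o \<Rightarrow> 'o \<Rightarrow> 'm set" where
  "Hom C a b = {f \<in> Arr C. Dom C f = a \<and> Cod C f = b}"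

locale category =
  fixes C :: "('o, 'm) cat" (structure)
  assumes Dom_closed: "f \<in> Arr C \<Longrightarrow> Dom C f \<in> Obj C"
    and Cod_closed: "f \<in> Arr C \<Longrightarrow> Cod C f \<in> Obj C"
    and Ident_closed: "a \<in> Obj C \<Longrightarrow> Ident C a \<in> Hom C a a"
    and Comp_closed: "f \<in> Hom C a b \<Longrightarrow> g \<in> Hom C b c \<Longrightarrow> g \<cdot> f \<in> Hom C a c"
    and Comp_Ident: "f \<in> Hom C a b \<Longrightarrow> f \<cdot> Ident C a = f"
    and Ident_Comp: "f \<in> Hom C a b \<Longrightarrow> Ident C b \<cdot> f = f"
    and Comp_assoc:
      "f \<in> Hom C a b \<Longrightarrow> g \<in> Hom C b c \<Longrightarrow> h \<in> Hom C c d \<Longrightarrow> h \<cdot> (g \<cdot> f) = (h \<cdot> g) \<cdot> f"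

record ('o1, 'm1, 'o2, 'm2) func =
  FObj :: "'o1 \<Rightarrow> 'o2"
  FArr :: "'m1 \<Rightarrow> 'm2"

locale cat_functor = dom: category C + cod: category D
  for C :: "('o1, 'm1) cat" and D :: "('o2, 'm2) cat" +
  fixes F :: "('o1, 'm1, 'o2, 'm2) func"
  assumes FObj_closed: "a \<in> Obj C \<Longrightarrow> FObj F a \<in> Obj D"
    and FArr_closed: "f \<in> Hom C a b \<Longrightarrow> FArr F f \<in> Hom D (FObj F a) (FObj F b)"
    and FArr_Ident: "a \<in> Obj C \<Longrightarrow> FArr F (Ident C a) = Ident D (FObj F a)"
    and FArr_Comp: "f \<in> Hom C a b \<Longrightarrow> g \<in> Hom C b c \<Longrightarrow>
      FArr F (g \<cdot>\<^bsub>C\<^esub> f) = FArr F g \<cdot>\<^bsub>D\<^esub> FArr F f"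

definition id_func :: "('o, 'm, 'o, 'm) func" where
  "id_func = \<lparr>FObj = (\<lambda>a. a), FArr = (\<lambda>f. f)\<rparr>"

definition comp_func :: "('o2, 'm2, 'o3, 'm3) func \<Rightarrow> ('o1, 'm1, 'o2, 'm2) func
    \<Rightarrow> ('o1, 'm1, 'o3, 'm3) func" (infixl \<open>\<circ>\<^sub>F\<close> 70) where
  "G \<circ>\<^sub>F F = \<lparr>FObj = (\<lambda>a. FObj G (FObj F a)), FArr = (\<lambda>f. FArr G (FArr F f))\<rparr>"

locale nat_trans = source: cat_functor C D F + target: cat_functor C D G
  for C :: "('o1, 'm1) cat" and D :: "('o2, 'm2) cat"
    and F :: "('o1, 'm1, 'o2, 'm2) func" and G :: "('o1, 'm1, 'o2, 'm2) func" +
  fixes \<tau> :: "'o1 \<Rightarrow> 'm2"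
  assumes component: "a \<in> Obj C \<Longrightarrow> \<tau> a \<in> Hom D (FObj F a) (FObj G a)"
    and naturality: "f \<in> Hom C a b \<Longrightarrow> \<tau> b \<cdot>\<^bsub>D\<^esub> FArr F f = FArr G f \<cdot>\<^bsub>D\<^esub> \<tau> a"

definition is_iso :: "('o, 'm) cat \<Rightarrow> 'm \<Rightarrow> bool" where
  "is_iso C f \<longleftrightarrow> f \<in> Arr C \<and> (\<exists>g \<in> Hom C (Cod C f) (Dom C f).
     g \<cdot>\<^bsub>C\<^esub> f = Ident C (Dom C f) \<and> f \<cdot>\<^bsub>C\<^esub> g = Ident C (Cod C f))"

definition nat_iso :: "('o1, 'm1) cat \<Rightarrow> ('o2, 'm2) cat \<Rightarrow> ('o1, 'm1, 'o2, 'm2) func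
    \<Rightarrow> ('o1, 'm1, 'o2, 'm2) func \<Rightarrow> ('o1 \<Rightarrow> 'm2) \<Rightarrow> bool" where
  "nat_iso C D F G \<tau> \<longleftrightarrow> nat_trans C D F G \<tau> \<and> (\<forall>a \<in> Obj C. is_iso D (\<tau> a))"

definition faithful :: "('o1, 'm1) cat \<Rightarrow> ('o2, 'm2) cat \<Rightarrow> ('o1, 'm1, 'o2, 'm2) func \<Rightarrow> bool" where
  "faithful C D F \<longleftrightarrow> cat_functor C D F \<and>
     (\<forall>a \<in> Obj C. \<forall>b \<in> Obj C. inj_on (FArr F) (Hom C a b))"

definition fully_faithful ::
    "('o1, 'm1) cat \<Rightarrow> ('o2, 'm2) cat \<Rightarrow> ('o1, 'm1, 'o2, 'm2) func \<Rightarrow> bool" where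
  "fully_faithful C D F \<longleftrightarrow> cat_functor C D F \<and>
     (\<forall>a \<in> Obj C. \<forall>b \<in> Obj C.
        bij_betw (FArr F) (Hom C a b) (Hom D (FObj F a) (FObj F b)))"

definition is_equivalence ::
    "('o1, 'm1) cat \<Rightarrow> ('o2, 'm2) cat \<Rightarrow> ('o1, 'm1, 'o2, 'm2) func \<Rightarrow> bool" where
  "is_equivalence C D F \<longleftrightarrow> cat_functor C D F \<and>
     (\<exists>G \<eta> \<epsilon>. cat_functor D C G \<and> nat_iso C C id_func (G \<circ>\<^sub>F F) \<eta> \<and> nat_iso D D (F \<circ>\<^sub>F G) id_func \<epsilon>)"


section \<open>Pullbacks\<close>

text \<open>
  \<open>is_pullback C f g p q\<close>: the square \<open>f \<cdot> p = g \<cdot> q\<close> is a pullback of the cospan \<open>(f, g)\<close>.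
\<close>

definition is_pullback :: "('o, 'm) cat \<Rightarrow> 'm \<Rightarrow> 'm \<Rightarrow> 'm \<Rightarrow> 'm \<Rightarrow> bool" where
  "is_pullback C f g p q \<longleftrightarrow>
     f \<in> Arr C \<and> g \<in> Arr C \<and> Cod C f = Cod C g \<and>
     p \<in> Hom C (Dom C p) (Dom C f) \<and> q \<in> Hom C (Dom C p) (Dom C g) \<and>
     f \<cdot>\<^bsub>C\<^esub> p = g \<cdot>\<^bsub>C\<^esub> q \<and>
     (\<forall>w \<in> Obj C. \<forall>h \<in> Hom C w (Dom C f). \<forall>k \<in> Hom C w (Dom C g). f \<cdot>\<^bsub>C\<^esub> h = g \<cdot>\<^bsub>C\<^esub> k \<longrightarrow>
        (\<exists>!u. u \<in> Hom C w (Dom C p) \<and> p \<cdot>\<^bsub>C\<^esub> u = h \<and> q \<cdot>\<^bsub>C\<^esub> u = k))"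

definition has_pullbacks :: "('o, 'm) cat \<Rightarrow> bool" where
  "has_pullbacks C \<longleftrightarrow>
     (\<forall>f \<in> Arr C. \<forall>g \<in> Arr C. Cod C f = Cod C g \<longrightarrow> (\<exists>p q. is_pullback C f g p q))"

text \<open>
  Every cospan with a pullback gets an arbitrary but fixed one, with projections
  \<open>pb_fst C f g\<close> and \<open>pb_snd C f g\<close>; \<open>pb_pair C f g h k\<close> is the arrow \<open>(h, k)\<close> into it.
\<close>

definition pb :: "('o, 'm) cat \<Rightarrow> 'm \<Rightarrow> 'm \<Rightarrow> 'm \<times> 'm" where
  "pb C f g = (SOME (p, q). is_pullback C f g p q)"

definition pb_fst :: "('o, 'm) cat \<Rightarrow> 'm \<Rightarrow> 'm \<Rightarrow> 'm" where
  "pb_fst C f g = fst (pb C f g)"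

definition pb_snd :: "('o, 'm) cat \<Rightarrow> 'm \<Rightarrow> 'm \<Rightarrow> 'm" where
  "pb_snd C f g = snd (pb C f g)"

definition pb_pair :: "('o, 'm) cat \<Rightarrow> 'm \<Rightarrow> 'm \<Rightarrow> 'm \<Rightarrow> 'm \<Rightarrow> 'm" where
  "pb_pair C f g h k = (THE u. u \<in> Hom C (Dom C h) (Dom C (pb_fst C f g)) \<and>
     pb_fst C f g \<cdot>\<^bsub>C\<^esub> u = h \<and> pb_snd C f g \<cdot>\<^bsub>C\<^esub> u = k)"


section \<open>Monads, algebras and the comparison functor\<close>

record ('o, 'm) monad =
  MFun :: "('o, 'm, 'o, 'm) func"
  MMult :: "'o \<Rightarrow> 'm"
  MUnit :: "'o \<Rightarrow> 'm"

abbreviation MObj :: "('o, 'm) monad \<Rightarrow> 'o \<Rightarrow> 'o" where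
  "MObj T \<equiv> FObj (MFun T)"

abbreviation MArr :: "('o, 'm) monad \<Rightarrow> 'm \<Rightarrow> 'm" where
  "MArr T \<equiv> FArr (MFun T)"

definition is_monad :: "('o, 'm) cat \<Rightarrow> ('o, 'm) monad \<Rightarrow> bool" where
  "is_monad C T \<longleftrightarrow>
     cat_functor C C (MFun T) \<and>
     nat_trans C C (MFun T \<circ>\<^sub>F MFun T) (MFun T) (MMult T) \<and>
     nat_trans C C id_func (MFun T) (MUnit T) \<and>
     (\<forall>a \<in> Obj C.
        MMult T a \<cdot>\<^bsub>C\<^esub> MArr T (MUnit T a) = Ident C (MObj T a) \<and>
        MMult T a \<cdot>\<^bsub>C\<^esub> MUnit T (MObj T a) = Ident C (MObj T a) \<and>
        MMult T a \<cdot>\<^bsub>C\<^esub> MArr T (MMult T a) = MMult T a \<cdot>\<^bsub>C\<^esub> MMult T (MObj T a))"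

definition preserves_pullbacks ::
    "('o1, 'm1) cat \<Rightarrow> ('o2, 'm2) cat \<Rightarrow> ('o1, 'm1, 'o2, 'm2) func \<Rightarrow> bool" where
  "preserves_pullbacks C D F \<longleftrightarrow> (\<forall>f g p q. is_pullback C f g p q \<longrightarrow>
     is_pullback D (FArr F f) (FArr F g) (FArr F p) (FArr F q))"

definition cartesian_nat_trans :: "('o1, 'm1) cat \<Rightarrow> ('o2, 'm2) cat \<Rightarrow> ('o1, 'm1, 'o2, 'm2) func
    \<Rightarrow> ('o1, 'm1, 'o2, 'm2) func \<Rightarrow> ('o1 \<Rightarrow> 'm2) \<Rightarrow> bool" where
  "cartesian_nat_trans C D F G \<tau> \<longleftrightarrow> nat_trans C D F G \<tau> \<and>
     (\<forall>f \<in> Arr C. is_pullback D (\<tau> (Cod C f)) (FArr G f) (FArr F f) (\<tau> (Dom C f)))"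

definition cartesian_monad :: "('o, 'm) cat \<Rightarrow> ('o, 'm) monad \<Rightarrow> bool" where
  "cartesian_monad C T \<longleftrightarrow> is_monad C T \<and> preserves_pullbacks C C (MFun T) \<and>
     cartesian_nat_trans C C (MFun T \<circ>\<^sub>F MFun T) (MFun T) (MMult T) \<and>
     cartesian_nat_trans C C id_func (MFun T) (MUnit T)"

text \<open>An algebra is a pair \<open>(a, \<alpha>)\<close>; a homomorphism carries its source and target algebra.\<close>

definition is_algebra :: "('o, 'm) cat \<Rightarrow> ('o, 'm) monad \<Rightarrow> 'o \<times> 'm \<Rightarrow> bool" where
  "is_algebra C T = (\<lambda>(a, \<alpha>). a \<in> Obj C \<and> \<alpha> \<in> Hom C (MObj T a) a \<and>
     \<alpha> \<cdot>\<^bsub>C\<^esub> MUnit T a = Ident C a \<and> \<alpha> \<cdot>\<^bsub>C\<^esub> MMult T a = \<alpha> \<cdot>\<^bsub>C\<^esub> MArr T \<alpha>)"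

definition Alg ::
    "('o, 'm) cat \<Rightarrow> ('o, 'm) monad \<Rightarrow> ('o \<times> 'm, ('o \<times> 'm) \<times> 'm \<times> ('o \<times> 'm)) cat" where
  "Alg C T = \<lparr>
     Obj = {A. is_algebra C T A},
     Arr = {(A, h, B). is_algebra C T A \<and> is_algebra C T B \<and> h \<in> Hom C (fst A) (fst B) \<and>
              h \<cdot>\<^bsub>C\<^esub> snd A = snd B \<cdot>\<^bsub>C\<^esub> MArr T h},
     Dom = (\<lambda>(A, h, B). A),
     Cod = (\<lambda>(A, h, B). B),
     Ident = (\<lambda>A. (A, Ident C (fst A), A)),
     Comp = (\<lambda>(A', k, B') (A, h, B). (A, k \<cdot>\<^bsub>C\<^esub> h, B'))\<rparr>"

text \<open>
  Monad on \<open>C\<close> induced by an adjunction \<open>L \<stileturn> R\<close> with \<open>L : C \<rightarrow> D\<close>, unit \<open>\<eta>\<close> and counit \<open>\<epsilon>\<close>,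
  and its Eilenberg-Moore comparison functor, sending \<open>d\<close> to \<open>(R d, R (\<epsilon> d))\<close>.
\<close>

definition induced_monad :: "('o1, 'm1, 'o2, 'm2) func \<Rightarrow> ('o2, 'm2, 'o1, 'm1) func
    \<Rightarrow> ('o1 \<Rightarrow> 'm1) \<Rightarrow> ('o2 \<Rightarrow> 'm2) \<Rightarrow> ('o1, 'm1) monad" where
  "induced_monad L R \<eta> \<epsilon> =
     \<lparr>MFun = R \<circ>\<^sub>F L, MMult = (\<lambda>a. FArr R (\<epsilon> (FObj L a))), MUnit = \<eta>\<rparr>"

definition EM_comparison :: "('o2, 'm2) cat \<Rightarrow> ('o2, 'm2, 'o1, 'm1) func \<Rightarrow> ('o2 \<Rightarrow> 'm2)
    \<Rightarrow> ('o2, 'm2, 'o1 \<times> 'm1, ('o1 \<times> 'm1) \<times> 'm1 \<times> ('o1 \<times> 'm1)) func" where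
  "EM_comparison D R \<epsilon> =
     (let K = (\<lambda>d. (FObj R d, FArr R (\<epsilon> d)))
      in \<lparr>FObj = K, FArr = (\<lambda>f. (K (Dom D f), FArr R f, K (Cod D f)))\<rparr>)"


section \<open>Descent\<close>

text \<open>An arrow \<open>(f, h, g)\<close> of the slice is an arrow \<open>h\<close> of \<open>C\<close> from \<open>f\<close> to \<open>g\<close> over \<open>b\<close>.\<close>

definition Slice :: "('o, 'm) cat \<Rightarrow> 'o \<Rightarrow> ('m, 'm \<times> 'm \<times> 'm) cat" where
  "Slice C b = \<lparr>
     Obj = {f \<in> Arr C. Cod C f = b},
     Arr = {(f, h, g). f \<in> Arr C \<and> Cod C f = b \<and> g \<in> Arr C \<and> Cod C g = b \<and>
              h \<in> Hom C (Dom C f) (Dom C g) \<and> g \<cdot>\<^bsub>C\<^esub> h = f},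
     Dom = (\<lambda>(f, h, g). f),
     Cod = (\<lambda>(f, h, g). g),
     Ident = (\<lambda>f. (f, Ident C (Dom C f), f)),
     Comp = (\<lambda>(f', k, g') (f, h, g). (f, k \<cdot>\<^bsub>C\<^esub> h, g'))\<rparr>"

text \<open>
  For \<open>q : e \<rightarrow> b\<close>: the functors \<open>q\<^sub>!\<close> (postcomposition) and \<open>q\<^sup>*\<close> (pullback along \<open>q\<close>), and the
  unit and counit of \<open>q\<^sub>! \<stileturn> q\<^sup>*\<close>. The pullback of \<open>g : a \<rightarrow> b\<close> is the first projection of
  the chosen pullback of \<open>(q, g)\<close>; the counit at \<open>g\<close> is the second projection.
\<close>

definition slice_post :: "('o, 'm) cat \<Rightarrow> 'm \<Rightarrow> ('m, 'm \<times> 'm \<times> 'm, 'm, 'm \<times> 'm \<times> 'm) func" where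
  "slice_post C q = \<lparr>
     FObj = (\<lambda>f. q \<cdot>\<^bsub>C\<^esub> f),
     FArr = (\<lambda>(f, h, g). (q \<cdot>\<^bsub>C\<^esub> f, h, q \<cdot>\<^bsub>C\<^esub> g))\<rparr>"

definition slice_pull :: "('o, 'm) cat \<Rightarrow> 'm \<Rightarrow> ('m, 'm \<times> 'm \<times> 'm, 'm, 'm \<times> 'm \<times> 'm) func" where
  "slice_pull C q = \<lparr>
     FObj = (\<lambda>f. pb_fst C q f),
     FArr = (\<lambda>(f, h, g).
       (pb_fst C q f, pb_pair C q g (pb_fst C q f) (h \<cdot>\<^bsub>C\<^esub> pb_snd C q f), pb_fst C q g))\<rparr>"

definition slice_unit :: "('o, 'm) cat \<Rightarrow> 'm \<Rightarrow> 'm \<Rightarrow> 'm \<times> 'm \<times> 'm" where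
  "slice_unit C q f =
     (f, pb_pair C q (q \<cdot>\<^bsub>C\<^esub> f) f (Ident C (Dom C f)), pb_fst C q (q \<cdot>\<^bsub>C\<^esub> f))"

definition slice_counit :: "('o, 'm) cat \<Rightarrow> 'm \<Rightarrow> 'm \<Rightarrow> 'm \<times> 'm \<times> 'm" where
  "slice_counit C q g = (q \<cdot>\<^bsub>C\<^esub> pb_fst C q g, pb_snd C q g, g)"

definition descent_monad :: "('o, 'm) cat \<Rightarrow> 'm \<Rightarrow> ('m, 'm \<times> 'm \<times> 'm) monad" where
  "descent_monad C q =
     induced_monad (slice_post C q) (slice_pull C q) (slice_unit C q) (slice_counit C q)"

definition descent_comparison :: "('o, 'm) cat \<Rightarrow> 'm \<Rightarrow> ('m, 'm \<times> 'm \<times> 'm,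
    'm \<times> 'm \<times> 'm \<times> 'm, ('m \<times> 'm \<times> 'm \<times> 'm) \<times> ('m \<times> 'm \<times> 'm) \<times> ('m \<times> 'm \<times> 'm \<times> 'm)) func" where
  "descent_comparison C q =
     EM_comparison (Slice C (Cod C q)) (slice_pull C q) (slice_counit C q)"

text \<open>
  The pullback functor is junk without pullbacks in \<open>C\<close>, so their existence is part of the
  three notions below rather than left implicit.
\<close>

definition almost_descent :: "('o, 'm) cat \<Rightarrow> 'm \<Rightarrow> bool" where
  "almost_descent C q \<longleftrightarrow> category C \<and> has_pullbacks C \<and> q \<in> Arr C \<and>
     faithful (Slice C (Cod C q)) (Alg (Slice C (Dom C q)) (descent_monad C q))
       (descent_comparison C q)"

definition descent :: "('o, 'm) cat \<Rightarrow> 'm \<Rightarrow> bool" where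
  "descent C q \<longleftrightarrow> category C \<and> has_pullbacks C \<and> q \<in> Arr C \<and>
     fully_faithful (Slice C (Cod C q)) (Alg (Slice C (Dom C q)) (descent_monad C q))
       (descent_comparison C q)"

definition effective_descent :: "('o, 'm) cat \<Rightarrow> 'm \<Rightarrow> bool" where
  "effective_descent C q \<longleftrightarrow> category C \<and> has_pullbacks C \<and> q \<in> Arr C \<and>
     is_equivalence (Slice C (Cod C q)) (Alg (Slice C (Dom C q)) (descent_monad C q))
       (descent_comparison C q)"


section \<open>Internal \<open>T\<close>-categories\<close>

text \<open>The arrow \<open>td1\<close> (into \<open>T x\<^sub>0\<close>) is the domain, \<open>td0\<close> the codomain.\<close>

record ('o, 'm) tcat =
  tob0 :: 'o
  tob1 :: 'o
  td1 :: 'm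
  td0 :: 'm
  ts0 :: 'm
  tcomp :: 'm

text \<open>
  Projections of the objects of 2-chains, \<open>x\<^sub>2 = x\<^sub>1 \<times> T x\<^sub>1\<close> over \<open>T x\<^sub>0\<close>, and of
  3-chains, \<open>x\<^sub>3 = x\<^sub>2 \<times> T x\<^sub>2\<close> over \<open>T x\<^sub>1\<close>, with the arrows induced into these objects.
\<close>

definition tpi0 :: "('o, 'm) cat \<Rightarrow> ('o, 'm) monad \<Rightarrow> ('o, 'm) tcat \<Rightarrow> 'm" where
  "tpi0 V T x = pb_fst V (td1 x) (MArr T (td0 x))"

definition tpi2 :: "('o, 'm) cat \<Rightarrow> ('o, 'm) monad \<Rightarrow> ('o, 'm) tcat \<Rightarrow> 'm" where
  "tpi2 V T x = pb_snd V (td1 x) (MArr T (td0 x))"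

definition tob2 :: "('o, 'm) cat \<Rightarrow> ('o, 'm) monad \<Rightarrow> ('o, 'm) tcat \<Rightarrow> 'o" where
  "tob2 V T x = Dom V (tpi0 V T x)"

definition tpair2 :: "('o, 'm) cat \<Rightarrow> ('o, 'm) monad \<Rightarrow> ('o, 'm) tcat \<Rightarrow> 'm \<Rightarrow> 'm \<Rightarrow> 'm" where
  "tpair2 V T x h k = pb_pair V (td1 x) (MArr T (td0 x)) h k"

definition trho0 :: "('o, 'm) cat \<Rightarrow> ('o, 'm) monad \<Rightarrow> ('o, 'm) tcat \<Rightarrow> 'm" where
  "trho0 V T x = pb_fst V (tpi2 V T x) (MArr T (tpi0 V T x))"

definition trho3 :: "('o, 'm) cat \<Rightarrow> ('o, 'm) monad \<Rightarrow> ('o, 'm) tcat \<Rightarrow> 'm" where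
  "trho3 V T x = pb_snd V (tpi2 V T x) (MArr T (tpi0 V T x))"

definition tpair3 :: "('o, 'm) cat \<Rightarrow> ('o, 'm) monad \<Rightarrow> ('o, 'm) tcat \<Rightarrow> 'm \<Rightarrow> 'm \<Rightarrow> 'm" where
  "tpair3 V T x h k = pb_pair V (tpi2 V T x) (MArr T (tpi0 V T x)) h k"

definition is_tcat :: "('o, 'm) cat \<Rightarrow> ('o, 'm) monad \<Rightarrow> ('o, 'm) tcat \<Rightarrow> bool" where
  "is_tcat V T x \<longleftrightarrow>
     tob0 x \<in> Obj V \<and> tob1 x \<in> Obj V \<and>
     td1 x \<in> Hom V (tob1 x) (MObj T (tob0 x)) \<and>
     td0 x \<in> Hom V (tob1 x) (tob0 x) \<and>
     ts0 x \<in> Hom V (tob0 x) (tob1 x) \<and>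
     tcomp x \<in> Hom V (tob2 V T x) (tob1 x) \<and>
     td0 x \<cdot>\<^bsub>V\<^esub> ts0 x = Ident V (tob0 x) \<and>
     td1 x \<cdot>\<^bsub>V\<^esub> ts0 x = MUnit T (tob0 x) \<and>
     td0 x \<cdot>\<^bsub>V\<^esub> tcomp x = td0 x \<cdot>\<^bsub>V\<^esub> tpi0 V T x \<and>
     td1 x \<cdot>\<^bsub>V\<^esub> tcomp x = MMult T (tob0 x) \<cdot>\<^bsub>V\<^esub> MArr T (td1 x) \<cdot>\<^bsub>V\<^esub> tpi2 V T x \<and>
     tcomp x \<cdot>\<^bsub>V\<^esub> tpair2 V T x (ts0 x \<cdot>\<^bsub>V\<^esub> td0 x) (MUnit T (tob1 x)) = Ident V (tob1 x) \<and>
     tcomp x \<cdot>\<^bsub>V\<^esub> tpair2 V T x (Ident V (tob1 x)) (MArr T (ts0 x) \<cdot>\<^bsub>V\<^esub> td1 x) = Ident V (tob1 x) \<and>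
     tcomp x \<cdot>\<^bsub>V\<^esub> tpair2 V T x
         (tpi0 V T x \<cdot>\<^bsub>V\<^esub> trho0 V T x)
         (MArr T (tcomp x) \<cdot>\<^bsub>V\<^esub> trho3 V T x) =
       tcomp x \<cdot>\<^bsub>V\<^esub> tpair2 V T x
         (tcomp x \<cdot>\<^bsub>V\<^esub> trho0 V T x)
         (MMult T (tob1 x) \<cdot>\<^bsub>V\<^esub> MArr T (tpi2 V T x) \<cdot>\<^bsub>V\<^esub> trho3 V T x)"

record ('o, 'm) tfun =
  tsrc :: "('o, 'm) tcat"
  ttgt :: "('o, 'm) tcat"
  tmap0 :: 'm
  tmap1 :: 'm

definition tmap2 :: "('o, 'm) cat \<Rightarrow> ('o, 'm) monad \<Rightarrow> ('o, 'm) tfun \<Rightarrow> 'm" where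
  "tmap2 V T p = tpair2 V T (ttgt p)
     (tmap1 p \<cdot>\<^bsub>V\<^esub> tpi0 V T (tsrc p)) (MArr T (tmap1 p) \<cdot>\<^bsub>V\<^esub> tpi2 V T (tsrc p))"

definition tmap3 :: "('o, 'm) cat \<Rightarrow> ('o, 'm) monad \<Rightarrow> ('o, 'm) tfun \<Rightarrow> 'm" where
  "tmap3 V T p = tpair3 V T (ttgt p)
     (tmap2 V T p \<cdot>\<^bsub>V\<^esub> trho0 V T (tsrc p)) (MArr T (tmap2 V T p) \<cdot>\<^bsub>V\<^esub> trho3 V T (tsrc p))"

definition is_tfun :: "('o, 'm) cat \<Rightarrow> ('o, 'm) monad \<Rightarrow> ('o, 'm) tcat \<Rightarrow> ('o, 'm) tcat
    \<Rightarrow> ('o, 'm) tfun \<Rightarrow> bool" where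
  "is_tfun V T x y p \<longleftrightarrow>
     is_tcat V T x \<and> is_tcat V T y \<and> tsrc p = x \<and> ttgt p = y \<and>
     tmap0 p \<in> Hom V (tob0 x) (tob0 y) \<and>
     tmap1 p \<in> Hom V (tob1 x) (tob1 y) \<and>
     td0 y \<cdot>\<^bsub>V\<^esub> tmap1 p = tmap0 p \<cdot>\<^bsub>V\<^esub> td0 x \<and>
     td1 y \<cdot>\<^bsub>V\<^esub> tmap1 p = MArr T (tmap0 p) \<cdot>\<^bsub>V\<^esub> td1 x \<and>
     tmap1 p \<cdot>\<^bsub>V\<^esub> ts0 x = ts0 y \<cdot>\<^bsub>V\<^esub> tmap0 p \<and>
     tmap1 p \<cdot>\<^bsub>V\<^esub> tcomp x = tcomp y \<cdot>\<^bsub>V\<^esub> tmap2 V T p"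

definition TCat :: "('o, 'm) cat \<Rightarrow> ('o, 'm) monad \<Rightarrow> (('o, 'm) tcat, ('o, 'm) tfun) cat" where
  "TCat V T = \<lparr>
     Obj = {x. is_tcat V T x},
     Arr = {p. is_tfun V T (tsrc p) (ttgt p) p},
     Dom = tsrc,
     Cod = ttgt,
     Ident = (\<lambda>x. \<lparr>tsrc = x, ttgt = x, tmap0 = Ident V (tob0 x), tmap1 = Ident V (tob1 x)\<rparr>),
     Comp = (\<lambda>q p. \<lparr>tsrc = tsrc p, ttgt = ttgt q,
               tmap0 = tmap0 q \<cdot>\<^bsub>V\<^esub> tmap0 p, tmap1 = tmap1 q \<cdot>\<^bsub>V\<^esub> tmap1 p\<rparr>)\<rparr>"

end

theory Submission
  imports Defs
begin

text \<open>
  Each descent notion for \<open>q\<close> is first reduced to a property of pullbacks along \<open>q\<close>: almost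
  descent means that \<open>q\<close> is a stable epimorphism, descent that it is moreover a stable quotient
  of its kernel pair, and effectiveness that every transport along the fibres of \<open>q\<close> comes from
  a pullback square. The unit of \<open>T\<close> is cartesian, so \<open>p\<^sub>1\<close> and \<open>p\<^sub>2\<close> are pullbacks of \<open>T p\<^sub>1\<close> and
  \<open>T p\<^sub>2\<close>, while \<open>p\<^sub>0\<close> is a retract of the pullback of \<open>p\<^sub>1\<close> along \<open>s\<^sub>0\<close>; hence \<open>p\<^sub>0\<close> and \<open>p\<^sub>1\<close> are
  effective descent and \<open>p\<^sub>2\<close> is a descent morphism. Pullbacks of \<open>T\<close>-categories are computed
  levelwise, and so are those of chains. Therefore a descent datum on \<open>w \<rightarrow> x\<close> along \<open>p\<close> gives one
  on each level: objects and arrows descend to \<open>z\<^sub>0\<close> and \<open>z\<^sub>1\<close> by effectiveness of \<open>p\<^sub>0\<close> and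
  \<open>p\<^sub>1\<close>, the maps \<open>d\<^sub>0\<close>, \<open>d\<^sub>1\<close>, \<open>s\<^sub>0\<close> and the composition descend because \<open>p\<^sub>0\<close>, \<open>p\<^sub>1\<close> and
  \<open>p\<^sub>2\<close> are descent morphisms, and the laws hold because \<open>p\<^sub>0, \<dots>, p\<^sub>3\<close> are stable epimorphisms.
\<close>

section \<open>Categories and pullbacks\<close>

text \<open>The elementary conditions quantify over arbitrary pullback squares and generalized
  elements and never mention chosen pullbacks. This makes them portable: the functors from
  \<open>TCat V T\<close> to \<open>V\<close> that pick out objects, arrows or 2-chains preserve
  pullback squares, but need not preserve the chosen ones. The main obstacle is that the structure
  maps of the descended T-category z do not stay over one base. Its codomain map, for instance, runs
  from z_1 over y_1 to z_0 over y_0, while the stable properties of p_1 concern arrows over y_1.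
  They are therefore first moved along a structure map of y (\<open>stable_quot_factor\<close>,
  \<open>stable_epi_cancel\<close>). A second obstacle is a circularity: the composition of z starts
  at the 2-chains of z, which are computed from a record that already has a composition field.
  Chains are therefore studied for graphs, and new records are built with the composition as a
  parameter.\<close>

context category
begin

lemma in_Hom: "f \<in> Hom C a b \<longleftrightarrow> f \<in> Arr C \<and> Dom C f = a \<and> Cod C f = b"
  by (auto simp: Hom_def)

lemma dom_cod_obj [simp]:
  assumes "f \<in> Arr C"
  shows "Dom C f \<in> Obj C" "Cod C f \<in> Obj C"
  using assms Dom_closed Cod_closed by auto

lemma ident_arr [simp]:
  assumes "a \<in> Obj C"
  shows "Ident C a \<in> Arr C" "Dom C (Ident C a) = a" "Cod C (Ident C a) = a"
  using Ident_closed[OF assms] by (auto simp: in_Hom)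

lemma comp_arr [simp]:
  assumes "g \<in> Arr C" "f \<in> Arr C" "Cod C f = Dom C g"
  shows "g \<cdot> f \<in> Arr C" "Dom C (g \<cdot> f) = Dom C f" "Cod C (g \<cdot> f) = Cod C g"
  using Comp_closed[of f "Dom C f" "Cod C f" g "Cod C g"] assms by (auto simp: in_Hom)

lemma comp_ident [simp]: "f \<in> Arr C \<Longrightarrow> Dom C f = a \<Longrightarrow> f \<cdot> Ident C a = f"
  using Comp_Ident[of f a "Cod C f"] by (auto simp: in_Hom)

lemma ident_comp [simp]: "f \<in> Arr C \<Longrightarrow> Cod C f = a \<Longrightarrow> Ident C a \<cdot> f = f"
  using Ident_Comp[of f "Dom C f" a] by (auto simp: in_Hom)

lemma comp_assoc [simp]:
  assumes "f \<in> Arr C" "g \<in> Arr C" "h \<in> Arr C" "Cod C f = Dom C g" "Cod C g = Dom C h"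
  shows "(h \<cdot> g) \<cdot> f = h \<cdot> (g \<cdot> f)"
  using Comp_assoc[of f "Dom C f" "Dom C g" g "Dom C h" h "Cod C h"] assms by (auto simp: in_Hom)

text \<open>
  Composites are kept associated to the right; \<open>eq[THEN reassoc]\<close> lets an equation \<open>eq\<close>
  between composites rewrite inside longer ones.
\<close>

lemma reassoc:
  assumes "g \<cdot> f = k" "f \<in> Arr C" "g \<in> Arr C" "Cod C f = Dom C g" "u \<in> Arr C" "Cod C u = Dom C f"
  shows "g \<cdot> (f \<cdot> u) = k \<cdot> u"
  using comp_assoc[of u f g] assms by simp

lemma pullback_arrs:
  assumes "is_pullback C f g p q"
  shows "f \<in> Arr C" "g \<in> Arr C" "p \<in> Arr C" "q \<in> Arr C" "Cod C g = Cod C f"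
    "Cod C p = Dom C f" "Cod C q = Dom C g" "Dom C q = Dom C p" "f \<cdot> p = g \<cdot> q"
  using assms unfolding is_pullback_def in_Hom by simp_all

lemma pullback_ex1:
  assumes "is_pullback C f g p q" "h \<in> Arr C" "k \<in> Arr C" "Dom C h = w" "Dom C k = w"
    "Cod C h = Dom C f" "Cod C k = Dom C g" "f \<cdot> h = g \<cdot> k"
  shows "\<exists>!u. u \<in> Hom C w (Dom C p) \<and> p \<cdot> u = h \<and> q \<cdot> u = k"
proof -
  have "w \<in> Obj C" "h \<in> Hom C w (Dom C f)" "k \<in> Hom C w (Dom C g)"
    using assms(2-7) dom_cod_obj(1)[of h] by (simp_all add: in_Hom)
  then show ?thesis
    using assms(1,8) unfolding is_pullback_def by blast
qed

lemma pullback_ex: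
  assumes "is_pullback C f g p q" "h \<in> Arr C" "k \<in> Arr C" "Dom C h = w" "Dom C k = w"
    "Cod C h = Dom C f" "Cod C k = Dom C g" "f \<cdot> h = g \<cdot> k"
  obtains u where "u \<in> Arr C" "Dom C u = w" "Cod C u = Dom C p" "p \<cdot> u = h" "q \<cdot> u = k"
  using ex1_implies_ex[OF pullback_ex1[OF assms]] unfolding in_Hom by blast

lemma pullback_eq:
  assumes "is_pullback C f g p q" "u \<in> Arr C" "v \<in> Arr C" "Dom C u = Dom C v"
    "Cod C u = Dom C p" "Cod C v = Dom C p" "p \<cdot> u = p \<cdot> v" "q \<cdot> u = q \<cdot> v"
  shows "u = v"
proof -
  note P = pullback_arrs[OF assms(1)]
  have "f \<cdot> (p \<cdot> v) = g \<cdot> (q \<cdot> v)"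
    using P assms(2-6) by (simp add: P(9)[THEN reassoc])
  then have "\<exists>!w. w \<in> Hom C (Dom C v) (Dom C p) \<and> p \<cdot> w = p \<cdot> v \<and> q \<cdot> w = q \<cdot> v"
    using P assms(2-6) by (intro pullback_ex1[OF assms(1)]) simp_all
  moreover have "u \<in> Hom C (Dom C v) (Dom C p)" "v \<in> Hom C (Dom C v) (Dom C p)"
    using assms(2-6) by (simp_all add: in_Hom)
  ultimately show ?thesis
    using assms(7,8) by blast
qed

lemma pullbackI:
  assumes "f \<in> Arr C" "g \<in> Arr C" "p \<in> Arr C" "q \<in> Arr C" "Cod C g = Cod C f"
    "Cod C p = Dom C f" "Cod C q = Dom C g" "Dom C q = Dom C p" "f \<cdot> p = g \<cdot> q"
    and ex: "\<And>h k. h \<in> Arr C \<Longrightarrow> k \<in> Arr C \<Longrightarrow> Dom C k = Dom C h \<Longrightarrow> Cod C h = Dom C f \<Longrightarrow>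
      Cod C k = Dom C g \<Longrightarrow> f \<cdot> h = g \<cdot> k \<Longrightarrow>
      \<exists>u \<in> Arr C. Dom C u = Dom C h \<and> Cod C u = Dom C p \<and> p \<cdot> u = h \<and> q \<cdot> u = k"
    and eq: "\<And>u v. u \<in> Arr C \<Longrightarrow> v \<in> Arr C \<Longrightarrow> Dom C u = Dom C v \<Longrightarrow> Cod C u = Dom C p \<Longrightarrow>
      Cod C v = Dom C p \<Longrightarrow> p \<cdot> u = p \<cdot> v \<Longrightarrow> q \<cdot> u = q \<cdot> v \<Longrightarrow> u = v"
  shows "is_pullback C f g p q"
  unfolding is_pullback_def
proof (intro conjI ballI impI)
  fix w h k
  assume "w \<in> Obj C" and hk: "h \<in> Hom C w (Dom C f)" "k \<in> Hom C w (Dom C g)" "f \<cdot> h = g \<cdot> k"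
  then obtain u where "u \<in> Hom C w (Dom C p)" "p \<cdot> u = h" "q \<cdot> u = k"
    using ex[of h k] unfolding in_Hom by auto
  then show "\<exists>!u. u \<in> Hom C w (Dom C p) \<and> p \<cdot> u = h \<and> q \<cdot> u = k"
    using eq unfolding in_Hom by (intro ex1I[of _ u]) simp_all
qed (use assms(1-9) in \<open>simp_all add: in_Hom\<close>)

lemma pullback_sym:
  assumes pb: "is_pullback C f g p q"
  shows "is_pullback C g f q p"
proof (rule pullbackI)
  fix h k
  assume [simp]: "h \<in> Arr C" "k \<in> Arr C" "Dom C k = Dom C h" "Cod C h = Dom C g" "Cod C k = Dom C f"
    "g \<cdot> h = f \<cdot> k"
  obtain u where "u \<in> Arr C" "Dom C u = Dom C h" "Cod C u = Dom C p" "p \<cdot> u = k" "q \<cdot> u = h"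
    by (rule pullback_ex[OF pb, of k h "Dom C h"]) simp_all
  then show "\<exists>u \<in> Arr C. Dom C u = Dom C h \<and> Cod C u = Dom C q \<and> q \<cdot> u = h \<and> p \<cdot> u = k"
    using pullback_arrs(8)[OF pb] by (intro bexI[of _ u]) simp_all
next
  fix u v
  assume "u \<in> Arr C" "v \<in> Arr C" "Dom C u = Dom C v" "Cod C u = Dom C q"
    "Cod C v = Dom C q" "q \<cdot> u = q \<cdot> v" "p \<cdot> u = p \<cdot> v"
  then show "u = v"
    using pullback_arrs(8)[OF pb] by - (rule pullback_eq[OF pb], simp_all)
qed (simp_all add: pullback_arrs[OF pb])

text \<open>Allows the apex to be exchanged for an isomorphic one: the carrier of an isomorphic
  algebra, or a level of an abstract pullback of T-categories.\<close>

lemma pullback_iso: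
  assumes pb: "is_pullback C f g p q" and j: "j \<in> Arr C" "i \<in> Arr C" "Cod C j = Dom C p"
    "Dom C i = Dom C p" "Cod C i = Dom C j" "j \<cdot> i = Ident C (Dom C p)"
    "i \<cdot> j = Ident C (Dom C j)"
  shows "is_pullback C f g (p \<cdot> j) (q \<cdot> j)"
proof -
  note P [simp] = pullback_arrs[OF pb]
  note [simp] = P(9)[THEN reassoc] j j(6)[THEN reassoc] j(7)[THEN reassoc]
  show ?thesis
  proof (rule pullbackI; (simp; fail)?)
    fix h k
    assume a [simp]: "h \<in> Arr C" "k \<in> Arr C" "Dom C k = Dom C h" "Cod C h = Dom C f"
      "Cod C k = Dom C g" "f \<cdot> h = g \<cdot> k"
    obtain u where [simp]: "u \<in> Arr C" "Dom C u = Dom C h" "Cod C u = Dom C p" "p \<cdot> u = h" "q \<cdot> u = k"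
      by (rule pullback_ex[OF pb, of h k "Dom C h"]) simp_all
    show "\<exists>u \<in> Arr C. Dom C u = Dom C h \<and> Cod C u = Dom C (p \<cdot> j) \<and> (p \<cdot> j) \<cdot> u = h \<and> (q \<cdot> j) \<cdot> u = k"
      by (rule bexI[of _ "i \<cdot> u"]) simp_all
  next
    fix u v
    assume a [simp]: "u \<in> Arr C" "v \<in> Arr C" "Dom C u = Dom C v" "Cod C u = Dom C (p \<cdot> j)"
      "Cod C v = Dom C (p \<cdot> j)" and "(p \<cdot> j) \<cdot> u = (p \<cdot> j) \<cdot> v" "(q \<cdot> j) \<cdot> u = (q \<cdot> j) \<cdot> v"
    then have "j \<cdot> u = j \<cdot> v"
      by - (rule pullback_eq[OF pb], simp_all)
    then have "i \<cdot> (j \<cdot> u) = i \<cdot> (j \<cdot> v)"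
      by simp
    then show "u = v"
      by simp
  qed
qed

lemma pullback_comparison:
  assumes pb: "is_pullback C f g p q" and pb': "is_pullback C f g p' q'"
  obtains j i where "j \<in> Arr C" "i \<in> Arr C" "Cod C j = Dom C p" "Dom C j = Dom C p'"
    "Dom C i = Dom C p" "Cod C i = Dom C p'" "j \<cdot> i = Ident C (Dom C p)"
    "i \<cdot> j = Ident C (Dom C p')" "p \<cdot> j = p'" "q \<cdot> j = q'" "p' \<cdot> i = p" "q' \<cdot> i = q"
proof -
  note P [simp] = pullback_arrs[OF pb]
  note P' [simp] = pullback_arrs[OF pb']
  obtain j where j [simp]: "j \<in> Arr C" "Dom C j = Dom C p'" "Cod C j = Dom C p" "p \<cdot> j = p'" "q \<cdot> j = q'"
    by (rule pullback_ex[OF pb, of p' q' "Dom C p'"]) simp_all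
  obtain i where i [simp]: "i \<in> Arr C" "Dom C i = Dom C p" "Cod C i = Dom C p'" "p' \<cdot> i = p" "q' \<cdot> i = q"
    by (rule pullback_ex[OF pb', of p q "Dom C p"]) simp_all
  have "j \<cdot> i = Ident C (Dom C p)"
    by (rule pullback_eq[OF pb]) (simp_all add: j(4,5)[THEN reassoc])
  moreover have "i \<cdot> j = Ident C (Dom C p')"
    by (rule pullback_eq[OF pb']) (simp_all add: i(4,5)[THEN reassoc])
  ultimately show thesis
    using that j i by blast
qed

lemma pullback_paste:
  assumes pb1: "is_pullback C f g p q" and pb2: "is_pullback C h p p' q'"
  shows "is_pullback C (f \<cdot> h) g p' (q \<cdot> q')"
proof -
  note P [simp] = pullback_arrs[OF pb1] pullback_arrs[OF pb2]
  have [simp]: "Cod C h = Dom C f"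
    using P(6,14) by simp
  note [simp] = P(9)[THEN reassoc] P(18)[THEN reassoc]
  show ?thesis
  proof (rule pullbackI; (simp; fail)?)
    fix s k
    assume [simp]: "s \<in> Arr C" "k \<in> Arr C" "Dom C k = Dom C s" and c: "Cod C s = Dom C (f \<cdot> h)"
      "Cod C k = Dom C g" "(f \<cdot> h) \<cdot> s = g \<cdot> k"
    have [simp]: "Cod C s = Dom C h" "Cod C k = Dom C g" "f \<cdot> (h \<cdot> s) = g \<cdot> k"
      using c by simp_all
    obtain u where [simp]: "u \<in> Arr C" "Dom C u = Dom C s" "Cod C u = Dom C p" "p \<cdot> u = h \<cdot> s" "q \<cdot> u = k"
      by (rule pullback_ex[OF pb1, of "h \<cdot> s" k "Dom C s"]) simp_all
    obtain v where [simp]: "v \<in> Arr C" "Dom C v = Dom C s" "Cod C v = Dom C p'" "p' \<cdot> v = s" "q' \<cdot> v = u"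
      by (rule pullback_ex[OF pb2, of s u "Dom C s"]) simp_all
    show "\<exists>u \<in> Arr C. Dom C u = Dom C s \<and> Cod C u = Dom C p' \<and> p' \<cdot> u = s \<and> (q \<cdot> q') \<cdot> u = k"
      by (rule bexI[of _ v]) simp_all
  next
    fix u v
    assume [simp]: "u \<in> Arr C" "v \<in> Arr C" "Dom C u = Dom C v" "Cod C u = Dom C p'"
      "Cod C v = Dom C p'" and e: "p' \<cdot> u = p' \<cdot> v" "(q \<cdot> q') \<cdot> u = (q \<cdot> q') \<cdot> v"
    have "p \<cdot> (q' \<cdot> u) = p \<cdot> (q' \<cdot> v)"
      using arg_cong[OF e(1), of "\<lambda>x. h \<cdot> x"] by simp
    then have "q' \<cdot> u = q' \<cdot> v"
      using e(2) by - (rule pullback_eq[OF pb1], simp_all)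
    then show "u = v"
      using e(1) by - (rule pullback_eq[OF pb2], simp_all)
  qed
qed

text \<open>The cancellation half of the pasting law. The mediating arrow comes from the outer
  rectangle; it satisfies the inner equation because \<open>p\<close> and \<open>q\<close> are
  jointly monic.\<close>

lemma pullback_unpaste:
  assumes pb: "is_pullback C f g p q" and outer: "is_pullback C (f \<cdot> h) g p' (q \<cdot> q')"
    and [simp]: "h \<in> Arr C" "Cod C h = Dom C f" "q' \<in> Arr C" "Dom C q' = Dom C p'" "Cod C q' = Dom C p"
    and eq: "h \<cdot> p' = p \<cdot> q'"
  shows "is_pullback C h p p' q'"
proof -
  note P [simp] = pullback_arrs[OF pb]
  have O [simp]: "p' \<in> Arr C" "Cod C p' = Dom C h"
    using pullback_arrs[OF outer] by simp_all
  note [simp] = P(9)[THEN reassoc] eq eq[THEN reassoc]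
  show ?thesis
  proof (rule pullbackI; (simp; fail)?)
    fix s k
    assume [simp]: "s \<in> Arr C" "k \<in> Arr C" "Dom C k = Dom C s" and c [simp]: "Cod C s = Dom C h"
      "Cod C k = Dom C p" "h \<cdot> s = p \<cdot> k"
    obtain u where u: "u \<in> Arr C" "Dom C u = Dom C s" "Cod C u = Dom C p'" "p' \<cdot> u = s"
        "(q \<cdot> q') \<cdot> u = q \<cdot> k"
      by (rule pullback_ex[OF outer, of s "q \<cdot> k" "Dom C s"]) simp_all
    note [simp] = u(1-3)
    have "p \<cdot> (q' \<cdot> u) = p \<cdot> k"
      using arg_cong[OF u(4), of "\<lambda>x. h \<cdot> x"] by simp
    then have "q' \<cdot> u = k"
      using u(5) by - (rule pullback_eq[OF pb], simp_all)
    then show "\<exists>u \<in> Arr C. Dom C u = Dom C s \<and> Cod C u = Dom C p' \<and> p' \<cdot> u = s \<and> q' \<cdot> u = k"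
      using u(4) by (intro bexI[of _ u]) simp_all
  next
    fix u v
    assume [simp]: "u \<in> Arr C" "v \<in> Arr C" "Dom C u = Dom C v" "Cod C u = Dom C p'"
      "Cod C v = Dom C p'" and "p' \<cdot> u = p' \<cdot> v" "q' \<cdot> u = q' \<cdot> v"
    then show "u = v"
      by - (rule pullback_eq[OF outer], simp_all)
  qed
qed

text \<open>
  Limits commute: the cospans \<open>(uK, vK)\<close>, for \<open>K = P, A, B, Z\<close>, are the corners of three
  pullback squares, and their pullbacks \<open>(iK, jK)\<close> form a fourth one.
\<close>

lemma pullback_of_pullbacks:
  assumes S1: "is_pullback C f1 g1 a1 b1" and S0: "is_pullback C f0 g0 a0 b0"
    and S2: "is_pullback C f2 g2 a2 b2"
    and P: "is_pullback C uP vP iP jP" and A: "is_pullback C uA vA iA jA"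
    and B: "is_pullback C uB vB iB jB" and Z: "is_pullback C uZ vZ iZ jZ"
    and types: "Dom C uP = Dom C a1" "Dom C vP = Dom C a2" "Dom C uA = Dom C f1" "Dom C vA = Dom C f2"
      "Dom C uB = Dom C g1" "Dom C vB = Dom C g2" "Dom C uZ = Cod C f1" "Dom C vZ = Cod C f2"
      "Cod C uP = Dom C a0" "Cod C uA = Dom C f0" "Cod C uB = Dom C g0" "Cod C uZ = Cod C f0"
    and u: "a0 \<cdot> uP = uA \<cdot> a1" "b0 \<cdot> uP = uB \<cdot> b1" "f0 \<cdot> uA = uZ \<cdot> f1" "g0 \<cdot> uB = uZ \<cdot> g1"
    and v: "a0 \<cdot> vP = vA \<cdot> a2" "b0 \<cdot> vP = vB \<cdot> b2" "f0 \<cdot> vA = vZ \<cdot> f2" "g0 \<cdot> vB = vZ \<cdot> g2"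
    and arrs: "f3 \<in> Arr C" "g3 \<in> Arr C" "a3 \<in> Arr C" "b3 \<in> Arr C" "Dom C a3 = Dom C iP"
      "Dom C b3 = Dom C iP" "Cod C a3 = Dom C iA" "Cod C b3 = Dom C iB" "Dom C f3 = Dom C iA"
      "Dom C g3 = Dom C iB" "Cod C f3 = Dom C iZ" "Cod C g3 = Dom C iZ"
    and i: "iA \<cdot> a3 = a1 \<cdot> iP" "iB \<cdot> b3 = b1 \<cdot> iP" "iZ \<cdot> f3 = f1 \<cdot> iA" "iZ \<cdot> g3 = g1 \<cdot> iB"
    and j: "jA \<cdot> a3 = a2 \<cdot> jP" "jB \<cdot> b3 = b2 \<cdot> jP" "jZ \<cdot> f3 = f2 \<cdot> jA" "jZ \<cdot> g3 = g2 \<cdot> jB"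
  shows "is_pullback C f3 g3 a3 b3"
proof -
  note PA [simp] = pullback_arrs(1-8)[OF P] pullback_arrs(1-8)[OF A] pullback_arrs(1-8)[OF B]
    pullback_arrs(1-8)[OF Z] pullback_arrs(1-8)[OF S0] pullback_arrs(1-8)[OF S1]
    pullback_arrs(1-8)[OF S2]
  note sq = pullback_arrs(9)[OF S0] pullback_arrs(9)[OF S1]
    pullback_arrs(9)[OF S2] pullback_arrs(9)[OF P] pullback_arrs(9)[OF A] pullback_arrs(9)[OF B]
  note [simp] = types arrs
  have [simp]: "Cod C vP = Dom C a0" "Cod C vA = Dom C f0" "Cod C vB = Dom C g0" "Cod C vZ = Cod C f0"
    by simp_all
  note [simp] = sq sq[THEN reassoc] u u[THEN reassoc] v v[THEN reassoc] i i[THEN reassoc] j j[THEN reassoc]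
  show ?thesis
  proof (rule pullbackI; (simp; fail)?)
    show "f3 \<cdot> a3 = g3 \<cdot> b3"
      by (rule pullback_eq[OF Z]) simp_all
  next
    fix h k
    assume [simp]: "h \<in> Arr C" "k \<in> Arr C" "Dom C k = Dom C h" and c: "Cod C h = Dom C f3"
      "Cod C k = Dom C g3" and e: "f3 \<cdot> h = g3 \<cdot> k"
    have [simp]: "Cod C h = Dom C iA" "Cod C k = Dom C iB" using c by simp_all
    have "iZ \<cdot> (f3 \<cdot> h) = iZ \<cdot> (g3 \<cdot> k)" "jZ \<cdot> (f3 \<cdot> h) = jZ \<cdot> (g3 \<cdot> k)" using e by simp_all
    then have e1 [simp]: "f1 \<cdot> (iA \<cdot> h) = g1 \<cdot> (iB \<cdot> k)" "f2 \<cdot> (jA \<cdot> h) = g2 \<cdot> (jB \<cdot> k)"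
      by simp_all
    obtain r where r [simp]: "r \<in> Arr C" "Dom C r = Dom C h" "Cod C r = Dom C a1"
        "a1 \<cdot> r = iA \<cdot> h" "b1 \<cdot> r = iB \<cdot> k"
      by (rule pullback_ex[OF S1, of "iA \<cdot> h" "iB \<cdot> k" "Dom C h"]) simp_all
    obtain s where s [simp]: "s \<in> Arr C" "Dom C s = Dom C h" "Cod C s = Dom C a2"
        "a2 \<cdot> s = jA \<cdot> h" "b2 \<cdot> s = jB \<cdot> k"
      by (rule pullback_ex[OF S2, of "jA \<cdot> h" "jB \<cdot> k" "Dom C h"]) simp_all
    \<comment> \<open>The middle square enters here: its projections separate the two sides, so
      \<open>r\<close> and \<open>s\<close> form a cone over the cospan that defines the fourth
      apex.\<close>
    have "uP \<cdot> r = vP \<cdot> s"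
      by (rule pullback_eq[OF S0]) simp_all
    note [simp] = this
    obtain t where t [simp]: "t \<in> Arr C" "Dom C t = Dom C h" "Cod C t = Dom C iP"
        "iP \<cdot> t = r" "jP \<cdot> t = s"
      by (rule pullback_ex[OF P, of r s "Dom C h"]) simp_all
    have "a3 \<cdot> t = h"
      by (rule pullback_eq[OF A]) simp_all
    moreover have "b3 \<cdot> t = k"
      by (rule pullback_eq[OF B]) simp_all
    ultimately show "\<exists>u \<in> Arr C. Dom C u = Dom C h \<and> Cod C u = Dom C a3 \<and> a3 \<cdot> u = h \<and> b3 \<cdot> u = k"
      by (intro bexI[of _ t]) simp_all
  next
    fix r s
    assume [simp]: "r \<in> Arr C" "s \<in> Arr C" "Dom C r = Dom C s" and c: "Cod C r = Dom C a3"
      "Cod C s = Dom C a3" and e: "a3 \<cdot> r = a3 \<cdot> s" "b3 \<cdot> r = b3 \<cdot> s"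
    have [simp]: "Cod C r = Dom C iP" "Cod C s = Dom C iP" using c by simp_all
    have "iA \<cdot> (a3 \<cdot> r) = iA \<cdot> (a3 \<cdot> s)" "jA \<cdot> (a3 \<cdot> r) = jA \<cdot> (a3 \<cdot> s)"
      "iB \<cdot> (b3 \<cdot> r) = iB \<cdot> (b3 \<cdot> s)" "jB \<cdot> (b3 \<cdot> r) = jB \<cdot> (b3 \<cdot> s)"
      using e by simp_all
    then have ee: "a1 \<cdot> (iP \<cdot> r) = a1 \<cdot> (iP \<cdot> s)" "a2 \<cdot> (jP \<cdot> r) = a2 \<cdot> (jP \<cdot> s)"
      "b1 \<cdot> (iP \<cdot> r) = b1 \<cdot> (iP \<cdot> s)" "b2 \<cdot> (jP \<cdot> r) = b2 \<cdot> (jP \<cdot> s)"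
      by simp_all
    have "iP \<cdot> r = iP \<cdot> s"
      by (rule pullback_eq[OF S1]) (simp_all add: ee del: sq)
    moreover have "jP \<cdot> r = jP \<cdot> s"
      by (rule pullback_eq[OF S2]) (simp_all add: ee del: sq)
    ultimately show "r = s"
      by - (rule pullback_eq[OF P], simp_all del: sq)
  qed
qed

end

section \<open>Chosen pullbacks\<close>

locale category_pb = category +
  assumes pullbacks: "has_pullbacks C"
begin

lemma pb_pullback:
  assumes "f \<in> Arr C" "g \<in> Arr C" "Cod C g = Cod C f"
  shows "is_pullback C f g (pb_fst C f g) (pb_snd C f g)"
proof -
  have "\<exists>x. case_prod (is_pullback C f g) x"
    using pullbacks assms by (auto simp: has_pullbacks_def)
  then show ?thesis
    unfolding pb_fst_def pb_snd_def pb_def by (rule someI2_ex) auto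
qed

lemmas pb_arrs [simp] = pullback_arrs(3,4,6-8)[OF pb_pullback]
lemmas pb_square = pullback_arrs(9)[OF pb_pullback]
lemmas pb_eq = pullback_eq[OF pb_pullback]

lemma pb_pair [simp]:
  assumes "f \<in> Arr C" "g \<in> Arr C" "Cod C g = Cod C f" "h \<in> Arr C" "k \<in> Arr C"
    "Dom C k = Dom C h" "Cod C h = Dom C f" "Cod C k = Dom C g" "f \<cdot> h = g \<cdot> k"
  shows "pb_pair C f g h k \<in> Arr C"
    and "Dom C (pb_pair C f g h k) = Dom C h"
    and "Cod C (pb_pair C f g h k) = Dom C (pb_fst C f g)"
    and "pb_fst C f g \<cdot> pb_pair C f g h k = h"
    and "pb_snd C f g \<cdot> pb_pair C f g h k = k"
proof -
  have "\<exists>!u. u \<in> Hom C (Dom C h) (Dom C (pb_fst C f g)) \<and>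
      pb_fst C f g \<cdot> u = h \<and> pb_snd C f g \<cdot> u = k"
    using assms by (intro pullback_ex1[OF pb_pullback[OF assms(1-3)]]) simp_all
  then have "pb_pair C f g h k \<in> Hom C (Dom C h) (Dom C (pb_fst C f g)) \<and>
      pb_fst C f g \<cdot> pb_pair C f g h k = h \<and> pb_snd C f g \<cdot> pb_pair C f g h k = k"
    unfolding pb_pair_def by (rule theI')
  then show "pb_pair C f g h k \<in> Arr C"
    and "Dom C (pb_pair C f g h k) = Dom C h"
    and "Cod C (pb_pair C f g h k) = Dom C (pb_fst C f g)"
    and "pb_fst C f g \<cdot> pb_pair C f g h k = h"
    and "pb_snd C f g \<cdot> pb_pair C f g h k = k"
    by (auto simp: in_Hom)
qed

end

section \<open>Functors and equivalences\<close>

lemma (in category) isoE: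
  assumes "is_iso C f"
  obtains g where "f \<in> Arr C" "g \<in> Arr C" "Dom C g = Cod C f" "Cod C g = Dom C f"
    "g \<cdot> f = Ident C (Dom C f)" "f \<cdot> g = Ident C (Cod C f)"
proof -
  obtain g where "f \<in> Arr C" and g: "g \<in> Hom C (Cod C f) (Dom C f)"
    "g \<cdot> f = Ident C (Dom C f)" "f \<cdot> g = Ident C (Cod C f)"
    using assms unfolding is_iso_def by blast
  moreover have "g \<in> Arr C" "Dom C g = Cod C f" "Cod C g = Dom C f"
    using g(1) by (simp_all add: in_Hom)
  ultimately show thesis
    using that by blast
qed

lemma (in category) isoI:
  assumes "f \<in> Arr C" "g \<in> Arr C" "Dom C g = Cod C f" "Cod C g = Dom C f"
    "g \<cdot> f = Ident C (Dom C f)" "f \<cdot> g = Ident C (Cod C f)"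
  shows "is_iso C f"
proof -
  have "g \<in> Hom C (Cod C f) (Dom C f)"
    using assms by (simp add: in_Hom)
  with assms show ?thesis
    unfolding is_iso_def by blast
qed

context cat_functor
begin

lemma FObj_obj [simp]: "a \<in> Obj C \<Longrightarrow> FObj F a \<in> Obj D"
  by (rule FObj_closed)

lemma FArr_arr [simp]:
  assumes "f \<in> Arr C"
  shows "FArr F f \<in> Arr D" "Dom D (FArr F f) = FObj F (Dom C f)" "Cod D (FArr F f) = FObj F (Cod C f)"
  using FArr_closed[of f "Dom C f" "Cod C f"] assms by (simp_all add: dom.in_Hom cod.in_Hom)

lemma FArr_ident [simp]: "a \<in> Obj C \<Longrightarrow> FArr F (Ident C a) = Ident D (FObj F a)"
  by (rule FArr_Ident)

lemma FArr_comp [simp]: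
  assumes "g \<in> Arr C" "f \<in> Arr C" "Cod C f = Dom C g"
  shows "FArr F (g \<cdot>\<^bsub>C\<^esub> f) = FArr F g \<cdot>\<^bsub>D\<^esub> FArr F f"
  using FArr_Comp[of f "Dom C f" "Dom C g" g "Cod C g"] assms by (simp add: dom.in_Hom)

end

lemma cat_functorI:
  assumes "category C" "category D"
    and "\<And>a. a \<in> Obj C \<Longrightarrow> FObj F a \<in> Obj D"
    and "\<And>f. f \<in> Arr C \<Longrightarrow> FArr F f \<in> Arr D \<and> Dom D (FArr F f) = FObj F (Dom C f) \<and>
      Cod D (FArr F f) = FObj F (Cod C f)"
    and "\<And>a. a \<in> Obj C \<Longrightarrow> FArr F (Ident C a) = Ident D (FObj F a)"
    and "\<And>f g. f \<in> Arr C \<Longrightarrow> g \<in> Arr C \<Longrightarrow> Cod C f = Dom C g \<Longrightarrow>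
      FArr F (g \<cdot>\<^bsub>C\<^esub> f) = FArr F g \<cdot>\<^bsub>D\<^esub> FArr F f"
  shows "cat_functor C D F"
proof -
  interpret C: category C by fact
  interpret D: category D by fact
  show ?thesis
    by unfold_locales (use assms(3-6) in \<open>simp_all add: C.in_Hom D.in_Hom\<close>)
qed

lemma comp_func_functor:
  assumes "cat_functor A B F" "cat_functor B C G"
  shows "cat_functor A C (G \<circ>\<^sub>F F)"
proof -
  interpret F: cat_functor A B F by fact
  interpret G: cat_functor B C G by fact
  show ?thesis
    by (rule cat_functorI) (simp_all add: comp_func_def F.dom.category_axioms G.cod.category_axioms)
qed

lemma nat_transD:
  assumes "nat_trans C D F G \<tau>"
  shows "a \<in> Obj C \<Longrightarrow> \<tau> a \<in> Arr D" "a \<in> Obj C \<Longrightarrow> Dom D (\<tau> a) = FObj F a"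
    "a \<in> Obj C \<Longrightarrow> Cod D (\<tau> a) = FObj G a"
    and "f \<in> Arr C \<Longrightarrow> \<tau> (Cod C f) \<cdot>\<^bsub>D\<^esub> FArr F f = FArr G f \<cdot>\<^bsub>D\<^esub> \<tau> (Dom C f)"
proof -
  interpret nat_trans C D F G \<tau> by fact
  show "a \<in> Obj C \<Longrightarrow> \<tau> a \<in> Arr D" "a \<in> Obj C \<Longrightarrow> Dom D (\<tau> a) = FObj F a"
    "a \<in> Obj C \<Longrightarrow> Cod D (\<tau> a) = FObj G a"
    using component[of a] by (simp_all add: source.cod.in_Hom)
  show "f \<in> Arr C \<Longrightarrow> \<tau> (Cod C f) \<cdot>\<^bsub>D\<^esub> FArr F f = FArr G f \<cdot>\<^bsub>D\<^esub> \<tau> (Dom C f)"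
    by (rule naturality) (simp add: source.dom.in_Hom)
qed

lemma nat_transI:
  assumes "cat_functor C D F" "cat_functor C D G"
    and "\<And>a. a \<in> Obj C \<Longrightarrow> \<tau> a \<in> Arr D \<and> Dom D (\<tau> a) = FObj F a \<and> Cod D (\<tau> a) = FObj G a"
    and "\<And>f. f \<in> Arr C \<Longrightarrow> \<tau> (Cod C f) \<cdot>\<^bsub>D\<^esub> FArr F f = FArr G f \<cdot>\<^bsub>D\<^esub> \<tau> (Dom C f)"
  shows "nat_trans C D F G \<tau>"
proof -
  interpret F: cat_functor C D F by fact
  interpret G: cat_functor C D G by fact
  show ?thesis
    by unfold_locales (use assms(3,4) in \<open>auto simp: F.dom.in_Hom F.cod.in_Hom\<close>)
qed

definition ess_surj :: "('o1, 'm1) cat \<Rightarrow> ('o2, 'm2) cat \<Rightarrow> ('o1, 'm1, 'o2, 'm2) func \<Rightarrow> bool" where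
  "ess_surj C D F \<longleftrightarrow> (\<forall>b \<in> Obj D. \<exists>a \<in> Obj C. \<exists>h \<in> Hom D (FObj F a) b. is_iso D h)"

text \<open>Naturality of \<open>\<eta>\<close> makes \<open>F\<close> faithful and naturality of
  \<open>\<epsilon>\<close> makes \<open>G\<close> faithful. Fullness of \<open>F\<close> follows:
  for the candidate \<open>k\<close>, obtained from \<open>G h\<close> by conjugating with
  \<open>\<eta>\<close>, only the images of \<open>F k\<close> and \<open>h\<close> under
  \<open>G\<close> have to be compared.\<close>

lemma equivalence_imp:
  assumes "is_equivalence C D F"
  shows "fully_faithful C D F \<and> ess_surj C D F"
proof -
  obtain G \<eta> \<epsilon> where "cat_functor C D F" and "cat_functor D C G"
    and "nat_iso C C id_func (G \<circ>\<^sub>F F) \<eta>" and "nat_iso D D (F \<circ>\<^sub>F G) id_func \<epsilon>"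
    using assms unfolding is_equivalence_def by blast
  then interpret F: cat_functor C D F + G: cat_functor D C G by blast+
  have eta: "nat_trans C C id_func (G \<circ>\<^sub>F F) \<eta>" "\<And>a. a \<in> Obj C \<Longrightarrow> is_iso C (\<eta> a)"
    and eps: "nat_trans D D (F \<circ>\<^sub>F G) id_func \<epsilon>" "\<And>a. a \<in> Obj D \<Longrightarrow> is_iso D (\<epsilon> a)"
    using \<open>nat_iso C C _ _ _\<close> \<open>nat_iso D D _ _ _\<close> unfolding nat_iso_def by blast+
  note [simp] = nat_transD(1-3)[OF eta(1), unfolded id_func_def comp_func_def, simplified]
    nat_transD(1-3)[OF eps(1), unfolded id_func_def comp_func_def, simplified]
  note eta_nat = nat_transD(4)[OF eta(1), unfolded id_func_def comp_func_def, simplified]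
  note eps_nat = nat_transD(4)[OF eps(1), unfolded id_func_def comp_func_def, simplified]
  have eta_inv: "\<exists>i. i \<in> Arr C \<and> Dom C i = FObj G (FObj F a) \<and> Cod C i = a \<and>
      i \<cdot>\<^bsub>C\<^esub> \<eta> a = Ident C a \<and> \<eta> a \<cdot>\<^bsub>C\<^esub> i = Ident C (FObj G (FObj F a))" if "a \<in> Obj C" for a
    by (rule F.dom.isoE[OF eta(2)[OF that]]) (use that in \<open>simp, blast\<close>)
  have eps_inv: "\<exists>i. i \<in> Arr D \<and> Cod D i = FObj F (FObj G a) \<and> Dom D i = a \<and>
      \<epsilon> a \<cdot>\<^bsub>D\<^esub> i = Ident D a" if "a \<in> Obj D" for a
    by (rule F.cod.isoE[OF eps(2)[OF that]]) (use that in \<open>simp, blast\<close>)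
  have F_inj: "f = f'" if f: "f \<in> Arr C" "f' \<in> Arr C" "Dom C f = Dom C f'" "Cod C f = Cod C f'"
    "FArr F f = FArr F f'" for f f'
  proof -
    obtain i where i: "i \<in> Arr C" "Dom C i = FObj G (FObj F (Cod C f'))" "Cod C i = Cod C f'"
      "i \<cdot>\<^bsub>C\<^esub> \<eta> (Cod C f') = Ident C (Cod C f')"
      using eta_inv[of "Cod C f'"] f(2) by (simp, blast)
    have "\<eta> (Cod C f') \<cdot>\<^bsub>C\<^esub> f = \<eta> (Cod C f') \<cdot>\<^bsub>C\<^esub> f'"
      using eta_nat[OF f(1)] eta_nat[OF f(2)] f(3-5) by simp
    then have "i \<cdot>\<^bsub>C\<^esub> (\<eta> (Cod C f') \<cdot>\<^bsub>C\<^esub> f) = i \<cdot>\<^bsub>C\<^esub> (\<eta> (Cod C f') \<cdot>\<^bsub>C\<^esub> f')"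
      by simp
    then show "f = f'"
      using f i by (simp add: i(4)[THEN F.dom.reassoc])
  qed
  have G_inj: "h = h'" if h: "h \<in> Arr D" "h' \<in> Arr D" "Dom D h = Dom D h'" "Cod D h = Cod D h'"
    "FArr G h = FArr G h'" for h h'
  proof -
    obtain i where i: "i \<in> Arr D" "Dom D i = Dom D h'" "Cod D i = FObj F (FObj G (Dom D h'))"
      "\<epsilon> (Dom D h') \<cdot>\<^bsub>D\<^esub> i = Ident D (Dom D h')"
      using eps_inv[of "Dom D h'"] h(2) by (simp, blast)
    have "h \<cdot>\<^bsub>D\<^esub> \<epsilon> (Dom D h') = h' \<cdot>\<^bsub>D\<^esub> \<epsilon> (Dom D h')"
      using eps_nat[OF h(1)] eps_nat[OF h(2)] h(3-5) by simp
    then have "(h \<cdot>\<^bsub>D\<^esub> \<epsilon> (Dom D h')) \<cdot>\<^bsub>D\<^esub> i = (h' \<cdot>\<^bsub>D\<^esub> \<epsilon> (Dom D h')) \<cdot>\<^bsub>D\<^esub> i"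
      by simp
    then show "h = h'"
      using h i by simp
  qed
  have full: "\<exists>k \<in> Hom C a b. FArr F k = h"
    if a: "a \<in> Obj C" "b \<in> Obj C" and "h \<in> Hom D (FObj F a) (FObj F b)" for a b h
  proof -
    have [simp]: "h \<in> Arr D" "Dom D h = FObj F a" "Cod D h = FObj F b"
      using that(3) by (simp_all add: F.cod.in_Hom)
    obtain i where i [simp]: "i \<in> Arr C" "Dom C i = FObj G (FObj F b)" "Cod C i = b"
      and inv: "\<eta> b \<cdot>\<^bsub>C\<^esub> i = Ident C (FObj G (FObj F b))"
      using eta_inv[OF a(2)] by blast
    obtain j where j [simp]: "j \<in> Arr C" "Dom C j = FObj G (FObj F a)" "Cod C j = a"
      and jnv: "\<eta> a \<cdot>\<^bsub>C\<^esub> j = Ident C (FObj G (FObj F a))"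
      using eta_inv[OF a(1)] by blast
    note [simp] = a inv inv[THEN F.dom.reassoc] jnv
    define k where "k = i \<cdot>\<^bsub>C\<^esub> (FArr G h \<cdot>\<^bsub>C\<^esub> \<eta> a)"
    have k [simp]: "k \<in> Arr C" "Dom C k = a" "Cod C k = b"
      and eta_k: "\<eta> b \<cdot>\<^bsub>C\<^esub> k = FArr G h \<cdot>\<^bsub>C\<^esub> \<eta> a"
      by (simp_all add: k_def)
    have "FArr G (FArr F k) \<cdot>\<^bsub>C\<^esub> \<eta> a = FArr G h \<cdot>\<^bsub>C\<^esub> \<eta> a"
      using eta_nat[of k] eta_k by simp
    then have "(FArr G (FArr F k) \<cdot>\<^bsub>C\<^esub> \<eta> a) \<cdot>\<^bsub>C\<^esub> j = (FArr G h \<cdot>\<^bsub>C\<^esub> \<eta> a) \<cdot>\<^bsub>C\<^esub> j"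
      by simp
    then have "FArr G (FArr F k) = FArr G h"
      by simp
    then have "FArr F k = h"
      by - (rule G_inj, simp_all)
    then show ?thesis
      by (intro bexI[of _ k]) (simp_all add: F.dom.in_Hom)
  qed
  have "bij_betw (FArr F) (Hom C a b) (Hom D (FObj F a) (FObj F b))"
    if "a \<in> Obj C" "b \<in> Obj C" for a b
  proof (rule bij_betw_imageI)
    show "inj_on (FArr F) (Hom C a b)"
      by (rule inj_onI) (rule F_inj, simp_all add: F.dom.in_Hom)
    have "FArr F ` Hom C a b \<subseteq> Hom D (FObj F a) (FObj F b)"
      by (rule image_subsetI) (simp add: F.dom.in_Hom F.cod.in_Hom)
    then show "FArr F ` Hom C a b = Hom D (FObj F a) (FObj F b)"
      using full[OF that] by blast
  qed
  moreover have "ess_surj C D F"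
    unfolding ess_surj_def
  proof
    fix b assume b: "b \<in> Obj D"
    then have "\<epsilon> b \<in> Hom D (FObj F (FObj G b)) b" "FObj G b \<in> Obj C"
      by (simp_all add: F.cod.in_Hom)
    then show "\<exists>a \<in> Obj C. \<exists>h \<in> Hom D (FObj F a) b. is_iso D h"
      using eps(2)[OF b] by blast
  qed
  ultimately show ?thesis
    unfolding fully_faithful_def using F.cat_functor_axioms by blast
qed

text \<open>The inverse is chosen objectwise by essential surjectivity. Its arrows and the unit are
  unique lifts through \<open>F\<close>, so every equation about them is checked after applying
  \<open>F\<close>.\<close>

lemma equivalenceI:
  assumes ff: "fully_faithful C D F" and es: "ess_surj C D F"
  shows "is_equivalence C D F"
proof -
  interpret F: cat_functor C D F
    using ff by (simp add: fully_faithful_def)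
  have inj: "f = f'" if "f \<in> Arr C" "f' \<in> Arr C" "Dom C f = Dom C f'" "Cod C f = Cod C f'"
    "FArr F f = FArr F f'" for f f'
  proof -
    have "inj_on (FArr F) (Hom C (Dom C f) (Cod C f))"
      using ff that unfolding fully_faithful_def bij_betw_def by simp
    then show ?thesis
      by (rule inj_onD) (use that in \<open>simp_all add: F.dom.in_Hom\<close>)
  qed
  have lift_ex: "\<exists>k. k \<in> Arr C \<and> Dom C k = a \<and> Cod C k = b \<and> FArr F k = h"
    if "a \<in> Obj C" "b \<in> Obj C" "h \<in> Arr D" "Dom D h = FObj F a" "Cod D h = FObj F b" for a b h
  proof -
    have "h \<in> FArr F ` Hom C a b"
      using ff that unfolding fully_faithful_def bij_betw_def by (simp add: F.cod.in_Hom)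
    then obtain k where "k \<in> Hom C a b" "h = FArr F k"
      by blast
    then show ?thesis
      by (intro exI[of _ k]) (simp add: F.dom.in_Hom)
  qed
  define lift where
    "lift a b h = (SOME k. k \<in> Arr C \<and> Dom C k = a \<and> Cod C k = b \<and> FArr F k = h)" for a b h
  have lift [simp]: "lift a b h \<in> Arr C" "Dom C (lift a b h) = a"
      "Cod C (lift a b h) = b" "FArr F (lift a b h) = h"
    if "a \<in> Obj C" "b \<in> Obj C" "h \<in> Arr D" "Dom D h = FObj F a" "Cod D h = FObj F b" for a b h
    using someI_ex[OF lift_ex[OF that]] unfolding lift_def by simp_all
  define P where "P b a e i \<longleftrightarrow> a \<in> Obj C \<and> e \<in> Arr D \<and> Dom D e = FObj F a \<and> Cod D e = b \<and>
      i \<in> Arr D \<and> Dom D i = b \<and> Cod D i = FObj F a \<and>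
      i \<cdot>\<^bsub>D\<^esub> e = Ident D (FObj F a) \<and> e \<cdot>\<^bsub>D\<^esub> i = Ident D b" for b a e i
  have "\<forall>b. \<exists>a e i. b \<in> Obj D \<longrightarrow> P b a e i"
  proof
    fix b
    show "\<exists>a e i. b \<in> Obj D \<longrightarrow> P b a e i"
    proof (cases "b \<in> Obj D")
      case True
      then obtain a e where ae: "a \<in> Obj C" "e \<in> Hom D (FObj F a) b" and iso: "is_iso D e"
        using es unfolding ess_surj_def by blast
      from F.cod.isoE[OF iso] obtain i where
        "i \<in> Arr D" "Dom D i = Cod D e" "Cod D i = Dom D e"
        "i \<cdot>\<^bsub>D\<^esub> e = Ident D (Dom D e)" "e \<cdot>\<^bsub>D\<^esub> i = Ident D (Cod D e)" .
      then have "P b a e i"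
        using ae unfolding F.cod.in_Hom P_def by simp
      then show ?thesis
        by blast
    qed blast
  qed
  then obtain g e i where P: "P b (g b) (e b) (i b)" if "b \<in> Obj D" for b
    by metis
  have G [simp]: "g b \<in> Obj C" "e b \<in> Arr D" "Dom D (e b) = FObj F (g b)"
      "Cod D (e b) = b" "i b \<in> Arr D" "Dom D (i b) = b" "Cod D (i b) = FObj F (g b)"
      and ie: "i b \<cdot>\<^bsub>D\<^esub> e b = Ident D (FObj F (g b))" and ei: "e b \<cdot>\<^bsub>D\<^esub> i b = Ident D b"
    if "b \<in> Obj D" for b
    using P[OF that] unfolding P_def by simp_all
  note [simp] = ie ei ie[THEN F.cod.reassoc] ei[THEN F.cod.reassoc]
  define m where "m h = lift (g (Dom D h)) (g (Cod D h)) (i (Cod D h) \<cdot>\<^bsub>D\<^esub> (h \<cdot>\<^bsub>D\<^esub> e (Dom D h)))" for h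
  have m [simp]: "m h \<in> Arr C" "Dom C (m h) = g (Dom D h)" "Cod C (m h) = g (Cod D h)"
    "FArr F (m h) = i (Cod D h) \<cdot>\<^bsub>D\<^esub> (h \<cdot>\<^bsub>D\<^esub> e (Dom D h))" if "h \<in> Arr D" for h
    using that unfolding m_def by simp_all
  define G where "G = \<lparr>FObj = g, FArr = m\<rparr>"
  have [simp]: "FObj G = g" "FArr G = m"
    by (simp_all add: G_def)
  have G_functor: "cat_functor D C G"
    by (rule cat_functorI) (simp_all add: F.dom.category_axioms F.cod.category_axioms; rule inj; simp)+
  interpret G: cat_functor D C G by (rule G_functor)
  define \<eta> where "\<eta> a = lift a (g (FObj F a)) (i (FObj F a))" for a
  have eta [simp]: "\<eta> a \<in> Arr C" "Dom C (\<eta> a) = a" "Cod C (\<eta> a) = g (FObj F a)"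
    "FArr F (\<eta> a) = i (FObj F a)" if "a \<in> Obj C" for a
    using that unfolding \<eta>_def by simp_all
  have "nat_trans C C id_func (G \<circ>\<^sub>F F) \<eta>"
  proof (rule nat_transI)
    show "cat_functor C C id_func"
      by (rule cat_functorI) (simp_all add: id_func_def F.dom.category_axioms)
    show "cat_functor C C (G \<circ>\<^sub>F F)"
      by (rule comp_func_functor) unfold_locales
  next
    fix f assume "f \<in> Arr C"
    then show "\<eta> (Cod C f) \<cdot>\<^bsub>C\<^esub> FArr id_func f = FArr (G \<circ>\<^sub>F F) f \<cdot>\<^bsub>C\<^esub> \<eta> (Dom C f)"
      unfolding id_func_def comp_func_def by simp (rule inj; simp)
  qed (simp add: id_func_def comp_func_def)
  moreover have "is_iso C (\<eta> a)" if a [simp]: "a \<in> Obj C" for a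
    by (rule F.dom.isoI[of _ "lift (g (FObj F a)) a (e (FObj F a))"]; (simp; fail)?) (rule inj; simp)+
  moreover have "nat_trans D D (F \<circ>\<^sub>F G) id_func e"
  proof (rule nat_transI)
    show "cat_functor D D id_func"
      by (rule cat_functorI) (simp_all add: id_func_def F.cod.category_axioms)
    show "cat_functor D D (F \<circ>\<^sub>F G)"
      by (rule comp_func_functor) unfold_locales
  qed (simp_all add: id_func_def comp_func_def)
  moreover have "is_iso D (e b)" if [simp]: "b \<in> Obj D" for b
    by (rule F.cod.isoI[of _ "i b"]) simp_all
  ultimately show ?thesis
    unfolding is_equivalence_def nat_iso_def using F.cat_functor_axioms G_functor by blast
qed

section \<open>Descent in elementary terms\<close>

text \<open>
  For \<open>q : e \<rightarrow> b\<close> in a category with pullbacks, \<open>stable_epi\<close>, \<open>stable_quot\<close> and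
  \<open>effective\<close> unfold faithfulness, fullness and essential surjectivity of the comparison
  functor. In \<open>descent_datum\<close>, \<open>\<xi> (s, t)\<close> is the transport of \<open>t\<close> to the point \<open>s\<close> of
  the same fibre of \<open>q\<close>, and \<open>u\<close>, \<open>u'\<close>, \<open>v\<close> are generalized elements of \<open>e \<times>\<^sub>b a\<close>.
\<close>

definition fibrewise_constant :: "('o, 'm) cat \<Rightarrow> 'm \<Rightarrow> 'm \<Rightarrow> bool" where
  "fibrewise_constant C e t \<longleftrightarrow> (\<forall>r r'. r \<in> Arr C \<longrightarrow> r' \<in> Arr C \<longrightarrow> Dom C r = Dom C r' \<longrightarrow>
     Cod C r = Dom C e \<longrightarrow> Cod C r' = Dom C e \<longrightarrow> e \<cdot>\<^bsub>C\<^esub> r = e \<cdot>\<^bsub>C\<^esub> r' \<longrightarrow> t \<cdot>\<^bsub>C\<^esub> r = t \<cdot>\<^bsub>C\<^esub> r')"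

definition stable_epi :: "('o, 'm) cat \<Rightarrow> 'm \<Rightarrow> bool" where
  "stable_epi C q \<longleftrightarrow> (\<forall>\<alpha> k q' \<gamma> u v. is_pullback C q \<alpha> k q' \<longrightarrow> \<gamma> \<in> Arr C \<longrightarrow> u \<in> Arr C \<longrightarrow> v \<in> Arr C \<longrightarrow>
     Dom C u = Dom C \<alpha> \<longrightarrow> Dom C v = Dom C \<alpha> \<longrightarrow> Cod C u = Dom C \<gamma> \<longrightarrow> Cod C v = Dom C \<gamma> \<longrightarrow>
     \<gamma> \<cdot>\<^bsub>C\<^esub> u = \<alpha> \<longrightarrow> \<gamma> \<cdot>\<^bsub>C\<^esub> v = \<alpha> \<longrightarrow> u \<cdot>\<^bsub>C\<^esub> q' = v \<cdot>\<^bsub>C\<^esub> q' \<longrightarrow> u = v)"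

definition stable_quot :: "('o, 'm) cat \<Rightarrow> 'm \<Rightarrow> bool" where
  "stable_quot C q \<longleftrightarrow> (\<forall>\<alpha> k q' \<gamma> t. is_pullback C q \<alpha> k q' \<longrightarrow> \<gamma> \<in> Arr C \<longrightarrow> t \<in> Arr C \<longrightarrow>
     Dom C t = Dom C q' \<longrightarrow> Cod C t = Dom C \<gamma> \<longrightarrow> \<gamma> \<cdot>\<^bsub>C\<^esub> t = \<alpha> \<cdot>\<^bsub>C\<^esub> q' \<longrightarrow> fibrewise_constant C q' t \<longrightarrow>
     (\<exists>u \<in> Arr C. Dom C u = Dom C \<alpha> \<and> Cod C u = Dom C \<gamma> \<and> u \<cdot>\<^bsub>C\<^esub> q' = t \<and> \<gamma> \<cdot>\<^bsub>C\<^esub> u = \<alpha>))"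

definition descent_datum :: "('o, 'm) cat \<Rightarrow> 'm \<Rightarrow> 'm \<Rightarrow> 'm \<Rightarrow> 'm \<Rightarrow> 'm \<Rightarrow> bool" where
  "descent_datum C q f m1 m2 \<xi> \<longleftrightarrow>
     f \<in> Arr C \<and> Cod C f = Dom C q \<and> is_pullback C q (q \<cdot>\<^bsub>C\<^esub> f) m1 m2 \<and>
     \<xi> \<in> Arr C \<and> Dom C \<xi> = Dom C m1 \<and> Cod C \<xi> = Dom C f \<and> f \<cdot>\<^bsub>C\<^esub> \<xi> = m1 \<and>
     (\<forall>u. u \<in> Arr C \<longrightarrow> Cod C u = Dom C m1 \<longrightarrow> m1 \<cdot>\<^bsub>C\<^esub> u = f \<cdot>\<^bsub>C\<^esub> (m2 \<cdot>\<^bsub>C\<^esub> u) \<longrightarrow> \<xi> \<cdot>\<^bsub>C\<^esub> u = m2 \<cdot>\<^bsub>C\<^esub> u) \<and>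
     (\<forall>u u' v. u \<in> Arr C \<longrightarrow> u' \<in> Arr C \<longrightarrow> v \<in> Arr C \<longrightarrow> Dom C u' = Dom C u \<longrightarrow> Dom C v = Dom C u \<longrightarrow>
        Cod C u = Dom C m1 \<longrightarrow> Cod C u' = Dom C m1 \<longrightarrow> Cod C v = Dom C m1 \<longrightarrow>
        m2 \<cdot>\<^bsub>C\<^esub> v = \<xi> \<cdot>\<^bsub>C\<^esub> u \<longrightarrow> m1 \<cdot>\<^bsub>C\<^esub> u' = m1 \<cdot>\<^bsub>C\<^esub> v \<longrightarrow> m2 \<cdot>\<^bsub>C\<^esub> u' = m2 \<cdot>\<^bsub>C\<^esub> u \<longrightarrow>
        \<xi> \<cdot>\<^bsub>C\<^esub> v = \<xi> \<cdot>\<^bsub>C\<^esub> u')"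

definition effective :: "('o, 'm) cat \<Rightarrow> 'm \<Rightarrow> bool" where
  "effective C q \<longleftrightarrow> (\<forall>f m1 m2 \<xi>. descent_datum C q f m1 m2 \<xi> \<longrightarrow>
     (\<exists>z \<pi>. is_pullback C q z f \<pi> \<and> \<pi> \<cdot>\<^bsub>C\<^esub> \<xi> = \<pi> \<cdot>\<^bsub>C\<^esub> m2))"

context category
begin

lemma fibrewise_constantD:
  assumes "fibrewise_constant C e t" "r \<in> Arr C" "r' \<in> Arr C" "Dom C r = Dom C r'"
    "Cod C r = Dom C e" "Cod C r' = Dom C e" "e \<cdot> r = e \<cdot> r'"
  shows "t \<cdot> r = t \<cdot> r'"
  using assms unfolding fibrewise_constant_def by blast

lemma stable_epiD:
  assumes "stable_epi C q" "is_pullback C q \<alpha> k q'" "\<gamma> \<in> Arr C" "u \<in> Arr C" "v \<in> Arr C"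
    "Dom C u = Dom C \<alpha>" "Dom C v = Dom C \<alpha>" "Cod C u = Dom C \<gamma>" "Cod C v = Dom C \<gamma>"
    "\<gamma> \<cdot> u = \<alpha>" "\<gamma> \<cdot> v = \<alpha>" "u \<cdot> q' = v \<cdot> q'"
  shows "u = v"
  using assms unfolding stable_epi_def by blast

lemma stable_quotD:
  assumes "stable_quot C q" "is_pullback C q \<alpha> k q'" "\<gamma> \<in> Arr C" "t \<in> Arr C"
    "Dom C t = Dom C q'" "Cod C t = Dom C \<gamma>" "\<gamma> \<cdot> t = \<alpha> \<cdot> q'" "fibrewise_constant C q' t"
  obtains u where "u \<in> Arr C" "Dom C u = Dom C \<alpha>" "Cod C u = Dom C \<gamma>" "u \<cdot> q' = t" "\<gamma> \<cdot> u = \<alpha>"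
  using assms unfolding stable_quot_def by blast

lemma datumD:
  assumes "descent_datum C q f m1 m2 \<xi>"
  shows "f \<in> Arr C" "Cod C f = Dom C q" "is_pullback C q (q \<cdot> f) m1 m2"
    "\<xi> \<in> Arr C" "Dom C \<xi> = Dom C m1" "Cod C \<xi> = Dom C f" "f \<cdot> \<xi> = m1"
  using assms unfolding descent_datum_def by blast+

lemma datum_unit:
  assumes "descent_datum C q f m1 m2 \<xi>"
    "u \<in> Arr C" "Cod C u = Dom C m1" "m1 \<cdot> u = f \<cdot> (m2 \<cdot> u)"
  shows "\<xi> \<cdot> u = m2 \<cdot> u"
  using assms unfolding descent_datum_def by blast

lemma datum_assoc:
  assumes "descent_datum C q f m1 m2 \<xi>"
    "u \<in> Arr C" "u' \<in> Arr C" "v \<in> Arr C" "Dom C u' = Dom C u" "Dom C v = Dom C u"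
    "Cod C u = Dom C m1" "Cod C u' = Dom C m1" "Cod C v = Dom C m1"
    "m2 \<cdot> v = \<xi> \<cdot> u" "m1 \<cdot> u' = m1 \<cdot> v" "m2 \<cdot> u' = m2 \<cdot> u"
  shows "\<xi> \<cdot> v = \<xi> \<cdot> u'"
  using assms unfolding descent_datum_def by blast

text \<open>The canonical datum on a pulled-back object: transport changes the coordinate
  \<open>f\<close> and keeps the coordinate \<open>\<pi>\<close>. As these are jointly monic, both
  laws are read off coordinatewise.\<close>

lemma datum_of_pullback:
  assumes pb: "is_pullback C q z f \<pi>" and m: "is_pullback C q (q \<cdot> f) m1 m2"
    and xi: "\<xi> \<in> Arr C" "Dom C \<xi> = Dom C m1" "Cod C \<xi> = Dom C f" "f \<cdot> \<xi> = m1" "\<pi> \<cdot> \<xi> = \<pi> \<cdot> m2"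
  shows "descent_datum C q f m1 m2 \<xi>"
proof -
  note P [simp] = pullback_arrs(1-8)[OF pb]
  have M [simp]: "m1 \<in> Arr C" "m2 \<in> Arr C" "Cod C m1 = Dom C q" "Cod C m2 = Dom C f" "Dom C m2 = Dom C m1"
    using pullback_arrs[OF m] by simp_all
  note [simp] = xi xi(4,5)[THEN reassoc]
  show ?thesis
    unfolding descent_datum_def
  proof (intro conjI allI impI m)
    fix u assume [simp]: "u \<in> Arr C" "Cod C u = Dom C m1" "m1 \<cdot> u = f \<cdot> (m2 \<cdot> u)"
    show "\<xi> \<cdot> u = m2 \<cdot> u"
      by (rule pullback_eq[OF pb]) simp_all
  next
    fix u u' v assume [simp]: "u \<in> Arr C" "u' \<in> Arr C" "v \<in> Arr C" "Dom C u' = Dom C u" "Dom C v = Dom C u"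
      "Cod C u = Dom C m1" "Cod C u' = Dom C m1" "Cod C v = Dom C m1"
      "m2 \<cdot> v = \<xi> \<cdot> u" "m1 \<cdot> u' = m1 \<cdot> v" "m2 \<cdot> u' = m2 \<cdot> u"
    show "\<xi> \<cdot> v = \<xi> \<cdot> u'"
      by (rule pullback_eq[OF pb]) simp_all
  qed simp_all
qed

text \<open>Transport exhausts the kernel pair of \<open>\<pi>\<close>: if \<open>r\<close> and
  \<open>r'\<close> have the same image, then moving \<open>r\<close> to the point
  \<open>f \<cdot> r'\<close> of its fibre gives \<open>r'\<close>, since both coordinates
  agree.\<close>

lemma kernel_transport:
  assumes pb: "is_pullback C q z f \<pi>" and m: "is_pullback C q (q \<cdot> f) m1 m2"
    and xi: "\<xi> \<in> Arr C" "Dom C \<xi> = Dom C m1" "Cod C \<xi> = Dom C f" "f \<cdot> \<xi> = m1" "\<pi> \<cdot> \<xi> = \<pi> \<cdot> m2"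
    and r [simp]: "r \<in> Arr C" "r' \<in> Arr C" "Dom C r = Dom C r'" "Cod C r = Dom C \<pi>" "Cod C r' = Dom C \<pi>"
    and eq: "\<pi> \<cdot> r = \<pi> \<cdot> r'"
  obtains u where "u \<in> Arr C" "Dom C u = Dom C r'" "Cod C u = Dom C m1" "m2 \<cdot> u = r" "\<xi> \<cdot> u = r'"
proof -
  note P [simp] = pullback_arrs(1-8)[OF pb]
  note sq = pullback_arrs(9)[OF pb]
  have M [simp]: "m1 \<in> Arr C" "m2 \<in> Arr C" "Cod C m1 = Dom C q" "Cod C m2 = Dom C f" "Dom C m2 = Dom C m1"
    using pullback_arrs[OF m] by simp_all
  note [simp] = xi xi(4,5)[THEN reassoc]
  have "q \<cdot> (f \<cdot> r') = q \<cdot> (f \<cdot> r)"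
    using eq by (simp add: sq[THEN reassoc])
  then obtain u where u [simp]: "u \<in> Arr C" "Dom C u = Dom C r'" "Cod C u = Dom C m1" "m1 \<cdot> u = f \<cdot> r'" "m2 \<cdot> u = r"
    by - (rule pullback_ex[OF m, of "f \<cdot> r'" r "Dom C r'"], simp_all)
  have "\<xi> \<cdot> u = r'"
    by (rule pullback_eq[OF pb]) (simp_all add: eq)
  then show thesis
    using that u by blast
qed

text \<open>Brings a datum over an arbitrary pullback to the chosen one, the only form in which
  algebras of the descent monad present it.\<close>

lemma datum_change_pullback:
  assumes d: "descent_datum C q f m1 m2 \<xi>" and m': "is_pullback C q (q \<cdot> f) m1' m2'"
    and j [simp]: "j \<in> Arr C" "Cod C j = Dom C m1" "Dom C j = Dom C m1'" and mj: "m1 \<cdot> j = m1'" "m2 \<cdot> j = m2'"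
  shows "descent_datum C q f m1' m2' (\<xi> \<cdot> j)"
proof -
  note D [simp] = datumD(1,2,4-7)[OF d]
  note M [simp] = pullback_arrs(1-8)[OF datumD(3)[OF d]]
  have [simp]: "m1' \<in> Arr C" "m2' \<in> Arr C" "Dom C m2' = Dom C m1'" "Cod C m1' = Dom C q" "Cod C m2' = Dom C f"
    using pullback_arrs[OF m'] by simp_all
  have [simp]: "q \<in> Arr C"
    using M by simp
  have a: "m1' \<cdot> u = m1 \<cdot> (j \<cdot> u)" "m2' \<cdot> u = m2 \<cdot> (j \<cdot> u)"
    if "u \<in> Arr C" "Cod C u = Dom C m1'" for u
    using that mj by (simp_all add: mj[THEN reassoc])
  show ?thesis
    unfolding descent_datum_def
  proof (intro conjI allI impI m')
    fix u assume [simp]: "u \<in> Arr C" "Cod C u = Dom C m1'" and "m1' \<cdot> u = f \<cdot> (m2' \<cdot> u)"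
    then show "(\<xi> \<cdot> j) \<cdot> u = m2' \<cdot> u"
      using datum_unit[OF d, of "j \<cdot> u"] by (simp add: a)
  next
    fix u u' v assume [simp]: "u \<in> Arr C" "u' \<in> Arr C" "v \<in> Arr C" "Dom C u' = Dom C u" "Dom C v = Dom C u"
      "Cod C u = Dom C m1'" "Cod C u' = Dom C m1'" "Cod C v = Dom C m1'" and
      "m2' \<cdot> v = (\<xi> \<cdot> j) \<cdot> u" "m1' \<cdot> u' = m1' \<cdot> v" "m2' \<cdot> u' = m2' \<cdot> u"
    then show "(\<xi> \<cdot> j) \<cdot> v = (\<xi> \<cdot> j) \<cdot> u'"
      using datum_assoc[OF d, of "j \<cdot> u" "j \<cdot> u'" "j \<cdot> v"] by (simp add: a)
  qed (simp_all add: mj D(6)[THEN reassoc])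
qed

end

context category_pb
begin

text \<open>Extends cancellation to arrows that lie over some base \<open>\<beta>\<close> instead of
  over the codomain of \<open>q\<close>: lifted to the pullback of \<open>\<gamma>\<close> along
  \<open>\<beta>\<close>, both become arrows over that codomain.\<close>

lemma stable_epi_cancel:
  assumes q: "stable_epi C q" and pb: "is_pullback C q \<alpha> k q'"
    and [simp]: "\<gamma> \<in> Arr C" "\<beta> \<in> Arr C" "Cod C \<beta> = Cod C \<gamma>" "Dom C \<beta> = Cod C q" "u \<in> Arr C" "v \<in> Arr C"
    "Dom C u = Dom C \<alpha>" "Dom C v = Dom C \<alpha>" "Cod C u = Dom C \<gamma>" "Cod C v = Dom C \<gamma>"
    "\<gamma> \<cdot> u = \<beta> \<cdot> \<alpha>" "\<gamma> \<cdot> v = \<beta> \<cdot> \<alpha>" and eq: "u \<cdot> q' = v \<cdot> q'"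
  shows "u = v"
proof -
  note P [simp] = pullback_arrs(1-8)[OF pb]
  let ?p = "pb_fst C \<gamma> \<beta>" and ?\<gamma> = "pb_snd C \<gamma> \<beta>"
  let ?u = "pb_pair C \<gamma> \<beta> u \<alpha>" and ?v = "pb_pair C \<gamma> \<beta> v \<alpha>"
  have uv: "?p \<cdot> ?u = u" "?p \<cdot> ?v = v" "?\<gamma> \<cdot> ?u = \<alpha>" "?\<gamma> \<cdot> ?v = \<alpha>"
    by simp_all
  have "?u = ?v"
  proof (rule stable_epiD[OF q pb, of ?\<gamma>])
    show "?u \<cdot> q' = ?v \<cdot> q'"
      by (rule pb_eq[of \<gamma> \<beta>]) (simp_all add: uv[THEN reassoc] eq)
  qed simp_all
  then show ?thesis
    using uv by metis
qed

text \<open>The same base change for quotients. The lift of \<open>t\<close> stays constant on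
  fibres because its second component is already a composite with \<open>q'\<close>.\<close>

lemma stable_quot_factor:
  assumes q: "stable_quot C q" and pb: "is_pullback C q \<alpha> k q'"
    and [simp]: "\<gamma> \<in> Arr C" "\<beta> \<in> Arr C" "Cod C \<beta> = Cod C \<gamma>" "Dom C \<beta> = Cod C q" "t \<in> Arr C"
    "Dom C t = Dom C q'" "Cod C t = Dom C \<gamma>" "\<gamma> \<cdot> t = \<beta> \<cdot> (\<alpha> \<cdot> q')" and fc: "fibrewise_constant C q' t"
  obtains u where "u \<in> Arr C" "Dom C u = Dom C \<alpha>" "Cod C u = Dom C \<gamma>" "u \<cdot> q' = t" "\<gamma> \<cdot> u = \<beta> \<cdot> \<alpha>"
proof -
  note P [simp] = pullback_arrs(1-8)[OF pb]
  let ?p = "pb_fst C \<gamma> \<beta>" and ?\<gamma> = "pb_snd C \<gamma> \<beta>" and ?t = "pb_pair C \<gamma> \<beta> t (\<alpha> \<cdot> q')"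
  have t: "?p \<cdot> ?t = t" "?\<gamma> \<cdot> ?t = \<alpha> \<cdot> q'"
    by simp_all
  have "fibrewise_constant C q' ?t"
    unfolding fibrewise_constant_def
  proof (intro allI impI)
    fix r r' assume a [simp]: "r \<in> Arr C" "r' \<in> Arr C" "Dom C r = Dom C r'" "Cod C r = Dom C q'"
      "Cod C r' = Dom C q'" "q' \<cdot> r = q' \<cdot> r'"
    have [simp]: "t \<cdot> r = t \<cdot> r'"
      by (rule fibrewise_constantD[OF fc a])
    show "?t \<cdot> r = ?t \<cdot> r'"
      by (rule pb_eq[of \<gamma> \<beta>]) (simp_all add: t[THEN reassoc])
  qed
  then obtain u where [simp]: "u \<in> Arr C" "Dom C u = Dom C \<alpha>" "Cod C u = Dom C ?\<gamma>" "u \<cdot> q' = ?t" "?\<gamma> \<cdot> u = \<alpha>"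
    by - (rule stable_quotD[OF q pb, of ?\<gamma> ?t], simp_all)
  show thesis
    by (rule that[of "?p \<cdot> u"]) (simp_all add: pb_square[THEN reassoc])
qed

end

section \<open>Slices, algebras and the comparison functor\<close>

lemma categoryI:
  assumes "\<And>f. f \<in> Arr C \<Longrightarrow> Dom C f \<in> Obj C \<and> Cod C f \<in> Obj C"
    and "\<And>a. a \<in> Obj C \<Longrightarrow> Ident C a \<in> Arr C \<and> Dom C (Ident C a) = a \<and> Cod C (Ident C a) = a"
    and "\<And>f g. f \<in> Arr C \<Longrightarrow> g \<in> Arr C \<Longrightarrow> Cod C f = Dom C g \<Longrightarrow>
      g \<cdot>\<^bsub>C\<^esub> f \<in> Arr C \<and> Dom C (g \<cdot>\<^bsub>C\<^esub> f) = Dom C f \<and> Cod C (g \<cdot>\<^bsub>C\<^esub> f) = Cod C g"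
    and "\<And>f. f \<in> Arr C \<Longrightarrow> f \<cdot>\<^bsub>C\<^esub> Ident C (Dom C f) = f \<and> Ident C (Cod C f) \<cdot>\<^bsub>C\<^esub> f = f"
    and "\<And>f g h. f \<in> Arr C \<Longrightarrow> g \<in> Arr C \<Longrightarrow> h \<in> Arr C \<Longrightarrow> Cod C f = Dom C g \<Longrightarrow> Cod C g = Dom C h \<Longrightarrow>
      h \<cdot>\<^bsub>C\<^esub> (g \<cdot>\<^bsub>C\<^esub> f) = (h \<cdot>\<^bsub>C\<^esub> g) \<cdot>\<^bsub>C\<^esub> f"
  shows "category C"
proof -
  have H: "f \<in> Hom C a b \<longleftrightarrow> f \<in> Arr C \<and> Dom C f = a \<and> Cod C f = b" for f a b
    by (simp add: Hom_def)
  show ?thesis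
  proof (unfold_locales, unfold H, goal_cases)
    case (5 f a b) then show ?case using assms(4)[of f] by simp
  next
    case (6 f a b) then show ?case using assms(4)[of f] by simp
  next
    case (7 f a b g c h d) then show ?case using assms(5)[of f g h] by simp
  qed (use assms(1-3) in simp_all)
qed

lemma Slice_simps [simp]:
  "f \<in> Obj (Slice C b) \<longleftrightarrow> f \<in> Arr C \<and> Cod C f = b"
  "(f, h, g) \<in> Arr (Slice C b) \<longleftrightarrow> f \<in> Arr C \<and> Cod C f = b \<and> g \<in> Arr C \<and> Cod C g = b \<and>
     h \<in> Hom C (Dom C f) (Dom C g) \<and> g \<cdot>\<^bsub>C\<^esub> h = f"
  "Dom (Slice C b) (f, h, g) = f" "Cod (Slice C b) (f, h, g) = g"
  "Ident (Slice C b) f = (f, Ident C (Dom C f), f)"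
  "(f', k, g') \<cdot>\<^bsub>Slice C b\<^esub> (f, h, g) = (f, k \<cdot>\<^bsub>C\<^esub> h, g')"
  by (auto simp: Slice_def)

lemma Alg_simps [simp]:
  "A \<in> Obj (Alg C T) \<longleftrightarrow> is_algebra C T A"
  "(A, h, B) \<in> Arr (Alg C T) \<longleftrightarrow> is_algebra C T A \<and> is_algebra C T B \<and> h \<in> Hom C (fst A) (fst B) \<and>
     h \<cdot>\<^bsub>C\<^esub> snd A = snd B \<cdot>\<^bsub>C\<^esub> MArr T h"
  "Dom (Alg C T) (A, h, B) = A" "Cod (Alg C T) (A, h, B) = B"
  "Ident (Alg C T) A = (A, Ident C (fst A), A)"
  "(A', k, B') \<cdot>\<^bsub>Alg C T\<^esub> (A, h, B) = (A, k \<cdot>\<^bsub>C\<^esub> h, B')"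
  by (auto simp: Alg_def)

lemma (in category) Slice_category: "category (Slice C b)"
proof (rule categoryI, goal_cases)
  case (1 f) then show ?case by (cases f) simp
next
  case (2 a) then show ?case by (simp add: in_Hom)
next
  case (3 f g)
  obtain x h y where f: "f = (x, h, y)" by (cases f)
  obtain y' k z where g: "g = (y', k, z)" by (cases g)
  have "z \<cdot> k = y" "y \<cdot> h = x" "h \<in> Arr C" "k \<in> Arr C" "z \<in> Arr C" "Cod C h = Dom C k" "Cod C k = Dom C z"
    using 3 f g by (simp_all add: in_Hom)
  then have "z \<cdot> (k \<cdot> h) = x"
    by (simp add: reassoc)
  then show ?case
    using 3 f g by (simp add: in_Hom)
next
  case (4 f) then show ?case by (cases f) (simp add: in_Hom)
next
  case (5 f g h) then show ?case
    by (cases f; cases g; cases h) (simp add: in_Hom)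
qed

lemma Alg_category:
  assumes "cat_functor C C (MFun T)"
  shows "category (Alg C T)"
proof -
  interpret T: cat_functor C C "MFun T" by fact
  have algD: "fst A \<in> Obj C \<and> snd A \<in> Arr C \<and> Dom C (snd A) = MObj T (fst A) \<and> Cod C (snd A) = fst A"
    if "is_algebra C T A" for A
    using that unfolding is_algebra_def by (cases A) (simp add: T.dom.in_Hom)
  show ?thesis
  proof (rule categoryI, goal_cases)
    case (1 f) then show ?case by (cases f) simp
  next
    case (2 A) then show ?case using algD[of A] by (simp add: T.dom.in_Hom)
  next
    case (3 f g)
    obtain A h B where f: "f = (A, h, B)" by (cases f)
    obtain B' k D where g: "g = (B', k, D)" by (cases g)
    have [simp]: "B' = B" using 3 f g by simp
    have a: "is_algebra C T A" "is_algebra C T B" "is_algebra C T D"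
      using 3 f g by simp_all
    note [simp] = a algD[OF a(1), THEN conjunct1] algD[OF a(1), THEN conjunct2]
      algD[OF a(2), THEN conjunct1] algD[OF a(2), THEN conjunct2]
      algD[OF a(3), THEN conjunct1] algD[OF a(3), THEN conjunct2]
    have h [simp]: "h \<in> Arr C" "Dom C h = fst A" "Cod C h = fst B"
      and k [simp]: "k \<in> Arr C" "Dom C k = fst B" "Cod C k = fst D"
      and eq: "h \<cdot>\<^bsub>C\<^esub> snd A = snd B \<cdot>\<^bsub>C\<^esub> MArr T h" "k \<cdot>\<^bsub>C\<^esub> snd B = snd D \<cdot>\<^bsub>C\<^esub> MArr T k"
      using 3 f g by (simp_all add: T.dom.in_Hom)
    show ?case
      using f g by (simp add: T.dom.in_Hom eq eq(2)[THEN T.dom.reassoc])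
  next
    case (4 f) then show ?case by (cases f) (simp add: T.dom.in_Hom)
  next
    case (5 f g h) then show ?case
      by (cases f; cases g; cases h) (simp add: T.dom.in_Hom)
  qed
qed

section \<open>The descent monad and the comparison functor of one arrow\<close>

locale base_arrow = category_pb +
  fixes q :: 'm
  assumes q_arr [simp]: "q \<in> Arr C"
begin

abbreviation "e \<equiv> Dom C q"
abbreviation "b \<equiv> Cod C q"
abbreviation "P1 g \<equiv> pb_fst C q g"
abbreviation "P2 g \<equiv> pb_snd C q g"
abbreviation "pullb f h g \<equiv> pb_pair C q g (P1 f) (h \<cdot> P2 f)"

lemma q_square: "g \<in> Arr C \<Longrightarrow> Cod C g = b \<Longrightarrow> q \<cdot> P1 g = g \<cdot> P2 g"
  by (rule pb_square) simp_all

lemma pullb [simp]: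
  assumes "f \<in> Arr C" "Cod C f = b" "g \<in> Arr C" "Cod C g = b" "h \<in> Arr C" "Dom C h = Dom C f"
    "Cod C h = Dom C g" and gh: "g \<cdot> h = f"
  shows "pullb f h g \<in> Arr C" "Dom C (pullb f h g) = Dom C (P1 f)" "Cod C (pullb f h g) = Dom C (P1 g)"
    "P1 g \<cdot> pullb f h g = P1 f" "P2 g \<cdot> pullb f h g = h \<cdot> P2 f"
  using assms by (simp_all add: q_square gh[THEN reassoc])

sublocale slice_b: category "Slice C b" by (rule Slice_category)
sublocale slice_e: category "Slice C e" by (rule Slice_category)

lemma slice_pull_simps [simp]:
  "FObj (slice_pull C q) f = P1 f" "FArr (slice_pull C q) (f, h, g) = (P1 f, pullb f h g, P1 g)"
  by (simp_all add: slice_pull_def)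

lemma slice_post_simps [simp]:
  "FObj (slice_post C q) f = q \<cdot> f" "FArr (slice_post C q) (f, h, g) = (q \<cdot> f, h, q \<cdot> g)"
  by (simp_all add: slice_post_def)

lemma slice_pull_functor: "cat_functor (Slice C b) (Slice C e) (slice_pull C q)"
proof (rule cat_functorI, goal_cases)
  case (4 f) then show ?case by (cases f) (simp add: in_Hom)
next
  case (5 a) then show ?case by simp (rule pb_eq[of q a]; simp add: q_square)
next
  case (6 f g)
  obtain x h y where f: "f = (x, h, y)" by (cases f)
  obtain y' k z where g: "g = (y', k, z)" by (cases g)
  have [simp]: "x \<in> Arr C" "Cod C x = b" "y \<in> Arr C" "Cod C y = b" "z \<in> Arr C" "Cod C z = b"
    "h \<in> Arr C" "Dom C h = Dom C x" "Cod C h = Dom C y" "k \<in> Arr C" "Dom C k = Dom C y"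
    "Cod C k = Dom C z" "y' = y" and eq [simp]: "y \<cdot> h = x" "z \<cdot> k = y"
    using 6 f g by (simp_all add: in_Hom)
  have [simp]: "z \<cdot> (k \<cdot> h) = x"
    by (simp add: eq(2)[THEN reassoc])
  have "pullb x (k \<cdot> h) z = pullb y k z \<cdot> pullb x h y"
    by (rule pb_eq[of q z]; (simp; fail)?)
      (simp_all add: pullb(4,5)[THEN reassoc] del: comp_assoc, simp)
  then show ?case
    using f g by simp
qed (simp_all add: slice_b.category_axioms slice_e.category_axioms)

lemma slice_post_functor: "cat_functor (Slice C e) (Slice C b) (slice_post C q)"
proof (rule cat_functorI, goal_cases)
  case (4 f) then show ?case by (cases f) (auto simp add: in_Hom)
next
  case (6 f g) then show ?case by (cases f; cases g) simp
qed (simp_all add: slice_b.category_axioms slice_e.category_axioms)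

lemma MFun_descent_monad: "MFun (descent_monad C q) = slice_pull C q \<circ>\<^sub>F slice_post C q"
  by (simp add: descent_monad_def induced_monad_def)

lemma descent_monad_simps [simp]:
  "MObj (descent_monad C q) f = P1 (q \<cdot> f)"
  "MArr (descent_monad C q) (f, h, g) = (P1 (q \<cdot> f), pullb (q \<cdot> f) h (q \<cdot> g), P1 (q \<cdot> g))"
  "MMult (descent_monad C q) f =
     (P1 (q \<cdot> P1 (q \<cdot> f)), pullb (q \<cdot> P1 (q \<cdot> f)) (P2 (q \<cdot> f)) (q \<cdot> f), P1 (q \<cdot> f))"
  "MUnit (descent_monad C q) f = (f, pb_pair C q (q \<cdot> f) f (Ident C (Dom C f)), P1 (q \<cdot> f))"
  by (simp_all add: descent_monad_def induced_monad_def comp_func_def slice_counit_def slice_unit_def)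

lemma descent_monad_functor: "cat_functor (Slice C e) (Slice C e) (MFun (descent_monad C q))"
  by (simp add: MFun_descent_monad comp_func_functor[OF slice_post_functor slice_pull_functor])

abbreviation "T \<equiv> descent_monad C q"
abbreviation "AlgT \<equiv> Alg (Slice C e) T"

sublocale alg: category AlgT
  by (rule Alg_category) (rule descent_monad_functor)

text \<open>The structure map of an algebra is a slice arrow whose ends are forced by the carrier,
  so only \<open>f\<close> and the underlying arrow \<open>\<xi>\<close> carry information.\<close>

definition alg :: "'m \<Rightarrow> 'm \<Rightarrow> 'm \<times> 'm \<times> 'm \<times> 'm" where
  "alg f \<xi> = (f, P1 (q \<cdot> f), \<xi>, f)"

text \<open>Each algebra law is the corresponding law of a descent datum at the universal
  generalized element. Conversely every element satisfying the premises of the datum law factors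
  through the universal one.\<close>

lemma algebra_iff:
  "is_algebra (Slice C e) T A \<longleftrightarrow>
     (\<exists>f \<xi>. A = alg f \<xi> \<and> descent_datum C q f (P1 (q \<cdot> f)) (P2 (q \<cdot> f)) \<xi>)"
proof
  assume A: "is_algebra (Slice C e) T A"
  obtain f F \<xi> G where AA: "A = (f, F, \<xi>, G)" by (cases A)
  have raw: "f \<in> Obj (Slice C e)" "(F, \<xi>, G) \<in> Hom (Slice C e) (MObj T f) f"
    "(F, \<xi>, G) \<cdot>\<^bsub>Slice C e\<^esub> MUnit T f = Ident (Slice C e) f"
    "(F, \<xi>, G) \<cdot>\<^bsub>Slice C e\<^esub> MMult T f = (F, \<xi>, G) \<cdot>\<^bsub>Slice C e\<^esub> MArr T (F, \<xi>, G)"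
    using A unfolding is_algebra_def AA by (simp_all only: prod.case)
  have F: "F = P1 (q \<cdot> f)" and G: "G = f"
    using raw(2) unfolding slice_e.in_Hom by simp_all
  have AD: "f \<in> Arr C" "Cod C f = e" "\<xi> \<in> Arr C" "Dom C \<xi> = Dom C (P1 (q \<cdot> f))"
    "Cod C \<xi> = Dom C f" "f \<cdot> \<xi> = P1 (q \<cdot> f)"
    using raw(1,2) unfolding slice_e.in_Hom F G by (simp_all add: in_Hom)
  have unit: "\<xi> \<cdot> pb_pair C q (q \<cdot> f) f (Ident C (Dom C f)) = Ident C (Dom C f)"
    and mult: "\<xi> \<cdot> pullb (q \<cdot> P1 (q \<cdot> f)) (P2 (q \<cdot> f)) (q \<cdot> f) = \<xi> \<cdot> pullb (q \<cdot> P1 (q \<cdot> f)) \<xi> (q \<cdot> f)"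
    using raw(3,4) unfolding F G by simp_all
  note [simp] = AD AD(6)[THEN reassoc]
  have "descent_datum C q f (P1 (q \<cdot> f)) (P2 (q \<cdot> f)) \<xi>"
    unfolding descent_datum_def
  proof (intro conjI allI impI)
    fix u assume [simp]: "u \<in> Arr C" "Cod C u = Dom C (P1 (q \<cdot> f))" "P1 (q \<cdot> f) \<cdot> u = f \<cdot> (P2 (q \<cdot> f) \<cdot> u)"
    let ?\<eta> = "pb_pair C q (q \<cdot> f) f (Ident C (Dom C f))"
    have eta: "P1 (q \<cdot> f) \<cdot> ?\<eta> = f" "P2 (q \<cdot> f) \<cdot> ?\<eta> = Ident C (Dom C f)"
      by simp_all
    \<comment> \<open>An element with \<open>P1 (q \<cdot> f) \<cdot> u = f \<cdot> (P2 (q \<cdot>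
      f) \<cdot> u)\<close> comes from the unit of the monad.\<close>
    have "u = ?\<eta> \<cdot> (P2 (q \<cdot> f) \<cdot> u)"
      by (rule pb_eq[of q "q \<cdot> f"]) (simp_all add: eta[THEN reassoc])
    then have "\<xi> \<cdot> u = \<xi> \<cdot> (?\<eta> \<cdot> (P2 (q \<cdot> f) \<cdot> u))"
      by simp
    also have "\<dots> = P2 (q \<cdot> f) \<cdot> u"
      by (simp add: unit[THEN reassoc])
    finally show "\<xi> \<cdot> u = P2 (q \<cdot> f) \<cdot> u" .
  next
    fix u u' v assume u [simp]: "u \<in> Arr C" "u' \<in> Arr C" "v \<in> Arr C" "Dom C u' = Dom C u" "Dom C v = Dom C u"
      "Cod C u = Dom C (P1 (q \<cdot> f))" "Cod C u' = Dom C (P1 (q \<cdot> f))" "Cod C v = Dom C (P1 (q \<cdot> f))"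
      and e: "P2 (q \<cdot> f) \<cdot> v = \<xi> \<cdot> u" "P1 (q \<cdot> f) \<cdot> u' = P1 (q \<cdot> f) \<cdot> v" "P2 (q \<cdot> f) \<cdot> u' = P2 (q \<cdot> f) \<cdot> u"
    let ?g = "q \<cdot> P1 (q \<cdot> f)"
    have "q \<cdot> (P1 (q \<cdot> f) \<cdot> v) = q \<cdot> (f \<cdot> (P2 (q \<cdot> f) \<cdot> v))"
      by (simp add: q_square[THEN reassoc])
    also have "\<dots> = q \<cdot> (P1 (q \<cdot> f) \<cdot> u)"
      by (simp add: e)
    finally have [simp]: "q \<cdot> (P1 (q \<cdot> f) \<cdot> v) = q \<cdot> (P1 (q \<cdot> f) \<cdot> u)" .
    \<comment> \<open>The element of the twice iterated pullback given by the target point of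
      \<open>v\<close> and by \<open>u\<close>. The two arrows of the multiplication law send it to
      \<open>v\<close> and to \<open>u'\<close>.\<close>
    define n where "n = pb_pair C q ?g (P1 (q \<cdot> f) \<cdot> v) u"
    have n [simp]: "n \<in> Arr C" "Dom C n = Dom C u" "Cod C n = Dom C (P1 ?g)" "P1 ?g \<cdot> n = P1 (q \<cdot> f) \<cdot> v" "P2 ?g \<cdot> n = u"
      unfolding n_def by simp_all
    have l: "P1 (q \<cdot> f) \<cdot> pullb ?g h (q \<cdot> f) = P1 ?g" "P2 (q \<cdot> f) \<cdot> pullb ?g h (q \<cdot> f) = h \<cdot> P2 ?g"
      "pullb ?g h (q \<cdot> f) \<in> Arr C" "Dom C (pullb ?g h (q \<cdot> f)) = Dom C (P1 ?g)"
      "Cod C (pullb ?g h (q \<cdot> f)) = Dom C (P1 (q \<cdot> f))"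
      if "h \<in> Arr C" "Dom C h = Dom C (P1 (q \<cdot> f))" "Cod C h = Dom C f" "q \<cdot> (f \<cdot> h) = ?g" for h
      using that by simp_all
    note L1 = l[of "P2 (q \<cdot> f)"] and L2 = l[of \<xi>]
    have fP: "q \<cdot> (f \<cdot> P2 (q \<cdot> f)) = ?g"
      by (simp add: q_square)
    note [simp] = L1(3-5)[OF _ _ _ fP] L2(3-5)
    have "v = pullb ?g \<xi> (q \<cdot> f) \<cdot> n"
      by (rule pb_eq[of q "q \<cdot> f"]) (simp_all add: L2(1,2)[THEN reassoc] e)
    then have "\<xi> \<cdot> v = \<xi> \<cdot> (pullb ?g \<xi> (q \<cdot> f) \<cdot> n)"
      by simp
    also have "\<dots> = \<xi> \<cdot> (pullb ?g (P2 (q \<cdot> f)) (q \<cdot> f) \<cdot> n)"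
      by (simp add: mult[THEN reassoc])
    also have "pullb ?g (P2 (q \<cdot> f)) (q \<cdot> f) \<cdot> n = u'"
      by (rule pb_eq[of q "q \<cdot> f"]) (simp_all add: L1(1,2)[OF _ _ _ fP, THEN reassoc] e)
    finally show "\<xi> \<cdot> v = \<xi> \<cdot> u'" .
  qed (simp_all add: pb_pullback)
  then show "\<exists>f \<xi>. A = alg f \<xi> \<and> descent_datum C q f (P1 (q \<cdot> f)) (P2 (q \<cdot> f)) \<xi>"
    using AA F G unfolding alg_def by blast
next
  assume "\<exists>f \<xi>. A = alg f \<xi> \<and> descent_datum C q f (P1 (q \<cdot> f)) (P2 (q \<cdot> f)) \<xi>"
  then obtain f \<xi> where A: "A = alg f \<xi>" and d: "descent_datum C q f (P1 (q \<cdot> f)) (P2 (q \<cdot> f)) \<xi>"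
    by blast
  note D [simp] = datumD(1,2,4-7)[OF d]
  let ?g = "q \<cdot> P1 (q \<cdot> f)" and ?\<eta> = "pb_pair C q (q \<cdot> f) f (Ident C (Dom C f))"
  have [simp]: "q \<cdot> (f \<cdot> P2 (q \<cdot> f)) = ?g"
    by (simp add: q_square)
  have "\<xi> \<cdot> ?\<eta> = P2 (q \<cdot> f) \<cdot> ?\<eta>"
    by (rule datum_unit[OF d]) simp_all
  moreover have "\<xi> \<cdot> pullb ?g \<xi> (q \<cdot> f) = \<xi> \<cdot> pullb ?g (P2 (q \<cdot> f)) (q \<cdot> f)"
    by (rule datum_assoc[OF d, of "P2 ?g"]) simp_all
  ultimately show "is_algebra (Slice C e) T A"
    unfolding is_algebra_def A alg_def by (simp add: in_Hom slice_e.in_Hom)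
qed

lemma alg_hom_iff:
  assumes d: "descent_datum C q f (P1 (q \<cdot> f)) (P2 (q \<cdot> f)) \<xi>"
    and d': "descent_datum C q f' (P1 (q \<cdot> f')) (P2 (q \<cdot> f')) \<xi>'"
  shows "(alg f \<xi>, (f1, h, f2), alg f' \<xi>') \<in> Arr AlgT \<longleftrightarrow>
    f1 = f \<and> f2 = f' \<and> h \<in> Arr C \<and> Dom C h = Dom C f \<and> Cod C h = Dom C f' \<and> f' \<cdot> h = f \<and>
    h \<cdot> \<xi> = \<xi>' \<cdot> pullb (q \<cdot> f) h (q \<cdot> f')"
  using datumD(1,2)[OF d] datumD(1,2)[OF d'] algebra_iff[of "alg f \<xi>"] algebra_iff[of "alg f' \<xi>'"] d d'
  by (auto simp: alg_def in_Hom slice_e.in_Hom)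

abbreviation "xi d \<equiv> pullb (q \<cdot> P1 d) (P2 d) d"

lemma comparison_datum:
  assumes [simp]: "d \<in> Arr C" "Cod C d = b"
  shows "descent_datum C q (P1 d) (P1 (q \<cdot> P1 d)) (P2 (q \<cdot> P1 d)) (xi d)"
  by (rule datum_of_pullback[OF pb_pullback[of q d] pb_pullback]) (simp_all add: q_square)

lemma comparison_simps:
  "FObj (descent_comparison C q) d = alg (P1 d) (xi d)"
  "FArr (descent_comparison C q) (d, h, d') =
     (alg (P1 d) (xi d), (P1 d, pullb d h d', P1 d'), alg (P1 d') (xi d'))"
  by (simp_all add: descent_comparison_def EM_comparison_def slice_counit_def alg_def Let_def)

lemma comparison_transport:
  assumes [simp]: "d \<in> Arr C" "Cod C d = b"
  shows "P1 d \<cdot> xi d = P1 (q \<cdot> P1 d)" "P2 d \<cdot> xi d = P2 d \<cdot> P2 (q \<cdot> P1 d)"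
    "xi d \<in> Arr C" "Dom C (xi d) = Dom C (P1 (q \<cdot> P1 d))" "Cod C (xi d) = Dom C (P1 d)"
  by (simp_all add: q_square)

text \<open>The two sides of the homomorphism law agree after \<open>P1 d'\<close> anyway, so the
  law says that \<open>P2 d' \<cdot> h\<close> does not distinguish \<open>xi d\<close> from
  \<open>P2 (q \<cdot> P1 d)\<close>. By \<open>kernel_transport\<close> these two arrows generate
  the kernel pair of \<open>P2 d\<close>.\<close>

lemma comparison_hom_iff:
  assumes d [simp]: "d \<in> Arr C" "Cod C d = b" "d' \<in> Arr C" "Cod C d' = b"
    and h [simp]: "h \<in> Arr C" "Dom C h = Dom C (P1 d)" "Cod C h = Dom C (P1 d')" "P1 d' \<cdot> h = P1 d"
  shows "h \<cdot> xi d = xi d' \<cdot> pullb (q \<cdot> P1 d) h (q \<cdot> P1 d') \<longleftrightarrow> fibrewise_constant C (P2 d) (P2 d' \<cdot> h)"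
proof -
  let ?G = "pullb (q \<cdot> P1 d) h (q \<cdot> P1 d')"
  have G: "?G \<in> Arr C" "Dom C ?G = Dom C (P1 (q \<cdot> P1 d))" "Cod C ?G = Dom C (P1 (q \<cdot> P1 d'))"
    "P1 (q \<cdot> P1 d') \<cdot> ?G = P1 (q \<cdot> P1 d)" "P2 (q \<cdot> P1 d') \<cdot> ?G = h \<cdot> P2 (q \<cdot> P1 d)"
    by simp_all
  note X = comparison_transport[OF d(1,2)] and X' = comparison_transport[OF d(3,4)]
  \<comment> \<open>Opaque names hide the pairings from the simplifier, which then sees only the
    collected equations.\<close>
  define G where "G = ?G"
  define x where "x = xi d"
  define x' where "x' = xi d'"
  note G = G[folded G_def] and X = X[folded x_def] and X' = X'[folded x'_def]
  note [simp] = G G(4,5)[THEN reassoc] X X(1,2)[THEN reassoc] X' X'(1,2)[THEN reassoc] h(4)[THEN reassoc]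
  have "h \<cdot> x = x' \<cdot> G \<longleftrightarrow> fibrewise_constant C (P2 d) (P2 d' \<cdot> h)"
  proof
    assume eq: "h \<cdot> x = x' \<cdot> G"
    have eq': "P2 d' \<cdot> (h \<cdot> x) = P2 d' \<cdot> (h \<cdot> P2 (q \<cdot> P1 d))"
      by (simp add: eq)
    show "fibrewise_constant C (P2 d) (P2 d' \<cdot> h)"
      unfolding fibrewise_constant_def
    proof (intro allI impI)
      fix r r' assume a [simp]: "r \<in> Arr C" "r' \<in> Arr C" "Dom C r = Dom C r'" "Cod C r = Dom C (P2 d)"
        "Cod C r' = Dom C (P2 d)" and e: "P2 d \<cdot> r = P2 d \<cdot> r'"
      obtain u where u [simp]: "u \<in> Arr C" "Dom C u = Dom C r'" "Cod C u = Dom C (P1 (q \<cdot> P1 d))"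
          "P2 (q \<cdot> P1 d) \<cdot> u = r" "x \<cdot> u = r'"
        by (rule kernel_transport[OF pb_pullback[of q d] pb_pullback[of q "q \<cdot> P1 d"], of x r r'])
          (use e in simp_all)
      show "(P2 d' \<cdot> h) \<cdot> r = (P2 d' \<cdot> h) \<cdot> r'"
        using arg_cong[OF eq', of "\<lambda>w. w \<cdot> u"] by simp
    qed
  next
    assume fc: "fibrewise_constant C (P2 d) (P2 d' \<cdot> h)"
    have "(P2 d' \<cdot> h) \<cdot> x = (P2 d' \<cdot> h) \<cdot> P2 (q \<cdot> P1 d)"
      by (rule fibrewise_constantD[OF fc]) simp_all
    then show "h \<cdot> x = x' \<cdot> G"
      by - (rule pb_eq[of q d'], simp_all)
  qed
  then show ?thesis
    unfolding G_def x_def x'_def .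
qed

lemma comparison_functor: "cat_functor (Slice C b) AlgT (descent_comparison C q)"
proof (rule cat_functorI, goal_cases)
  case (3 d)
  then show ?case
    using comparison_datum[of d] by (simp add: comparison_simps(1) algebra_iff) blast
next
  case (4 f)
  obtain d h d' where f: "f = (d, h, d')" by (cases f)
  have d: "d \<in> Arr C" "Cod C d = b" "d' \<in> Arr C" "Cod C d' = b"
    and h: "h \<in> Arr C" "Dom C h = Dom C d" "Cod C h = Dom C d'" "d' \<cdot> h = d"
    using 4 f by (simp_all add: in_Hom)
  note l = pullb[OF d h]
  have "fibrewise_constant C (P2 d) (P2 d' \<cdot> pullb d h d')"
    unfolding fibrewise_constant_def l(5) using d h by simp
  then have "pullb d h d' \<cdot> xi d = xi d' \<cdot> pullb (q \<cdot> P1 d) (pullb d h d') (q \<cdot> P1 d')"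
    using comparison_hom_iff[OF d l(1-4)] by blast
  then show ?case
    using alg_hom_iff[OF comparison_datum[OF d(1,2)] comparison_datum[OF d(3,4)]] l
    by (simp add: f comparison_simps)
next
  case (5 d)
  then show ?case
    using slice_b.ident_arr[of d] cat_functor.FArr_ident[OF slice_pull_functor, of d]
    by (simp add: comparison_simps) (simp add: alg_def)
next
  case (6 f g)
  obtain x h y where f: "f = (x, h, y)" by (cases f)
  obtain y' k z where g: "g = (y', k, z)" by (cases g)
  show ?case
    using 6 cat_functor.FArr_comp[OF slice_pull_functor, of g f] f g by (simp add: comparison_simps)
qed (simp_all add: slice_b.category_axioms alg.category_axioms)


section \<open>Faithfulness, fullness and essential surjectivity of the comparison functor\<close>

lemma slice_hom:
  "x \<in> Hom (Slice C c) f g \<longleftrightarrow> (\<exists>h. x = (f, h, g) \<and> f \<in> Arr C \<and> Cod C f = c \<and> g \<in> Arr C \<and> Cod C g = c \<and>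
     h \<in> Arr C \<and> Dom C h = Dom C f \<and> Cod C h = Dom C g \<and> g \<cdot> h = f)"
  by (cases x) (auto simp: Hom_def)

lemma slice_homE:
  assumes "x \<in> Hom (Slice C c) f g"
  obtains h where "x = (f, h, g)" "f \<in> Arr C" "Cod C f = c" "g \<in> Arr C" "Cod C g = c"
    "h \<in> Arr C" "Dom C h = Dom C f" "Cod C h = Dom C g" "g \<cdot> h = f"
  using assms unfolding slice_hom by blast

text \<open>The comparison functor sends \<open>u\<close> to the pairing with second component
  \<open>u \<cdot> P2 \<alpha>\<close>, so it identifies two arrows exactly when they agree after
  \<open>P2 \<alpha>\<close>. Arbitrary pullbacks are reached through the isomorphism with the
  chosen one.\<close>

lemma faithful_iff_stable_epi:
  "faithful (Slice C b) AlgT (descent_comparison C q) \<longleftrightarrow> stable_epi C q"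
proof
  assume f: "faithful (Slice C b) AlgT (descent_comparison C q)"
  show "stable_epi C q"
    unfolding stable_epi_def
  proof (intro allI impI)
    fix \<alpha> k q' \<gamma> u v
    assume pb: "is_pullback C q \<alpha> k q'" and [simp]: "\<gamma> \<in> Arr C" "u \<in> Arr C" "v \<in> Arr C"
      "Dom C u = Dom C \<alpha>" "Dom C v = Dom C \<alpha>" "Cod C u = Dom C \<gamma>" "Cod C v = Dom C \<gamma>"
      and g: "\<gamma> \<cdot> u = \<alpha>" "\<gamma> \<cdot> v = \<alpha>" and e: "u \<cdot> q' = v \<cdot> q'"
    note P [simp] = pullback_arrs(1-8)[OF pb]
    have "Cod C \<gamma> = Cod C (\<gamma> \<cdot> u)"
      by simp
    then have [simp]: "Cod C \<gamma> = b"
      using g(1) P(5) by simp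
    obtain j where [simp]: "j \<in> Arr C" "Dom C j = Dom C (P2 \<alpha>)" "Cod C j = Dom C q'" and j: "q' \<cdot> j = P2 \<alpha>"
      using pullback_comparison[OF pb pb_pullback[of q \<alpha>]] by (metis P(1,2,5,8) pb_arrs(5))
    have "u \<cdot> P2 \<alpha> = v \<cdot> P2 \<alpha>"
      unfolding j[symmetric] by (simp add: e[THEN reassoc])
    then have K: "FArr (descent_comparison C q) (\<alpha>, u, \<gamma>) = FArr (descent_comparison C q) (\<alpha>, v, \<gamma>)"
      by (simp add: comparison_simps)
    have inj: "inj_on (FArr (descent_comparison C q)) (Hom (Slice C b) \<alpha> \<gamma>)"
      using f unfolding faithful_def by simp
    have "(\<alpha>, u, \<gamma>) = (\<alpha>, v, \<gamma>)"
      by (rule inj_onD[OF inj K]) (use g in \<open>simp_all add: slice_hom\<close>)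
    then show "u = v"
      by simp
  qed
next
  assume se: "stable_epi C q"
  have "inj_on (FArr (descent_comparison C q)) (Hom (Slice C b) \<alpha> \<gamma>)" for \<alpha> \<gamma>
  proof (rule inj_onI)
    fix x y assume xm: "x \<in> Hom (Slice C b) \<alpha> \<gamma>" and ym: "y \<in> Hom (Slice C b) \<alpha> \<gamma>"
      and K: "FArr (descent_comparison C q) x = FArr (descent_comparison C q) y"
    from slice_homE[OF xm] obtain u where x: "x = (\<alpha>, u, \<gamma>)"
      and a: "\<alpha> \<in> Arr C" "Cod C \<alpha> = b" "\<gamma> \<in> Arr C" "Cod C \<gamma> = b"
      and u: "u \<in> Arr C" "Dom C u = Dom C \<alpha>" "Cod C u = Dom C \<gamma>" "\<gamma> \<cdot> u = \<alpha>" .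
    from slice_homE[OF ym] obtain v where y: "y = (\<alpha>, v, \<gamma>)"
      and "\<alpha> \<in> Arr C" "Cod C \<alpha> = b" "\<gamma> \<in> Arr C" "Cod C \<gamma> = b"
      and v: "v \<in> Arr C" "Dom C v = Dom C \<alpha>" "Cod C v = Dom C \<gamma>" "\<gamma> \<cdot> v = \<alpha>" .
    have "pullb \<alpha> u \<gamma> = pullb \<alpha> v \<gamma>"
      using K unfolding x y comparison_simps by simp
    then have "u \<cdot> P2 \<alpha> = v \<cdot> P2 \<alpha>"
      by (metis pullb(5)[OF a u] pullb(5)[OF a v])
    then have "u = v"
      using stable_epiD[OF se pb_pullback[of q \<alpha>] a(3) u(1) v(1)] u v a by simp
    then show "x = y"
      by (simp add: x y)
  qed
  then show "faithful (Slice C b) AlgT (descent_comparison C q)"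
    unfolding faithful_def using comparison_functor by blast
qed

lemma fullD:
  assumes full: "fully_faithful (Slice C b) AlgT (descent_comparison C q)"
    and a [simp]: "\<alpha> \<in> Arr C" "Cod C \<alpha> = b" "\<gamma> \<in> Arr C" "Cod C \<gamma> = b"
    and g: "g \<in> Arr C" "Dom C g = Dom C (P1 \<alpha>)" "Cod C g = Dom C (P1 \<gamma>)" "P1 \<gamma> \<cdot> g = P1 \<alpha>"
    and fc: "fibrewise_constant C (P2 \<alpha>) (P2 \<gamma> \<cdot> g)"
  obtains u where "u \<in> Arr C" "Dom C u = Dom C \<alpha>" "Cod C u = Dom C \<gamma>" "\<gamma> \<cdot> u = \<alpha>" "pullb \<alpha> u \<gamma> = g"
proof -
  let ?K = "descent_comparison C q"
  have "g \<cdot> xi \<alpha> = xi \<gamma> \<cdot> pullb (q \<cdot> P1 \<alpha>) g (q \<cdot> P1 \<gamma>)"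
    using comparison_hom_iff[OF a g] fc by blast
  then have "(alg (P1 \<alpha>) (xi \<alpha>), (P1 \<alpha>, g, P1 \<gamma>), alg (P1 \<gamma>) (xi \<gamma>)) \<in> Arr AlgT"
    using alg_hom_iff[OF comparison_datum[OF a(1,2)] comparison_datum[OF a(3,4)]] g by blast
  then have "(alg (P1 \<alpha>) (xi \<alpha>), (P1 \<alpha>, g, P1 \<gamma>), alg (P1 \<gamma>) (xi \<gamma>))
      \<in> Hom AlgT (FObj ?K \<alpha>) (FObj ?K \<gamma>)"
    unfolding Hom_def by (simp add: comparison_simps)
  moreover have "FArr ?K ` Hom (Slice C b) \<alpha> \<gamma> = Hom AlgT (FObj ?K \<alpha>) (FObj ?K \<gamma>)"
    using full unfolding fully_faithful_def bij_betw_def by simp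
  ultimately have "(alg (P1 \<alpha>) (xi \<alpha>), (P1 \<alpha>, g, P1 \<gamma>), alg (P1 \<gamma>) (xi \<gamma>))
      \<in> FArr ?K ` Hom (Slice C b) \<alpha> \<gamma>"
    by (simp only:)
  then obtain x where Kx: "(alg (P1 \<alpha>) (xi \<alpha>), (P1 \<alpha>, g, P1 \<gamma>), alg (P1 \<gamma>) (xi \<gamma>)) = FArr ?K x"
    and x: "x \<in> Hom (Slice C b) \<alpha> \<gamma>"
    by (rule imageE)
  from slice_homE[OF x] obtain u where
    u: "x = (\<alpha>, u, \<gamma>)" and "\<alpha> \<in> Arr C" "Cod C \<alpha> = b" "\<gamma> \<in> Arr C" "Cod C \<gamma> = b"
    and u': "u \<in> Arr C" "Dom C u = Dom C \<alpha>" "Cod C u = Dom C \<gamma>" "\<gamma> \<cdot> u = \<alpha>" .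
  have "pullb \<alpha> u \<gamma> = g"
    using Kx unfolding u(1) comparison_simps by simp
  with u' that show thesis
    by blast
qed

text \<open>An arrow constant on fibres induces an algebra homomorphism by
  \<open>comparison_hom_iff\<close>; its preimage under the comparison functor is the
  factorization.\<close>

lemma stable_quot_if_full:
  assumes full: "fully_faithful (Slice C b) AlgT (descent_comparison C q)"
  shows "stable_quot C q"
  unfolding stable_quot_def
proof (intro allI impI)
  fix \<alpha> k q' \<gamma> t
  assume pb: "is_pullback C q \<alpha> k q'" and [simp]: "\<gamma> \<in> Arr C" "t \<in> Arr C"
    "Dom C t = Dom C q'" "Cod C t = Dom C \<gamma>" and g: "\<gamma> \<cdot> t = \<alpha> \<cdot> q'" and fc: "fibrewise_constant C q' t"
  note P [simp] = pullback_arrs(1-8)[OF pb]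
  have "Cod C \<gamma> = Cod C (\<gamma> \<cdot> t)"
    by simp
  then have [simp]: "Cod C \<gamma> = b"
    unfolding g by simp
  obtain j i where j [simp]: "j \<in> Arr C" "i \<in> Arr C" "Dom C j = Dom C (P1 \<alpha>)" "Cod C j = Dom C k"
    "Dom C i = Dom C k" "Cod C i = Dom C (P1 \<alpha>)" "j \<cdot> i = Ident C (Dom C k)"
    and qj: "q' \<cdot> j = P2 \<alpha>" and qi: "P2 \<alpha> \<cdot> i = q'"
    by (rule pullback_comparison[OF pb pb_pullback[of q \<alpha>]]) simp_all
  \<comment> \<open>The arrow \<open>t\<close>, moved to the chosen pullback by \<open>j\<close> and
    turned into an arrow of the slice over \<open>e\<close> by adding the first projection.\<close>
  define g where "g = pb_pair C q \<gamma> (P1 \<alpha>) (t \<cdot> j)"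
  have sq: "\<gamma> \<cdot> (t \<cdot> j) = q \<cdot> P1 \<alpha>"
    using qj by (simp add: g[THEN reassoc] q_square)
  have g [simp]: "g \<in> Arr C" "Dom C g = Dom C (P1 \<alpha>)" "Cod C g = Dom C (P1 \<gamma>)" "P1 \<gamma> \<cdot> g = P1 \<alpha>"
    and Pg: "P2 \<gamma> \<cdot> g = t \<cdot> j"
    using sq unfolding g_def by simp_all
  have "fibrewise_constant C (P2 \<alpha>) (P2 \<gamma> \<cdot> g)"
    unfolding fibrewise_constant_def Pg
  proof (intro allI impI)
    fix r r' assume [simp]: "r \<in> Arr C" "r' \<in> Arr C" "Dom C r = Dom C r'" "Cod C r = Dom C (P2 \<alpha>)"
      "Cod C r' = Dom C (P2 \<alpha>)" and e: "P2 \<alpha> \<cdot> r = P2 \<alpha> \<cdot> r'"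
    have "t \<cdot> (j \<cdot> r) = t \<cdot> (j \<cdot> r')"
      by (rule fibrewise_constantD[OF fc]) (simp_all add: qj[THEN reassoc] e)
    then show "(t \<cdot> j) \<cdot> r = (t \<cdot> j) \<cdot> r'"
      by simp
  qed
  then obtain u where u [simp]: "u \<in> Arr C" "Dom C u = Dom C \<alpha>" "Cod C u = Dom C \<gamma>" "\<gamma> \<cdot> u = \<alpha>"
    and ug: "pullb \<alpha> u \<gamma> = g"
    by - (rule fullD[OF full, of \<alpha> \<gamma> g], simp_all)
  have "u \<cdot> P2 \<alpha> = t \<cdot> j"
    using pullb(5)[of \<alpha> \<gamma> u] Pg unfolding ug by simp
  then have "(u \<cdot> P2 \<alpha>) \<cdot> i = (t \<cdot> j) \<cdot> i"
    by simp
  then have "u \<cdot> q' = t"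
    by (simp add: qi)
  then show "\<exists>u \<in> Arr C. Dom C u = Dom C \<alpha> \<and> Cod C u = Dom C \<gamma> \<and> u \<cdot> q' = t \<and> \<gamma> \<cdot> u = \<alpha>"
    using u by blast
qed

text \<open>A homomorphism \<open>g\<close> makes \<open>P2 \<gamma> \<cdot> g\<close> constant on
  the fibres of \<open>P2 \<alpha>\<close>; factoring it through \<open>P2 \<alpha>\<close> produces
  the preimage of \<open>g\<close>.\<close>

lemma full_if_stable:
  assumes se: "stable_epi C q" and sq: "stable_quot C q"
  shows "fully_faithful (Slice C b) AlgT (descent_comparison C q)"
proof -
  let ?K = "descent_comparison C q"
  interpret K: cat_functor "Slice C b" AlgT ?K
    by (rule comparison_functor)
  have "bij_betw (FArr ?K) (Hom (Slice C b) \<alpha> \<gamma>) (Hom AlgT (FObj ?K \<alpha>) (FObj ?K \<gamma>))"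
    if "\<alpha> \<in> Obj (Slice C b)" "\<gamma> \<in> Obj (Slice C b)" for \<alpha> \<gamma>
  proof (rule bij_betw_imageI)
    show "inj_on (FArr ?K) (Hom (Slice C b) \<alpha> \<gamma>)"
      using se that unfolding faithful_iff_stable_epi[symmetric] faithful_def by blast
    have a [simp]: "\<alpha> \<in> Arr C" "Cod C \<alpha> = b" "\<gamma> \<in> Arr C" "Cod C \<gamma> = b"
      using that by simp_all
    have "y \<in> FArr ?K ` Hom (Slice C b) \<alpha> \<gamma>" if y: "y \<in> Hom AlgT (FObj ?K \<alpha>) (FObj ?K \<gamma>)" for y
    proof -
      obtain A B f1 g f2 where y': "y = (A, (f1, g, f2), B)"
        by (cases y) auto
      have AB: "A = alg (P1 \<alpha>) (xi \<alpha>)" "B = alg (P1 \<gamma>) (xi \<gamma>)"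
        using y unfolding alg.in_Hom comparison_simps by (simp_all add: y' del: Alg_simps(2))
      have yA: "y \<in> Arr AlgT"
        using y unfolding alg.in_Hom by blast
      have g: "f1 = P1 \<alpha>" "f2 = P1 \<gamma>" "g \<in> Arr C" "Dom C g = Dom C (P1 \<alpha>)" "Cod C g = Dom C (P1 \<gamma>)"
        "P1 \<gamma> \<cdot> g = P1 \<alpha>" and hom: "g \<cdot> xi \<alpha> = xi \<gamma> \<cdot> pullb (q \<cdot> P1 \<alpha>) g (q \<cdot> P1 \<gamma>)"
        using yA alg_hom_iff[OF comparison_datum[OF a(1,2)] comparison_datum[OF a(3,4)]]
        unfolding y' AB(1,2) by blast+
      note [simp] = g(3-6) g(6)[THEN reassoc]
      have fc: "fibrewise_constant C (P2 \<alpha>) (P2 \<gamma> \<cdot> g)"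
        using comparison_hom_iff[OF a g(3-6)] hom by blast
      obtain u where u [simp]: "u \<in> Arr C" "Dom C u = Dom C \<alpha>" "Cod C u = Dom C \<gamma>" and
          up: "u \<cdot> P2 \<alpha> = P2 \<gamma> \<cdot> g" and gu: "\<gamma> \<cdot> u = \<alpha>"
        by (rule stable_quotD[OF sq pb_pullback[of q \<alpha>] a(3), of "P2 \<gamma> \<cdot> g"])
          (simp_all add: fc q_square[of \<alpha>, symmetric] q_square[of \<gamma>, symmetric, THEN reassoc])
      have "pullb \<alpha> u \<gamma> = g"
        by (rule pb_eq[of q \<gamma>]) (use pullb[OF a u gu] in \<open>simp_all add: up\<close>)
      then have "FArr ?K (\<alpha>, u, \<gamma>) = y"
        unfolding comparison_simps y' AB g by simp
      moreover have "(\<alpha>, u, \<gamma>) \<in> Hom (Slice C b) \<alpha> \<gamma>"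
        using gu by (simp add: slice_hom)
      ultimately show ?thesis
        by blast
    qed
    moreover have "FArr ?K ` Hom (Slice C b) \<alpha> \<gamma> \<subseteq> Hom AlgT (FObj ?K \<alpha>) (FObj ?K \<gamma>)"
      using K.FArr_closed by blast
    ultimately show "FArr ?K ` Hom (Slice C b) \<alpha> \<gamma> = Hom AlgT (FObj ?K \<alpha>) (FObj ?K \<gamma>)"
      by blast
  qed
  then show ?thesis
    unfolding fully_faithful_def using comparison_functor by blast
qed

text \<open>An isomorphism between the algebra of the datum and the comparison algebra of
  \<open>z\<close> exhibits \<open>f\<close> as a pullback of \<open>z\<close>, and its
  compatibility with the structure maps is the required equation for \<open>\<pi>\<close>.\<close>

lemma effective_if_ess_surj:
  assumes es: "ess_surj (Slice C b) AlgT (descent_comparison C q)"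
  shows "effective C q"
  unfolding effective_def
proof (intro allI impI)
  fix f m1 m2 \<xi>0 assume d0: "descent_datum C q f m1 m2 \<xi>0"
  have [simp]: "f \<in> Arr C" "Cod C f = e"
    using datumD[OF d0] by simp_all
  have M: "is_pullback C q (q \<cdot> f) (P1 (q \<cdot> f)) (P2 (q \<cdot> f))"
    by (rule pb_pullback) simp_all
  obtain j i where j: "j \<in> Arr C" "Cod C j = Dom C m1" "Dom C j = Dom C (P1 (q \<cdot> f))"
    "m1 \<cdot> j = P1 (q \<cdot> f)" "m2 \<cdot> j = P2 (q \<cdot> f)" "i \<in> Arr C" "Dom C i = Dom C m1"
    "Cod C i = Dom C (P1 (q \<cdot> f))" "j \<cdot> i = Ident C (Dom C m1)" "P2 (q \<cdot> f) \<cdot> i = m2"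
    by (rule pullback_comparison[OF datumD(3)[OF d0] M])
  define \<xi> where "\<xi> = \<xi>0 \<cdot> j"
  have d: "descent_datum C q f (P1 (q \<cdot> f)) (P2 (q \<cdot> f)) \<xi>"
    unfolding \<xi>_def by (rule datum_change_pullback[OF d0 M j(1-5)])
  note D [simp] = datumD(4-7)[OF d]
  have "alg f \<xi> \<in> Obj AlgT"
    using d by (auto simp: algebra_iff)
  then obtain z h where z [simp]: "z \<in> Arr C" "Cod C z = b"
    and h: "h \<in> Hom AlgT (FObj (descent_comparison C q) z) (alg f \<xi>)" "is_iso AlgT h"
    using es unfolding ess_surj_def by (metis Slice_simps(1))
  obtain g where g: "g \<in> Arr AlgT" "Dom AlgT g = alg f \<xi>" "Cod AlgT g = alg (P1 z) (xi z)"
    and gh: "g \<cdot>\<^bsub>AlgT\<^esub> h = Ident AlgT (alg (P1 z) (xi z))" and hg: "h \<cdot>\<^bsub>AlgT\<^esub> g = Ident AlgT (alg f \<xi>)"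
    using alg.isoE[OF h(2)] h(1) unfolding alg.in_Hom comparison_simps by metis
  have dz: "descent_datum C q (P1 z) (P1 (q \<cdot> P1 z)) (P2 (q \<cdot> P1 z)) (xi z)"
    by (rule comparison_datum[OF z])
  obtain s s1 s2 where h': "h = (alg (P1 z) (xi z), (s1, s, s2), alg f \<xi>)"
    using h(1) unfolding alg.in_Hom comparison_simps by (cases h) auto
  obtain r r1 r2 where g': "g = (alg f \<xi>, (r1, r, r2), alg (P1 z) (xi z))"
    using g(2,3) by (cases g) auto
  have s [simp]: "s1 = P1 z" "s2 = f" "s \<in> Arr C" "Dom C s = Dom C (P1 z)" "Cod C s = Dom C f"
    and fs [simp]: "f \<cdot> s = P1 z"
    using h(1) alg_hom_iff[OF dz d] unfolding alg.in_Hom h' by blast+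
  have r [simp]: "r1 = f" "r2 = P1 z" "r \<in> Arr C" "Dom C r = Dom C f" "Cod C r = Dom C (P1 z)"
    and zr [simp]: "P1 z \<cdot> r = f" and hom: "r \<cdot> \<xi> = xi z \<cdot> pullb (q \<cdot> f) r (q \<cdot> P1 z)"
    using g(1) alg_hom_iff[OF d dz] unfolding g' by blast+
  have rs: "r \<cdot> s = Ident C (Dom C (P1 z))" and sr: "s \<cdot> r = Ident C (Dom C f)"
    using gh hg unfolding h' g' by (simp_all add: alg_def)
  have pb: "is_pullback C q z f (P2 z \<cdot> r)"
    using pullback_iso[OF pb_pullback[of q z], of r s] rs sr by simp
  let ?G = "pullb (q \<cdot> f) r (q \<cdot> P1 z)"
  have G: "P1 (q \<cdot> P1 z) \<cdot> ?G = P1 (q \<cdot> f)" "P2 (q \<cdot> P1 z) \<cdot> ?G = r \<cdot> P2 (q \<cdot> f)" "?G \<in> Arr C"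
    "Cod C ?G = Dom C (P1 (q \<cdot> P1 z))" "Dom C ?G = Dom C (P1 (q \<cdot> f))"
    by simp_all
  note X = comparison_transport[OF z]
  have eq: "P2 z \<cdot> (r \<cdot> \<xi>) = P2 z \<cdot> (r \<cdot> P2 (q \<cdot> f))"
    unfolding hom using G X by (simp add: X(2)[THEN reassoc] del: pullb)
  \<comment> \<open>Composing with \<open>i\<close> leads back from the chosen pullback to the legs
    \<open>m1\<close> and \<open>m2\<close> that were given.\<close>
  have \<xi>i: "\<xi> \<cdot> i = \<xi>0"
    unfolding \<xi>_def using j datumD(4-6)[OF d0] by simp
  have "P2 z \<cdot> (r \<cdot> (\<xi> \<cdot> i)) = P2 z \<cdot> (r \<cdot> (P2 (q \<cdot> f) \<cdot> i))"
    using arg_cong[OF eq, of "\<lambda>w. w \<cdot> i"] j by simp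
  then have "(P2 z \<cdot> r) \<cdot> \<xi>0 = (P2 z \<cdot> r) \<cdot> m2"
    unfolding \<xi>i j(10) using datumD(4-6)[OF d0] pullback_arrs[OF datumD(3)[OF d0]] by simp
  with pb show "\<exists>z \<pi>. is_pullback C q z f \<pi> \<and> \<pi> \<cdot> \<xi>0 = \<pi> \<cdot> m2"
    by blast
qed

text \<open>Both \<open>f\<close> and \<open>P1 z\<close> are pullbacks of \<open>z\<close>. Their
  comparison arrows respect transport because both transports keep the coordinate in
  \<open>z\<close>.\<close>

lemma ess_surj_if_effective:
  assumes eff: "effective C q"
  shows "ess_surj (Slice C b) AlgT (descent_comparison C q)"
  unfolding ess_surj_def
proof
  fix A assume "A \<in> Obj AlgT"
  then obtain f \<xi> where A: "A = alg f \<xi>" and d: "descent_datum C q f (P1 (q \<cdot> f)) (P2 (q \<cdot> f)) \<xi>"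
    by (auto simp: algebra_iff)
  then obtain z \<pi> where pb: "is_pullback C q z f \<pi>" and eq: "\<pi> \<cdot> \<xi> = \<pi> \<cdot> P2 (q \<cdot> f)"
    using eff unfolding effective_def by blast
  note D [simp] = datumD(1,2,4-7)[OF d]
  note P [simp] = pullback_arrs(1-8)[OF pb]
  obtain r s where s [simp]: "r \<in> Arr C" "s \<in> Arr C" "Cod C r = Dom C (P1 z)" "Dom C r = Dom C f"
    "Dom C s = Dom C (P1 z)" "Cod C s = Dom C f" "P1 z \<cdot> r = f" "P2 z \<cdot> r = \<pi>" "f \<cdot> s = P1 z" "\<pi> \<cdot> s = P2 z"
    and inv: "r \<cdot> s = Ident C (Dom C (P1 z))" "s \<cdot> r = Ident C (Dom C f)"
    by (rule pullback_comparison[OF pb_pullback[of q z] pb]) simp_all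
  have dz: "descent_datum C q (P1 z) (P1 (q \<cdot> P1 z)) (P2 (q \<cdot> P1 z)) (xi z)"
    by (rule comparison_datum) simp_all
  have X: "P1 z \<cdot> xi z = P1 (q \<cdot> P1 z)" "P2 z \<cdot> xi z = P2 z \<cdot> P2 (q \<cdot> P1 z)"
    "xi z \<in> Arr C" "Dom C (xi z) = Dom C (P1 (q \<cdot> P1 z))" "Cod C (xi z) = Dom C (P1 z)"
    by (rule comparison_transport; simp)+
  let ?G = "pullb (q \<cdot> P1 z) s (q \<cdot> f)" and ?H = "pullb (q \<cdot> f) r (q \<cdot> P1 z)"
  have G: "P1 (q \<cdot> f) \<cdot> ?G = P1 (q \<cdot> P1 z)" "P2 (q \<cdot> f) \<cdot> ?G = s \<cdot> P2 (q \<cdot> P1 z)" "?G \<in> Arr C"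
    "Cod C ?G = Dom C (P1 (q \<cdot> f))" "Dom C ?G = Dom C (P1 (q \<cdot> P1 z))"
    by simp_all
  have H: "P1 (q \<cdot> P1 z) \<cdot> ?H = P1 (q \<cdot> f)" "P2 (q \<cdot> P1 z) \<cdot> ?H = r \<cdot> P2 (q \<cdot> f)" "?H \<in> Arr C"
    "Cod C ?H = Dom C (P1 (q \<cdot> P1 z))" "Dom C ?H = Dom C (P1 (q \<cdot> f))"
    by simp_all
  note re = X(1,2)[THEN reassoc] G(1,2)[THEN reassoc] H(1,2)[THEN reassoc] eq[THEN reassoc] D(6)[THEN reassoc]
    s(7-10)[THEN reassoc]
  have homs: "s \<cdot> xi z = \<xi> \<cdot> ?G"
    by (rule pullback_eq[OF pb]) (simp_all add: X G re del: pullb)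
  have homr: "r \<cdot> \<xi> = xi z \<cdot> ?H"
    by (rule pb_eq[of q z]) (simp_all add: X H re eq del: pullb)
  let ?h = "(alg (P1 z) (xi z), (P1 z, s, f), alg f \<xi>)" and ?g = "(alg f \<xi>, (f, r, P1 z), alg (P1 z) (xi z))"
  have h: "?h \<in> Arr AlgT" "?g \<in> Arr AlgT"
    using homs homr alg_hom_iff[OF dz d] alg_hom_iff[OF d dz] by simp_all
  have "is_iso AlgT ?h"
  proof (rule alg.isoI[of ?h ?g])
    show "?g \<cdot>\<^bsub>AlgT\<^esub> ?h = Ident AlgT (Dom AlgT ?h)" "?h \<cdot>\<^bsub>AlgT\<^esub> ?g = Ident AlgT (Cod AlgT ?h)"
      using inv by (simp_all add: alg_def)
  qed (use h in simp_all)
  moreover have "?h \<in> Hom AlgT (FObj (descent_comparison C q) z) A"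
    unfolding alg.in_Hom comparison_simps A using h(1) by simp
  ultimately show "\<exists>a \<in> Obj (Slice C b). \<exists>h \<in> Hom AlgT (FObj (descent_comparison C q) a) A. is_iso AlgT h"
    by (intro bexI[of _ z]) auto
qed

end

section \<open>The three descent notions in elementary form\<close>

context category_pb
begin

lemma almost_descent_iff: "almost_descent C q \<longleftrightarrow> q \<in> Arr C \<and> stable_epi C q"
proof (cases "q \<in> Arr C")
  case True
  then interpret base_arrow C q by unfold_locales
  show ?thesis
    using faithful_iff_stable_epi category_axioms pullbacks unfolding almost_descent_def by simp
qed (simp add: almost_descent_def)

lemma descent_iff: "descent C q \<longleftrightarrow> q \<in> Arr C \<and> stable_epi C q \<and> stable_quot C q"
proof (cases "q \<in> Arr C")
  case True
  then interpret base_arrow C q by unfold_locales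
  have "fully_faithful (Slice C b) AlgT (descent_comparison C q) \<Longrightarrow> stable_epi C q"
    unfolding faithful_iff_stable_epi[symmetric] faithful_def fully_faithful_def bij_betw_def by blast
  then show ?thesis
    using full_if_stable stable_quot_if_full category_axioms pullbacks unfolding descent_def by auto
qed (simp add: descent_def)

lemma effective_descent_iff: "effective_descent C q \<longleftrightarrow> descent C q \<and> effective C q"
proof (cases "q \<in> Arr C")
  case True
  then interpret base_arrow C q by unfold_locales
  show ?thesis
    using equivalence_imp[of "Slice C b" AlgT] equivalenceI[of "Slice C b" AlgT]
      effective_if_ess_surj ess_surj_if_effective category_axioms pullbacks
    unfolding descent_def effective_descent_def by auto
qed (simp add: descent_def effective_descent_def)

end

section \<open>Pullback stability, retracts and functors preserving pullbacks\<close>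

context category_pb
begin

lemma pullback_paste':
  assumes "is_pullback C q \<beta> h q'" "is_pullback C q' \<alpha> k r"
  shows "is_pullback C q (\<beta> \<cdot> \<alpha>) (h \<cdot> k) r"
  using pullback_paste[OF pullback_sym[OF assms(1)] pullback_sym[OF assms(2)]] by (rule pullback_sym)

text \<open>By pasting, every pullback of \<open>q'\<close> is a pullback of \<open>q\<close>;
  arrows over the domain of \<open>\<beta>\<close> become arrows over the codomain of
  \<open>q\<close> by composing with \<open>\<beta>\<close>.\<close>

lemma stable_epi_pullback:
  assumes se: "stable_epi C q" and base: "is_pullback C q \<beta> h q'"
  shows "stable_epi C q'"
  unfolding stable_epi_def
proof (intro allI impI)
  fix \<alpha> k r \<gamma> u v
  assume pb: "is_pullback C q' \<alpha> k r" and [simp]: "\<gamma> \<in> Arr C" "u \<in> Arr C" "v \<in> Arr C"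
    "Dom C u = Dom C \<alpha>" "Dom C v = Dom C \<alpha>" "Cod C u = Dom C \<gamma>" "Cod C v = Dom C \<gamma>"
    and g: "\<gamma> \<cdot> u = \<alpha>" "\<gamma> \<cdot> v = \<alpha>" and e: "u \<cdot> r = v \<cdot> r"
  note B [simp] = pullback_arrs(1-8)[OF base] pullback_arrs(1-8)[OF pb]
  have "Cod C \<gamma> = Cod C (\<gamma> \<cdot> u)"
    by simp
  then have [simp]: "Cod C \<gamma> = Dom C \<beta>"
    unfolding g B by simp
  have [simp]: "Cod C \<alpha> = Dom C \<beta>"
    by simp
  show "u = v"
    by (rule stable_epiD[OF se pullback_paste'[OF base pb], of "\<beta> \<cdot> \<gamma>"]) (simp_all add: g e)
qed

lemma stable_quot_pullback:
  assumes se: "stable_epi C q" and sq: "stable_quot C q" and base: "is_pullback C q \<beta> h q'"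
  shows "stable_quot C q'"
  unfolding stable_quot_def
proof (intro allI impI)
  fix \<alpha> k r \<gamma> t
  assume pb: "is_pullback C q' \<alpha> k r" and [simp]: "\<gamma> \<in> Arr C" "t \<in> Arr C"
    "Dom C t = Dom C r" "Cod C t = Dom C \<gamma>" and g: "\<gamma> \<cdot> t = \<alpha> \<cdot> r" and fc: "fibrewise_constant C r t"
  note B [simp] = pullback_arrs(1-8)[OF base] pullback_arrs(1-8)[OF pb]
  have [simp]: "Cod C \<alpha> = Dom C \<beta>"
    by simp
  have "Cod C \<gamma> = Cod C (\<gamma> \<cdot> t)"
    by simp
  then have [simp]: "Cod C \<gamma> = Dom C \<beta>"
    unfolding g by simp
  note pb' = pullback_paste'[OF base pb]
  obtain u where u [simp]: "u \<in> Arr C" "Dom C u = Dom C \<alpha>" "Cod C u = Dom C \<gamma>"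
    and ur: "u \<cdot> r = t" and gu: "(\<beta> \<cdot> \<gamma>) \<cdot> u = \<beta> \<cdot> \<alpha>"
    by (rule stable_quotD[OF sq pb', of "\<beta> \<cdot> \<gamma>" t]) (simp_all add: g fc)
  \<comment> \<open>The quotient property only places \<open>u\<close> over
    \<open>\<beta> \<cdot> \<gamma>\<close>; cancelling \<open>r\<close> places it over
    \<open>\<gamma>\<close>.\<close>
  have "\<gamma> \<cdot> u = \<alpha>"
    by (rule stable_epiD[OF se pb', of \<beta>]) (use gu in \<open>simp_all add: ur g\<close>)
  with u ur show "\<exists>u \<in> Arr C. Dom C u = Dom C \<alpha> \<and> Cod C u = Dom C \<gamma> \<and> u \<cdot> r = t \<and> \<gamma> \<cdot> u = \<alpha>"
    by blast
qed

text \<open>The fibres of \<open>q'\<close> are fibres of \<open>q\<close>, so a datum on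
  \<open>f\<close> along \<open>q'\<close> is one on \<open>h \<cdot> f\<close> along
  \<open>q\<close>. The object that results lies over the codomain of \<open>q\<close> only; its map
  to the domain of \<open>\<beta>\<close> is obtained by descending \<open>q' \<cdot> f\<close>, and
  pullback cancellation gives the square over \<open>q'\<close>.\<close>

lemma effective_pullback:
  assumes sq: "stable_quot C q" and eff: "effective C q" and base: "is_pullback C q \<beta> h q'"
  shows "effective C q'"
  unfolding effective_def
proof (intro allI impI)
  fix f m1 m2 \<xi> assume d: "descent_datum C q' f m1 m2 \<xi>"
  note D [simp] = datumD(1,2,4-7)[OF d]
  note M = datumD(3)[OF d]
  note B [simp] = pullback_arrs(1-8)[OF base]
  note bs = pullback_arrs(9)[OF base]
  have Marrs [simp]: "m1 \<in> Arr C" "m2 \<in> Arr C" "Cod C m1 = Dom C q'" "Cod C m2 = Dom C f" "Dom C m2 = Dom C m1"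
    using pullback_arrs[OF M] by simp_all
  have Msq: "q' \<cdot> m1 = q' \<cdot> (f \<cdot> m2)"
    using pullback_arrs(9)[OF M] by simp
  have M': "is_pullback C q (q \<cdot> (h \<cdot> f)) (h \<cdot> m1) m2"
    using pullback_paste'[OF base M] by (simp add: bs[THEN reassoc])
  have d': "descent_datum C q (h \<cdot> f) (h \<cdot> m1) m2 \<xi>"
    unfolding descent_datum_def
  proof (intro conjI allI impI M')
    fix u assume [simp]: "u \<in> Arr C" "Cod C u = Dom C (h \<cdot> m1)" and e: "(h \<cdot> m1) \<cdot> u = (h \<cdot> f) \<cdot> (m2 \<cdot> u)"
    have "m1 \<cdot> u = f \<cdot> (m2 \<cdot> u)"
      by (rule pullback_eq[OF base]) (use e in \<open>simp_all add: Msq[THEN reassoc]\<close>)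
    then show "\<xi> \<cdot> u = m2 \<cdot> u"
      by - (rule datum_unit[OF d], simp_all)
  next
    fix u u' v assume [simp]: "u \<in> Arr C" "u' \<in> Arr C" "v \<in> Arr C" "Dom C u' = Dom C u" "Dom C v = Dom C u"
      "Cod C u = Dom C (h \<cdot> m1)" "Cod C u' = Dom C (h \<cdot> m1)" "Cod C v = Dom C (h \<cdot> m1)"
      and e: "m2 \<cdot> v = \<xi> \<cdot> u" "(h \<cdot> m1) \<cdot> u' = (h \<cdot> m1) \<cdot> v" "m2 \<cdot> u' = m2 \<cdot> u"
    have "q' \<cdot> (m1 \<cdot> v) = q' \<cdot> (m1 \<cdot> u)"
      by (simp add: Msq[THEN reassoc] e(1) D(6)[THEN reassoc])
    then have "m1 \<cdot> u' = m1 \<cdot> v"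
      by - (rule pullback_eq[OF base], use e in \<open>simp_all add: Msq[THEN reassoc]\<close>)
    then show "\<xi> \<cdot> v = \<xi> \<cdot> u'"
      by - (rule datum_assoc[OF d, of u u' v], use e in simp_all)
  qed (simp_all add: D(6)[THEN reassoc])
  then obtain z \<pi> where pb: "is_pullback C q z (h \<cdot> f) \<pi>" and eq: "\<pi> \<cdot> \<xi> = \<pi> \<cdot> m2"
    using eff unfolding effective_def by blast
  have Parrs [simp]: "z \<in> Arr C" "\<pi> \<in> Arr C" "Cod C z = Cod C q" "Cod C \<pi> = Dom C z" "Dom C \<pi> = Dom C f"
    using pullback_arrs[OF pb] by simp_all
  have psq: "q \<cdot> (h \<cdot> f) = z \<cdot> \<pi>"
    using pullback_arrs(9)[OF pb] .
  \<comment> \<open>Points with the same image under \<open>\<pi>\<close> are transported into each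
    other, and transport stays within a fibre of \<open>q'\<close>.\<close>
  have "fibrewise_constant C \<pi> (q' \<cdot> f)"
    unfolding fibrewise_constant_def
  proof (intro allI impI)
    fix r r' assume [simp]: "r \<in> Arr C" "r' \<in> Arr C" "Dom C r = Dom C r'" "Cod C r = Dom C \<pi>"
      "Cod C r' = Dom C \<pi>" and e: "\<pi> \<cdot> r = \<pi> \<cdot> r'"
    obtain u where [simp]: "u \<in> Arr C" "Dom C u = Dom C r'" "Cod C u = Dom C (h \<cdot> m1)"
      and u: "m2 \<cdot> u = r" "\<xi> \<cdot> u = r'"
      by (rule kernel_transport[OF pb M', of \<xi> r r']) (simp_all add: eq e)
    show "(q' \<cdot> f) \<cdot> r = (q' \<cdot> f) \<cdot> r'"
      unfolding u[symmetric] by (simp add: D(6)[THEN reassoc] Msq[THEN reassoc])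
  qed
  then obtain z' where z' [simp]: "z' \<in> Arr C" "Dom C z' = Dom C z" "Cod C z' = Dom C \<beta>"
    and zp: "z' \<cdot> \<pi> = q' \<cdot> f" and bz: "\<beta> \<cdot> z' = z"
    by - (rule stable_quotD[OF sq pb, of \<beta> "q' \<cdot> f"], simp_all add: bs[THEN reassoc] flip: psq)
  have "is_pullback C z' q' \<pi> f"
    by (rule pullback_unpaste[OF pullback_sym[OF base]]) (simp_all add: bz pullback_sym[OF pb] zp)
  then show "\<exists>z \<pi>. is_pullback C q' z f \<pi> \<and> \<pi> \<cdot> \<xi> = \<pi> \<cdot> m2"
    using eq pullback_sym by blast
qed

lemma effective_descent_pullback:
  assumes "effective_descent C q" "is_pullback C q \<beta> h q'"
  shows "effective_descent C q'"
  using assms stable_epi_pullback stable_quot_pullback effective_pullback pullback_arrs(4)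
  unfolding effective_descent_iff descent_iff by blast

lemma descent_pullback:
  assumes "descent C q" "is_pullback C q \<beta> h q'"
  shows "descent C q'"
  using assms stable_epi_pullback stable_quot_pullback pullback_arrs(4)
  unfolding descent_iff by blast

text \<open>Here \<open>i\<close> and \<open>r\<close> are arrows over the common codomain, so all
  data along \<open>q\<close> can be enlarged along \<open>r\<close> to data along
  \<open>q''\<close>, descended there and cut down again along \<open>i\<close>.\<close>

lemma effective_descent_retract:
  assumes ed: "effective_descent C q''"
    and ir: "q \<in> Arr C" "i \<in> Arr C" "r \<in> Arr C" "Dom C i = Dom C q" "Cod C i = Dom C q''"
      "Dom C r = Dom C q''" "Cod C r = Dom C q" "Cod C q = Cod C q''"
    and ri: "r \<cdot> i = Ident C (Dom C q)" and qi: "q'' \<cdot> i = q" and qr: "q \<cdot> r = q''"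
  shows "effective_descent C q"
proof -
  have se: "stable_epi C q''" and sq: "stable_quot C q''" and eff: "effective C q''" and [simp]: "q'' \<in> Arr C"
    using ed unfolding effective_descent_iff descent_iff by blast+
  note [simp] = ir
  note re = ri[THEN reassoc] qi[THEN reassoc] qr[THEN reassoc]
  \<comment> \<open>The retraction is stable: every pullback of \<open>q\<close> is a retract, over
    the new base, of the pullback of \<open>q''\<close> along the same arrow.\<close>
  have lift: "\<exists>r' i'. r' \<in> Arr C \<and> i' \<in> Arr C \<and> Dom C r' = Dom C (pb_snd C q'' \<alpha>) \<and> Cod C r' = Dom C q1 \<and>
      Dom C i' = Dom C q1 \<and> Cod C i' = Dom C (pb_snd C q'' \<alpha>) \<and> q1 \<cdot> r' = pb_snd C q'' \<alpha> \<and>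
      pb_snd C q'' \<alpha> \<cdot> i' = q1 \<and> r' \<cdot> i' = Ident C (Dom C q1)" if pb: "is_pullback C q \<alpha> k q1" for \<alpha> k q1
  proof -
    note P [simp] = pullback_arrs(1-8)[OF pb]
    let ?k = "pb_fst C q'' \<alpha>" and ?q = "pb_snd C q'' \<alpha>"
    have s: "q'' \<cdot> ?k = \<alpha> \<cdot> ?q"
      by (rule pb_square) simp_all
    obtain r' where r' [simp]: "r' \<in> Arr C" "Dom C r' = Dom C ?k" "Cod C r' = Dom C k" "k \<cdot> r' = r \<cdot> ?k" "q1 \<cdot> r' = ?q"
      by (rule pullback_ex[OF pb, of "r \<cdot> ?k" ?q "Dom C ?k"]) (simp_all add: re s)
    obtain i' where i' [simp]: "i' \<in> Arr C" "Dom C i' = Dom C k" "Cod C i' = Dom C ?k" "?k \<cdot> i' = i \<cdot> k" "?q \<cdot> i' = q1"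
      by (rule pullback_ex[OF pb_pullback[of q'' \<alpha>], of "i \<cdot> k" q1 "Dom C k"])
        (simp_all add: re pullback_arrs(9)[OF pb])
    have "r' \<cdot> i' = Ident C (Dom C k)"
      by (rule pullback_eq[OF pb]) (simp_all add: r'(4,5)[THEN reassoc] re)
    then show ?thesis
      by (intro exI[of _ r'] exI[of _ i']) simp
  qed
  have "stable_epi C q"
    unfolding stable_epi_def
  proof (intro allI impI)
    fix \<alpha> k q1 \<gamma> u v
    assume pb: "is_pullback C q \<alpha> k q1" and [simp]: "\<gamma> \<in> Arr C" "u \<in> Arr C" "v \<in> Arr C"
      "Dom C u = Dom C \<alpha>" "Dom C v = Dom C \<alpha>" "Cod C u = Dom C \<gamma>" "Cod C v = Dom C \<gamma>"
      and g: "\<gamma> \<cdot> u = \<alpha>" "\<gamma> \<cdot> v = \<alpha>" and e: "u \<cdot> q1 = v \<cdot> q1"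
    note P [simp] = pullback_arrs(1-8)[OF pb]
    obtain r' where r' [simp]: "r' \<in> Arr C" "Dom C r' = Dom C (pb_snd C q'' \<alpha>)" "Cod C r' = Dom C q1"
      and qr': "q1 \<cdot> r' = pb_snd C q'' \<alpha>"
      using lift[OF pb] by blast
    have "u \<cdot> pb_snd C q'' \<alpha> = v \<cdot> pb_snd C q'' \<alpha>"
      unfolding qr'[symmetric] by (simp add: e[THEN reassoc])
    then show "u = v"
      by - (rule stable_epiD[OF se pb_pullback[of q'' \<alpha>], of \<gamma>], simp_all add: g)
  qed
  moreover have "stable_quot C q"
    unfolding stable_quot_def
  proof (intro allI impI)
    fix \<alpha> k q1 \<gamma> t
    assume pb: "is_pullback C q \<alpha> k q1" and [simp]: "\<gamma> \<in> Arr C" "t \<in> Arr C"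
      "Dom C t = Dom C q1" "Cod C t = Dom C \<gamma>" and g: "\<gamma> \<cdot> t = \<alpha> \<cdot> q1" and fc: "fibrewise_constant C q1 t"
    note P [simp] = pullback_arrs(1-8)[OF pb]
    let ?q = "pb_snd C q'' \<alpha>"
    obtain r' i' where r' [simp]: "r' \<in> Arr C" "Dom C r' = Dom C ?q" "Cod C r' = Dom C q1"
      and i' [simp]: "i' \<in> Arr C" "Dom C i' = Dom C q1" "Cod C i' = Dom C ?q"
      and qr': "q1 \<cdot> r' = ?q" and qi': "?q \<cdot> i' = q1" and ri': "r' \<cdot> i' = Ident C (Dom C q1)"
      using lift[OF pb] by blast
    have "fibrewise_constant C ?q (t \<cdot> r')"
      unfolding fibrewise_constant_def
    proof (intro allI impI)
      fix s s' assume [simp]: "s \<in> Arr C" "s' \<in> Arr C" "Dom C s = Dom C s'" "Cod C s = Dom C ?q"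
        "Cod C s' = Dom C ?q" and e: "?q \<cdot> s = ?q \<cdot> s'"
      have "t \<cdot> (r' \<cdot> s) = t \<cdot> (r' \<cdot> s')"
        by (rule fibrewise_constantD[OF fc]) (simp_all add: qr'[THEN reassoc] e)
      then show "(t \<cdot> r') \<cdot> s = (t \<cdot> r') \<cdot> s'"
        by simp
    qed
    then obtain u where u: "u \<in> Arr C" "Dom C u = Dom C \<alpha>" "Cod C u = Dom C \<gamma>" "u \<cdot> ?q = t \<cdot> r'" "\<gamma> \<cdot> u = \<alpha>"
      by - (rule stable_quotD[OF sq pb_pullback[of q'' \<alpha>], of \<gamma> "t \<cdot> r'"], simp_all add: g[THEN reassoc] qr')
    note [simp] = u(1-3)
    have "u \<cdot> q1 = t"
      unfolding qi'[symmetric] by (simp add: u(4)[THEN reassoc] ri')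
    with u show "\<exists>u \<in> Arr C. Dom C u = Dom C \<alpha> \<and> Cod C u = Dom C \<gamma> \<and> u \<cdot> q1 = t \<and> \<gamma> \<cdot> u = \<alpha>"
      by blast
  qed
  moreover have "effective C q"
    unfolding effective_def
  proof (intro allI impI)
    fix f m1 m2 \<xi> assume d: "descent_datum C q f m1 m2 \<xi>"
    note D [simp] = datumD(1,2,4-6)[OF d] and fx = datumD(7)[OF d]
    note M = datumD(3)[OF d]
    have Marrs [simp]: "m1 \<in> Arr C" "m2 \<in> Arr C" "Cod C m1 = Dom C q" "Cod C m2 = Dom C f" "Dom C m2 = Dom C m1"
      using pullback_arrs[OF M] by simp_all
    have Msq: "q \<cdot> m1 = q \<cdot> (f \<cdot> m2)"
      using pullback_arrs(9)[OF M] by simp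
    \<comment> \<open>The datum is pulled back along \<open>r\<close>: a point of \<open>f''\<close>
      is a point of the domain of \<open>q''\<close> together with a point of \<open>f\<close> over
      its image under \<open>r\<close>.\<close>
    define f'' where "f'' = pb_fst C r f"
    define g where "g = pb_snd C r f"
    have F: "is_pullback C r f f'' g"
      unfolding f''_def g_def by (rule pb_pullback) simp_all
    note [simp] = pullback_arrs(3,4,6-8)[OF F]
    note Fsq = pullback_arrs(9)[OF F]
    define n1 where "n1 = pb_fst C q'' (q'' \<cdot> f'')"
    define n2 where "n2 = pb_snd C q'' (q'' \<cdot> f'')"
    have N: "is_pullback C q'' (q'' \<cdot> f'') n1 n2"
      unfolding n1_def n2_def by (rule pb_pullback) simp_all
    have [simp]: "n1 \<in> Arr C" "n2 \<in> Arr C" "Cod C n1 = Dom C q''" "Cod C n2 = Dom C f''" "Dom C n2 = Dom C n1"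
      using pullback_arrs[OF N] by simp_all
    have Nsq: "q'' \<cdot> n1 = q'' \<cdot> (f'' \<cdot> n2)"
      using pullback_arrs(9)[OF N] by simp
    have qf: "q'' \<cdot> f'' = q \<cdot> (f \<cdot> g)"
      by (simp add: Fsq[symmetric] re)
    \<comment> \<open>\<open>w\<close> applies \<open>r\<close> to the target point and
      \<open>g\<close> to the transported one, so that \<open>\<xi>\<close> can act. Then
      \<open>\<xi>''\<close> keeps the target \<open>n1\<close> and transports the second coordinate
      by \<open>\<xi>\<close>.\<close>
    obtain w where w: "w \<in> Arr C" "Dom C w = Dom C n1" "Cod C w = Dom C m1" "m1 \<cdot> w = r \<cdot> n1" "m2 \<cdot> w = g \<cdot> n2"
      by (rule pullback_ex[OF M, of "r \<cdot> n1" "g \<cdot> n2" "Dom C n1"]) (simp_all add: re Nsq qf[THEN reassoc])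
    note [simp] = w(1-3)
    obtain \<xi>'' where X: "\<xi>'' \<in> Arr C" "Dom C \<xi>'' = Dom C n1" "Cod C \<xi>'' = Dom C f''" "f'' \<cdot> \<xi>'' = n1" "g \<cdot> \<xi>'' = \<xi> \<cdot> w"
      by (rule pullback_ex[OF F, of n1 "\<xi> \<cdot> w" "Dom C n1"]) (simp_all add: fx[THEN reassoc] w(4))
    note [simp] = X(1-3)
    have "descent_datum C q'' f'' n1 n2 \<xi>''"
      unfolding descent_datum_def
    proof (intro conjI allI impI N)
      fix u assume [simp]: "u \<in> Arr C" "Cod C u = Dom C n1" and e: "n1 \<cdot> u = f'' \<cdot> (n2 \<cdot> u)"
      have "\<xi> \<cdot> (w \<cdot> u) = m2 \<cdot> (w \<cdot> u)"
        by (rule datum_unit[OF d]) (simp_all add: w(4,5)[THEN reassoc] e Fsq[THEN reassoc])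
      then show "\<xi>'' \<cdot> u = n2 \<cdot> u"
        by - (rule pullback_eq[OF F], simp_all add: X(4,5)[THEN reassoc] w(5)[THEN reassoc] e)
    next
      fix u u' v assume [simp]: "u \<in> Arr C" "u' \<in> Arr C" "v \<in> Arr C" "Dom C u' = Dom C u" "Dom C v = Dom C u"
        "Cod C u = Dom C n1" "Cod C u' = Dom C n1" "Cod C v = Dom C n1"
        and e: "n2 \<cdot> v = \<xi>'' \<cdot> u" "n1 \<cdot> u' = n1 \<cdot> v" "n2 \<cdot> u' = n2 \<cdot> u"
      have "\<xi> \<cdot> (w \<cdot> v) = \<xi> \<cdot> (w \<cdot> u')"
        by (rule datum_assoc[OF d, of "w \<cdot> u"]) (simp_all add: w(4,5)[THEN reassoc] X(5)[THEN reassoc] e)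
      then show "\<xi>'' \<cdot> v = \<xi>'' \<cdot> u'"
        by - (rule pullback_eq[OF F], simp_all add: X(4,5)[THEN reassoc] e)
    qed (simp_all add: X(4))
    then obtain z \<pi> where pb: "is_pullback C q'' z f'' \<pi>" and eq: "\<pi> \<cdot> \<xi>'' = \<pi> \<cdot> n2"
      using eff unfolding effective_def by blast
    note [simp] = pullback_arrs(1-8)[OF pb]
    note zsq = pullback_arrs(9)[OF pb]
    \<comment> \<open>The section of \<open>g\<close> induced by \<open>i\<close>. It embeds
      \<open>f\<close> into \<open>f''\<close>, and restricting \<open>\<pi>\<close> along it gives
      the projection for \<open>q\<close>.\<close>
    obtain \<sigma> where S: "\<sigma> \<in> Arr C" "Dom C \<sigma> = Dom C f" "Cod C \<sigma> = Dom C f''" "f'' \<cdot> \<sigma> = i \<cdot> f" "g \<cdot> \<sigma> = Ident C (Dom C f)"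
      by (rule pullback_ex[OF F, of "i \<cdot> f" "Ident C (Dom C f)" "Dom C f"]) (simp_all add: re)
    note [simp] = S(1-3)
    note Sre = S(4,5)[THEN reassoc]
    have "is_pullback C q z f (\<pi> \<cdot> \<sigma>)"
    proof (rule pullbackI)
      show "q \<cdot> f = z \<cdot> (\<pi> \<cdot> \<sigma>)"
        by (simp add: zsq[symmetric, THEN reassoc] S(4) re)
    next
      fix s k assume [simp]: "s \<in> Arr C" "k \<in> Arr C" "Dom C k = Dom C s" "Cod C s = Dom C q"
        "Cod C k = Dom C z" and e: "q \<cdot> s = z \<cdot> k"
      obtain x where x: "x \<in> Arr C" "Dom C x = Dom C s" "Cod C x = Dom C f''" "f'' \<cdot> x = i \<cdot> s" "\<pi> \<cdot> x = k"
        by (rule pullback_ex[OF pb, of "i \<cdot> s" k "Dom C s"]) (simp_all add: re e)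
      note [simp] = x(1-3)
      have fg: "f \<cdot> (g \<cdot> x) = s"
        by (simp add: Fsq[symmetric, THEN reassoc] x(4) re)
      have "\<sigma> \<cdot> (g \<cdot> x) = x"
        by (rule pullback_eq[OF F]) (simp_all add: Sre fg x(4))
      then have "(\<pi> \<cdot> \<sigma>) \<cdot> (g \<cdot> x) = k"
        by (simp add: x(5))
      with fg show "\<exists>u \<in> Arr C. Dom C u = Dom C s \<and> Cod C u = Dom C f \<and> f \<cdot> u = s \<and> (\<pi> \<cdot> \<sigma>) \<cdot> u = k"
        by (intro bexI[of _ "g \<cdot> x"]) simp_all
    next
      fix s t assume [simp]: "s \<in> Arr C" "t \<in> Arr C" "Dom C s = Dom C t" "Cod C s = Dom C f"
        "Cod C t = Dom C f" and e: "f \<cdot> s = f \<cdot> t" "(\<pi> \<cdot> \<sigma>) \<cdot> s = (\<pi> \<cdot> \<sigma>) \<cdot> t"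
      have "\<sigma> \<cdot> s = \<sigma> \<cdot> t"
        by (rule pullback_eq[OF pb]) (use e in \<open>simp_all add: Sre\<close>)
      then have "g \<cdot> (\<sigma> \<cdot> s) = g \<cdot> (\<sigma> \<cdot> t)"
        by simp
      then show "s = t"
        by (simp add: Sre)
    qed simp_all
    moreover have "(\<pi> \<cdot> \<sigma>) \<cdot> \<xi> = (\<pi> \<cdot> \<sigma>) \<cdot> m2"
    proof -
      \<comment> \<open>The embedding \<open>\<sigma>\<close> extended to transport problems:
        through \<open>x\<close> the transport \<open>\<xi>''\<close> restricts to
        \<open>\<xi>\<close>, so the equation for \<open>\<pi>\<close> restricts too.\<close>
      obtain x where x: "x \<in> Arr C" "Dom C x = Dom C m1" "Cod C x = Dom C n1" "n1 \<cdot> x = i \<cdot> m1" "n2 \<cdot> x = \<sigma> \<cdot> m2"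
        by (rule pullback_ex[OF N, of "i \<cdot> m1" "\<sigma> \<cdot> m2" "Dom C m1"]) (simp_all add: re Msq Sre)
      note [simp] = x(1-3)
      have wx: "w \<cdot> x = Ident C (Dom C m1)"
        by (rule pullback_eq[OF M]) (simp_all add: w(4,5)[THEN reassoc] x(4,5) re Sre)
      have "\<xi>'' \<cdot> x = \<sigma> \<cdot> \<xi>"
        by (rule pullback_eq[OF F]) (simp_all add: X(4,5)[THEN reassoc] x(4) Sre fx wx)
      then have "\<pi> \<cdot> (\<sigma> \<cdot> \<xi>) = \<pi> \<cdot> (\<xi>'' \<cdot> x)"
        by simp
      also have "\<dots> = \<pi> \<cdot> (\<sigma> \<cdot> m2)"
        by (simp add: eq[THEN reassoc] x(5))
      finally show ?thesis
        by simp
    qed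
    ultimately show "\<exists>z \<pi>. is_pullback C q z f \<pi> \<and> \<pi> \<cdot> \<xi> = \<pi> \<cdot> m2"
      by blast
  qed
  ultimately show ?thesis
    unfolding effective_descent_iff descent_iff by simp
qed

end

text \<open>The laws quantify over all elements of the target category, which need not come from
  \<open>C\<close>. Each law is therefore reduced to one universal element, built from pullbacks in
  \<open>C\<close> and hence preserved by \<open>F\<close>.\<close>

lemma descent_datum_functor:
  assumes "cat_functor C D F" and pres: "preserves_pullbacks C D F" and "has_pullbacks C"
    and d: "descent_datum C q f m1 m2 \<xi>"
  shows "descent_datum D (FArr F q) (FArr F f) (FArr F m1) (FArr F m2) (FArr F \<xi>)"
proof -
  interpret F: cat_functor C D F by fact
  interpret C: category_pb C
    by unfold_locales fact
  note DD [simp] = F.dom.datumD(1,2,4-7)[OF d]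
  note M = F.dom.datumD(3)[OF d]
  have Marrs [simp]: "q \<in> Arr C" "m1 \<in> Arr C" "m2 \<in> Arr C" "Cod C m1 = Dom C q" "Cod C m2 = Dom C f" "Dom C m2 = Dom C m1"
    using F.dom.pullback_arrs[OF M] by simp_all
  have Msq: "q \<cdot>\<^bsub>C\<^esub> m1 = q \<cdot>\<^bsub>C\<^esub> (f \<cdot>\<^bsub>C\<^esub> m2)"
    using F.dom.pullback_arrs(9)[OF M] by simp
  have FM: "is_pullback D (FArr F q) (FArr F q \<cdot>\<^bsub>D\<^esub> FArr F f) (FArr F m1) (FArr F m2)"
    using pres M unfolding preserves_pullbacks_def by fastforce
  \<comment> \<open>The universal element for the unit law: a point of \<open>f\<close>, transported
    to where it already is.\<close>
  obtain \<eta> where eta [simp]: "\<eta> \<in> Arr C" "Dom C \<eta> = Dom C f" "Cod C \<eta> = Dom C m1" "m1 \<cdot>\<^bsub>C\<^esub> \<eta> = f" "m2 \<cdot>\<^bsub>C\<^esub> \<eta> = Ident C (Dom C f)"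
    by (rule F.dom.pullback_ex[OF M, of f "Ident C (Dom C f)" "Dom C f"]) simp_all
  have "\<xi> \<cdot>\<^bsub>C\<^esub> \<eta> = Ident C (Dom C f)"
    using F.dom.datum_unit[OF d, of \<eta>] by simp
  then have Fxe: "FArr F \<xi> \<cdot>\<^bsub>D\<^esub> FArr F \<eta> = Ident D (FObj F (Dom C f))"
    using F.FArr_comp[of \<xi> \<eta>] by simp
  have Fe: "FArr F m1 \<cdot>\<^bsub>D\<^esub> FArr F \<eta> = FArr F f" "FArr F m2 \<cdot>\<^bsub>D\<^esub> FArr F \<eta> = Ident D (FObj F (Dom C f))"
    using F.FArr_comp[of m1 \<eta>] F.FArr_comp[of m2 \<eta>] by simp_all
  \<comment> \<open>The universal pair of successive transports: \<open>N2\<close> is the first one,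
    and \<open>N1\<close> starts from its result. The direct transport \<open>u0\<close> is
    determined by this pair.\<close>
  define N1 where "N1 = pb_fst C m2 \<xi>"
  define N2 where "N2 = pb_snd C m2 \<xi>"
  have N: "is_pullback C m2 \<xi> N1 N2"
    unfolding N1_def N2_def by (rule C.pb_pullback) simp_all
  note [simp] = F.dom.pullback_arrs(3,4,6-8)[OF N]
  note Nsq = F.dom.pullback_arrs(9)[OF N]
  have "q \<cdot>\<^bsub>C\<^esub> (m1 \<cdot>\<^bsub>C\<^esub> N1) = q \<cdot>\<^bsub>C\<^esub> (f \<cdot>\<^bsub>C\<^esub> (m2 \<cdot>\<^bsub>C\<^esub> N2))"
    by (simp add: Msq[THEN F.dom.reassoc] Nsq DD(6)[THEN F.dom.reassoc])
  then obtain u0 where u0: "u0 \<in> Arr C" "Dom C u0 = Dom C N1" "Cod C u0 = Dom C m1" "m1 \<cdot>\<^bsub>C\<^esub> u0 = m1 \<cdot>\<^bsub>C\<^esub> N1" "m2 \<cdot>\<^bsub>C\<^esub> u0 = m2 \<cdot>\<^bsub>C\<^esub> N2"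
    by - (rule F.dom.pullback_ex[OF M, of "m1 \<cdot>\<^bsub>C\<^esub> N1" "m2 \<cdot>\<^bsub>C\<^esub> N2" "Dom C N1"], simp_all)
  note [simp] = u0(1-3)
  have "\<xi> \<cdot>\<^bsub>C\<^esub> N1 = \<xi> \<cdot>\<^bsub>C\<^esub> u0"
    by (rule F.dom.datum_assoc[OF d, of N2]) (simp_all add: u0 Nsq)
  then have xN: "FArr F \<xi> \<cdot>\<^bsub>D\<^esub> FArr F N1 = FArr F \<xi> \<cdot>\<^bsub>D\<^esub> FArr F u0"
    using F.FArr_comp[of \<xi> N1] F.FArr_comp[of \<xi> u0] by simp
  have Fu0: "FArr F m1 \<cdot>\<^bsub>D\<^esub> FArr F u0 = FArr F m1 \<cdot>\<^bsub>D\<^esub> FArr F N1" "FArr F m2 \<cdot>\<^bsub>D\<^esub> FArr F u0 = FArr F m2 \<cdot>\<^bsub>D\<^esub> FArr F N2"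
    using arg_cong[OF u0(4), of "FArr F"] arg_cong[OF u0(5), of "FArr F"] by simp_all
  have FN: "is_pullback D (FArr F m2) (FArr F \<xi>) (FArr F N1) (FArr F N2)"
    using pres N unfolding preserves_pullbacks_def by blast
  show ?thesis
    unfolding descent_datum_def
  proof (intro conjI allI impI FM)
    fix u assume [simp]: "u \<in> Arr D" "Cod D u = Dom D (FArr F m1)"
      and e: "FArr F m1 \<cdot>\<^bsub>D\<^esub> u = FArr F f \<cdot>\<^bsub>D\<^esub> (FArr F m2 \<cdot>\<^bsub>D\<^esub> u)"
    have "u = FArr F \<eta> \<cdot>\<^bsub>D\<^esub> (FArr F m2 \<cdot>\<^bsub>D\<^esub> u)"
      by (rule F.cod.pullback_eq[OF FM]) (simp_all add: e Fe[THEN F.cod.reassoc])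
    then have "FArr F \<xi> \<cdot>\<^bsub>D\<^esub> u = FArr F \<xi> \<cdot>\<^bsub>D\<^esub> (FArr F \<eta> \<cdot>\<^bsub>D\<^esub> (FArr F m2 \<cdot>\<^bsub>D\<^esub> u))"
      by simp
    then show "FArr F \<xi> \<cdot>\<^bsub>D\<^esub> u = FArr F m2 \<cdot>\<^bsub>D\<^esub> u"
      by (simp add: Fxe[THEN F.cod.reassoc])
  next
    fix u u' v assume u [simp]: "u \<in> Arr D" "u' \<in> Arr D" "v \<in> Arr D" "Dom D u' = Dom D u" "Dom D v = Dom D u"
      "Cod D u = Dom D (FArr F m1)" "Cod D u' = Dom D (FArr F m1)" "Cod D v = Dom D (FArr F m1)"
      and e: "FArr F m2 \<cdot>\<^bsub>D\<^esub> v = FArr F \<xi> \<cdot>\<^bsub>D\<^esub> u" "FArr F m1 \<cdot>\<^bsub>D\<^esub> u' = FArr F m1 \<cdot>\<^bsub>D\<^esub> v"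
      "FArr F m2 \<cdot>\<^bsub>D\<^esub> u' = FArr F m2 \<cdot>\<^bsub>D\<^esub> u"
    obtain n where n: "n \<in> Arr D" "Dom D n = Dom D u" "Cod D n = Dom D (FArr F N1)" "FArr F N1 \<cdot>\<^bsub>D\<^esub> n = v" "FArr F N2 \<cdot>\<^bsub>D\<^esub> n = u"
      by (rule F.cod.pullback_ex[OF FN, of v u "Dom D u"]) (simp_all add: e)
    note [simp] = n(1-3)
    have "u' = FArr F u0 \<cdot>\<^bsub>D\<^esub> n"
      by (rule F.cod.pullback_eq[OF FM]) (simp_all add: e Fu0[THEN F.cod.reassoc] n(4,5))
    then show "FArr F \<xi> \<cdot>\<^bsub>D\<^esub> v = FArr F \<xi> \<cdot>\<^bsub>D\<^esub> u'"
      unfolding n(4)[symmetric] by (simp add: xN[THEN F.cod.reassoc])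
  qed (use F.FArr_comp[of f \<xi>] in simp_all)
qed

section \<open>Graphs and categories over a cartesian monad\<close>

locale cartesian_setup = category_pb V for V :: "('o, 'm) cat" (structure) +
  fixes T :: "('o, 'm) monad"
  assumes cartesian: "cartesian_monad V T"
begin

sublocale T: cat_functor V V "MFun T"
  using cartesian unfolding cartesian_monad_def is_monad_def by blast

lemma T_pullback:
  "is_pullback V f g p q \<Longrightarrow> is_pullback V (MArr T f) (MArr T g) (MArr T p) (MArr T q)"
  using cartesian unfolding cartesian_monad_def preserves_pullbacks_def by blast

lemma unit_nat_trans: "nat_trans V V id_func (MFun T) (MUnit T)"
  and mult_nat_trans: "nat_trans V V (MFun T \<circ>\<^sub>F MFun T) (MFun T) (MMult T)"
  using cartesian unfolding cartesian_monad_def is_monad_def by blast+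

text \<open>In this orientation \<open>f\<close> is a pullback of its image under \<open>T\<close>;
  the hypotheses on the images of p_1 and p_2 reach p_1 and p_2 through this square.\<close>

lemma unit_pullback:
  assumes "f \<in> Arr V"
  shows "is_pullback V (MArr T f) (MUnit T (Cod V f)) (MUnit T (Dom V f)) f"
proof -
  have "is_pullback V (MUnit T (Cod V f)) (MArr T f) f (MUnit T (Dom V f))"
    using cartesian assms unfolding cartesian_monad_def cartesian_nat_trans_def id_func_def by simp
  then show ?thesis
    by (rule pullback_sym)
qed

lemma unit_arr [simp]:
  assumes "a \<in> Obj V"
  shows "MUnit T a \<in> Arr V" "Dom V (MUnit T a) = a" "Cod V (MUnit T a) = MObj T a"
  using nat_transD(1-3)[OF unit_nat_trans assms] by (simp_all add: id_func_def)

lemma mult_arr [simp]: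
  assumes "a \<in> Obj V"
  shows "MMult T a \<in> Arr V" "Dom V (MMult T a) = MObj T (MObj T a)" "Cod V (MMult T a) = MObj T a"
  using nat_transD(1-3)[OF mult_nat_trans assms] by (simp_all add: comp_func_def)

lemma unit_natural [simp]:
  "f \<in> Arr V \<Longrightarrow> Cod V f = b \<Longrightarrow> MUnit T b \<cdot> f = MArr T f \<cdot> MUnit T (Dom V f)"
  using nat_transD(4)[OF unit_nat_trans, of f] by (simp add: id_func_def)

lemma mult_natural:
  "f \<in> Arr V \<Longrightarrow> Cod V f = b \<Longrightarrow> MMult T b \<cdot> MArr T (MArr T f) = MArr T f \<cdot> MMult T (Dom V f)"
  using nat_transD(4)[OF mult_nat_trans, of f] by (simp add: comp_func_def)

lemma mult_natural' [simp]:
  assumes "f \<in> Arr V" "Cod V f = b"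
  shows "MMult T b \<cdot> MArr T (MArr T f) = MArr T f \<cdot> MMult T (Dom V f)"
    and "u \<in> Arr V \<Longrightarrow> Cod V u = MObj T (MObj T (Dom V f)) \<Longrightarrow>
      MMult T b \<cdot> (MArr T (MArr T f) \<cdot> u) = MArr T f \<cdot> (MMult T (Dom V f) \<cdot> u)"
proof -
  have "b \<in> Obj V"
    using assms by auto
  then show "u \<in> Arr V \<Longrightarrow> Cod V u = MObj T (MObj T (Dom V f)) \<Longrightarrow>
      MMult T b \<cdot> (MArr T (MArr T f) \<cdot> u) = MArr T f \<cdot> (MMult T (Dom V f) \<cdot> u)"
    using reassoc[OF mult_natural[OF assms], of u] assms by simp
qed (rule mult_natural[OF assms])

text \<open>Together with \<open>reassoc\<close> this yields up to four rewrite rules per equation: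
  itself and its image under \<open>T\<close>, each alone or inside a longer composite.\<close>

lemma T_eq:
  assumes "g \<cdot> f = k" "f \<in> Arr V" "g \<in> Arr V" "Cod V f = Dom V g"
  shows "MArr T g \<cdot> MArr T f = MArr T k"
  using assms T.FArr_comp[of g f] by simp

text \<open>Split off from \<open>is_tcat\<close> because a composition can only be constructed
  after the 2-chains, and these need no more than the graph.\<close>

definition tgraph :: "('o, 'm) tcat \<Rightarrow> bool" where
  "tgraph x \<longleftrightarrow> tob0 x \<in> Obj V \<and> tob1 x \<in> Obj V \<and>
     td1 x \<in> Hom V (tob1 x) (MObj T (tob0 x)) \<and> td0 x \<in> Hom V (tob1 x) (tob0 x)"

lemma tgraph_arrs [simp]:
  assumes "tgraph x"
  shows "tob0 x \<in> Obj V" "tob1 x \<in> Obj V"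
    "td1 x \<in> Arr V" "Dom V (td1 x) = tob1 x" "Cod V (td1 x) = MObj T (tob0 x)"
    "td0 x \<in> Arr V" "Dom V (td0 x) = tob1 x" "Cod V (td0 x) = tob0 x"
  using assms unfolding tgraph_def in_Hom by simp_all

text \<open>The chain objects only depend on the underlying graph.\<close>

abbreviation "ob2 \<equiv> tob2 V T"
abbreviation "pi0 \<equiv> tpi0 V T"
abbreviation "pi2 \<equiv> tpi2 V T"
abbreviation "ob3 x \<equiv> Dom V (trho0 V T x)"
abbreviation "rho0 \<equiv> trho0 V T"
abbreviation "rho3 \<equiv> trho3 V T"
abbreviation "pair2 \<equiv> tpair2 V T"
abbreviation "pair3 \<equiv> tpair3 V T"
abbreviation "fmap2 \<equiv> tmap2 V T"
abbreviation "fmap3 \<equiv> tmap3 V T"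

lemma pullback2: "tgraph x \<Longrightarrow> is_pullback V (td1 x) (MArr T (td0 x)) (pi0 x) (pi2 x)"
  unfolding tpi0_def tpi2_def by (rule pb_pullback) simp_all

lemma chain2 [simp]:
  assumes "tgraph x"
  shows "ob2 x \<in> Obj V"
    "pi0 x \<in> Arr V" "Dom V (pi0 x) = ob2 x" "Cod V (pi0 x) = tob1 x"
    "pi2 x \<in> Arr V" "Dom V (pi2 x) = ob2 x" "Cod V (pi2 x) = MObj T (tob1 x)"
  using pullback_arrs[OF pullback2[OF assms]] assms unfolding tob2_def by simp_all

lemma square2: "tgraph x \<Longrightarrow> td1 x \<cdot> pi0 x = MArr T (td0 x) \<cdot> pi2 x"
  by (rule pullback_arrs(9)[OF pullback2])

lemma pullback3: "tgraph x \<Longrightarrow> is_pullback V (pi2 x) (MArr T (pi0 x)) (rho0 x) (rho3 x)"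
  unfolding trho0_def trho3_def by (rule pb_pullback) simp_all

lemma chain3 [simp]:
  assumes "tgraph x"
  shows "rho0 x \<in> Arr V" "Cod V (rho0 x) = ob2 x"
    "rho3 x \<in> Arr V" "Dom V (rho3 x) = ob3 x" "Cod V (rho3 x) = MObj T (ob2 x)"
  using pullback_arrs[OF pullback3[OF assms]] assms by simp_all

lemma square3: "tgraph x \<Longrightarrow> pi2 x \<cdot> rho0 x = MArr T (pi0 x) \<cdot> rho3 x"
  by (rule pullback_arrs(9)[OF pullback3])

lemmas squares [simp] = square2 square2[THEN reassoc] square3 square3[THEN reassoc]
  square2[THEN T_eq, simplified] square2[THEN T_eq, THEN reassoc, simplified]

lemma pair2 [simp]:
  assumes "tgraph x" "h \<in> Arr V" "k \<in> Arr V" "Dom V k = Dom V h" "Cod V h = tob1 x"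
    "Cod V k = MObj T (tob1 x)" "td1 x \<cdot> h = MArr T (td0 x) \<cdot> k"
  shows "pair2 x h k \<in> Arr V" "Dom V (pair2 x h k) = Dom V h" "Cod V (pair2 x h k) = ob2 x"
    "pi0 x \<cdot> pair2 x h k = h" "pi2 x \<cdot> pair2 x h k = k"
  using pb_pair[of "td1 x" "MArr T (td0 x)" h k] assms
  unfolding tpair2_def tpi0_def tpi2_def tob2_def by simp_all

lemma pair3 [simp]:
  assumes "tgraph x" "h \<in> Arr V" "k \<in> Arr V" "Dom V k = Dom V h" "Cod V h = ob2 x"
    "Cod V k = MObj T (ob2 x)" "pi2 x \<cdot> h = MArr T (pi0 x) \<cdot> k"
  shows "pair3 x h k \<in> Arr V" "Dom V (pair3 x h k) = Dom V h" "Cod V (pair3 x h k) = ob3 x"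
    "rho0 x \<cdot> pair3 x h k = h" "rho3 x \<cdot> pair3 x h k = k"
  using pb_pair[of "pi2 x" "MArr T (pi0 x)" h k] assms
  unfolding tpair3_def trho0_def trho3_def by simp_all

lemma chain2_eq:
  assumes "tgraph x" "u \<in> Arr V" "v \<in> Arr V" "Dom V u = Dom V v" "Cod V u = ob2 x" "Cod V v = ob2 x"
    "pi0 x \<cdot> u = pi0 x \<cdot> v" "pi2 x \<cdot> u = pi2 x \<cdot> v"
  shows "u = v"
  using pullback_eq[OF pullback2[OF assms(1)]] assms by simp

definition graph_map :: "('o, 'm) tfun \<Rightarrow> bool" where
  "graph_map \<phi> \<longleftrightarrow> tgraph (tsrc \<phi>) \<and> tgraph (ttgt \<phi>) \<and>
     tmap0 \<phi> \<in> Hom V (tob0 (tsrc \<phi>)) (tob0 (ttgt \<phi>)) \<and>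
     tmap1 \<phi> \<in> Hom V (tob1 (tsrc \<phi>)) (tob1 (ttgt \<phi>)) \<and>
     td0 (ttgt \<phi>) \<cdot> tmap1 \<phi> = tmap0 \<phi> \<cdot> td0 (tsrc \<phi>) \<and>
     td1 (ttgt \<phi>) \<cdot> tmap1 \<phi> = MArr T (tmap0 \<phi>) \<cdot> td1 (tsrc \<phi>)"

lemma graph_map_tgraph [simp]: "graph_map \<phi> \<Longrightarrow> tgraph (tsrc \<phi>)" "graph_map \<phi> \<Longrightarrow> tgraph (ttgt \<phi>)"
  unfolding graph_map_def by simp_all

lemma graph_map_arrs [simp]:
  assumes "graph_map \<phi>"
  shows "tmap0 \<phi> \<in> Arr V" "Dom V (tmap0 \<phi>) = tob0 (tsrc \<phi>)" "Cod V (tmap0 \<phi>) = tob0 (ttgt \<phi>)"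
    "tmap1 \<phi> \<in> Arr V" "Dom V (tmap1 \<phi>) = tob1 (tsrc \<phi>)" "Cod V (tmap1 \<phi>) = tob1 (ttgt \<phi>)"
  using assms unfolding graph_map_def in_Hom by simp_all

lemma graph_map_eqs:
  assumes "graph_map \<phi>" "ttgt \<phi> = y"
  shows "td0 y \<cdot> tmap1 \<phi> = tmap0 \<phi> \<cdot> td0 (tsrc \<phi>)"
    "td1 y \<cdot> tmap1 \<phi> = MArr T (tmap0 \<phi>) \<cdot> td1 (tsrc \<phi>)"
  using assms unfolding graph_map_def by blast+

lemmas graph_map_eqs_simps [simp] = graph_map_eqs graph_map_eqs[THEN reassoc]
  graph_map_eqs[THEN T_eq, simplified] graph_map_eqs[THEN T_eq, THEN reassoc, simplified]

lemma fmap2: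
  assumes [simp]: "graph_map \<phi>"
  shows "fmap2 \<phi> \<in> Arr V" "Dom V (fmap2 \<phi>) = ob2 (tsrc \<phi>)" "Cod V (fmap2 \<phi>) = ob2 (ttgt \<phi>)"
    "pi0 (ttgt \<phi>) \<cdot> fmap2 \<phi> = tmap1 \<phi> \<cdot> pi0 (tsrc \<phi>)"
    "pi2 (ttgt \<phi>) \<cdot> fmap2 \<phi> = MArr T (tmap1 \<phi>) \<cdot> pi2 (tsrc \<phi>)"
  unfolding tmap2_def by simp_all

lemmas map2_arr [simp] = fmap2(1-3)

lemma map2_eqs:
  assumes "graph_map \<phi>" "ttgt \<phi> = y"
  shows "pi0 y \<cdot> fmap2 \<phi> = tmap1 \<phi> \<cdot> pi0 (tsrc \<phi>)"
    "pi2 y \<cdot> fmap2 \<phi> = MArr T (tmap1 \<phi>) \<cdot> pi2 (tsrc \<phi>)"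
  using fmap2(4,5)[OF assms(1)] assms(2) by simp_all

lemmas map2_eqs_simps [simp] = map2_eqs map2_eqs[THEN reassoc]
  map2_eqs[THEN T_eq, simplified] map2_eqs[THEN T_eq, THEN reassoc, simplified]

lemma fmap3:
  assumes [simp]: "graph_map \<phi>"
  shows "fmap3 \<phi> \<in> Arr V" "Dom V (fmap3 \<phi>) = ob3 (tsrc \<phi>)" "Cod V (fmap3 \<phi>) = ob3 (ttgt \<phi>)"
    "rho0 (ttgt \<phi>) \<cdot> fmap3 \<phi> = fmap2 \<phi> \<cdot> rho0 (tsrc \<phi>)"
    "rho3 (ttgt \<phi>) \<cdot> fmap3 \<phi> = MArr T (fmap2 \<phi>) \<cdot> rho3 (tsrc \<phi>)"
  unfolding tmap3_def by simp_all

lemmas map3_arr [simp] = fmap3(1-3)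

lemma map3_eqs:
  assumes "graph_map \<phi>" "ttgt \<phi> = y"
  shows "rho0 y \<cdot> fmap3 \<phi> = fmap2 \<phi> \<cdot> rho0 (tsrc \<phi>)"
    "rho3 y \<cdot> fmap3 \<phi> = MArr T (fmap2 \<phi>) \<cdot> rho3 (tsrc \<phi>)"
  using fmap3(4,5)[OF assms(1)] assms(2) by simp_all

lemmas map3_eqs_simps [simp] = map3_eqs map3_eqs[THEN reassoc]

text \<open>
  A \<open>T\<close>-category without the unit and associativity laws. These laws equate arrows natural in
  maps of precategories, hence transfer along jointly monic or epic families of such maps.
\<close>

definition precat :: "('o, 'm) tcat \<Rightarrow> bool" where
  "precat x \<longleftrightarrow> tgraph x \<and> ts0 x \<in> Hom V (tob0 x) (tob1 x) \<and> tcomp x \<in> Hom V (ob2 x) (tob1 x) \<and>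
     td0 x \<cdot> ts0 x = Ident V (tob0 x) \<and>
     td1 x \<cdot> ts0 x = MUnit T (tob0 x) \<and>
     td0 x \<cdot> tcomp x = td0 x \<cdot> pi0 x \<and>
     td1 x \<cdot> tcomp x = MMult T (tob0 x) \<cdot> MArr T (td1 x) \<cdot> pi2 x"

lemma precat_tgraph [simp]: "precat x \<Longrightarrow> tgraph x"
  unfolding precat_def by simp

lemma precat_arrs [simp]:
  assumes "precat x"
  shows "ts0 x \<in> Arr V" "Dom V (ts0 x) = tob0 x" "Cod V (ts0 x) = tob1 x"
    "tcomp x \<in> Arr V" "Dom V (tcomp x) = ob2 x" "Cod V (tcomp x) = tob1 x"
  using assms unfolding precat_def in_Hom by simp_all

lemma precat_eqs:
  assumes "precat x"
  shows "td0 x \<cdot> ts0 x = Ident V (tob0 x)" "td1 x \<cdot> ts0 x = MUnit T (tob0 x)"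
    "td0 x \<cdot> tcomp x = td0 x \<cdot> pi0 x"
    "td1 x \<cdot> tcomp x = MMult T (tob0 x) \<cdot> (MArr T (td1 x) \<cdot> pi2 x)"
  using assms precat_tgraph[OF assms] unfolding precat_def by simp_all

lemmas precat_eqs_simps [simp] = precat_eqs precat_eqs[THEN reassoc]
  precat_eqs[THEN T_eq, simplified] precat_eqs[THEN T_eq, THEN reassoc, simplified]

definition prefun :: "('o, 'm) tfun \<Rightarrow> bool" where
  "prefun \<phi> \<longleftrightarrow> graph_map \<phi> \<and> precat (tsrc \<phi>) \<and> precat (ttgt \<phi>) \<and>
     tmap1 \<phi> \<cdot> ts0 (tsrc \<phi>) = ts0 (ttgt \<phi>) \<cdot> tmap0 \<phi> \<and>
     tmap1 \<phi> \<cdot> tcomp (tsrc \<phi>) = tcomp (ttgt \<phi>) \<cdot> fmap2 \<phi>"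

lemma prefun_precat [simp]: "prefun \<phi> \<Longrightarrow> graph_map \<phi>" "prefun \<phi> \<Longrightarrow> precat (tsrc \<phi>)" "prefun \<phi> \<Longrightarrow> precat (ttgt \<phi>)"
  unfolding prefun_def by simp_all

lemma prefun_eqs:
  assumes "prefun \<phi>" "ttgt \<phi> = y"
  shows "ts0 y \<cdot> tmap0 \<phi> = tmap1 \<phi> \<cdot> ts0 (tsrc \<phi>)" "tcomp y \<cdot> fmap2 \<phi> = tmap1 \<phi> \<cdot> tcomp (tsrc \<phi>)"
  using assms unfolding prefun_def by simp_all

lemmas prefun_eqs_simps [simp] = prefun_eqs prefun_eqs[THEN reassoc]
  prefun_eqs[THEN T_eq, simplified] prefun_eqs[THEN T_eq, THEN reassoc, simplified]

text \<open>The arrows into the 2-chains whose composites with \<open>tcomp x\<close> are the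
  nontrivial sides of the laws: an arrow with an identity on either side, and the two ways of
  contracting a 3-chain.\<close>

definition "lid_pair x = pair2 x (ts0 x \<cdot> td0 x) (MUnit T (tob1 x))"
definition "rid_pair x = pair2 x (Ident V (tob1 x)) (MArr T (ts0 x) \<cdot> td1 x)"
definition "lassoc_pair x = pair2 x (pi0 x \<cdot> rho0 x) (MArr T (tcomp x) \<cdot> rho3 x)"
definition "rassoc_pair x =
  pair2 x (tcomp x \<cdot> rho0 x) (MMult T (tob1 x) \<cdot> (MArr T (pi2 x) \<cdot> rho3 x))"

lemma law_pairs [simp]:
  assumes [simp]: "precat x"
  shows "lid_pair x \<in> Arr V" "Dom V (lid_pair x) = tob1 x" "Cod V (lid_pair x) = ob2 x"
    "pi0 x \<cdot> lid_pair x = ts0 x \<cdot> td0 x" "pi2 x \<cdot> lid_pair x = MUnit T (tob1 x)"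
    and "rid_pair x \<in> Arr V" "Dom V (rid_pair x) = tob1 x" "Cod V (rid_pair x) = ob2 x"
    "pi0 x \<cdot> rid_pair x = Ident V (tob1 x)" "pi2 x \<cdot> rid_pair x = MArr T (ts0 x) \<cdot> td1 x"
    and "lassoc_pair x \<in> Arr V" "Dom V (lassoc_pair x) = ob3 x" "Cod V (lassoc_pair x) = ob2 x"
    "pi0 x \<cdot> lassoc_pair x = pi0 x \<cdot> rho0 x" "pi2 x \<cdot> lassoc_pair x = MArr T (tcomp x) \<cdot> rho3 x"
    and "rassoc_pair x \<in> Arr V" "Dom V (rassoc_pair x) = ob3 x" "Cod V (rassoc_pair x) = ob2 x"
    "pi0 x \<cdot> rassoc_pair x = tcomp x \<cdot> rho0 x"
    "pi2 x \<cdot> rassoc_pair x = MMult T (tob1 x) \<cdot> (MArr T (pi2 x) \<cdot> rho3 x)"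
  unfolding lid_pair_def rid_pair_def lassoc_pair_def rassoc_pair_def by simp_all

lemmas law_pairs_reassoc [simp] = law_pairs(4,5,9,10,14,15,19,20)[THEN reassoc]

lemma law_pairs_natural:
  assumes [simp]: "prefun \<phi>" "tsrc \<phi> = x" "ttgt \<phi> = y"
  shows "lid_pair y \<cdot> tmap1 \<phi> = fmap2 \<phi> \<cdot> lid_pair x" "rid_pair y \<cdot> tmap1 \<phi> = fmap2 \<phi> \<cdot> rid_pair x"
    "lassoc_pair y \<cdot> fmap3 \<phi> = fmap2 \<phi> \<cdot> lassoc_pair x" "rassoc_pair y \<cdot> fmap3 \<phi> = fmap2 \<phi> \<cdot> rassoc_pair x"
proof -
  have [simp]: "graph_map \<phi>" "precat x" "precat y"
    using prefun_precat[OF assms(1)] by simp_all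
  show "lid_pair y \<cdot> tmap1 \<phi> = fmap2 \<phi> \<cdot> lid_pair x"
    by (rule chain2_eq[of y]) simp_all
  show "rid_pair y \<cdot> tmap1 \<phi> = fmap2 \<phi> \<cdot> rid_pair x"
    by (rule chain2_eq[of y]) simp_all
  show "lassoc_pair y \<cdot> fmap3 \<phi> = fmap2 \<phi> \<cdot> lassoc_pair x"
    by (rule chain2_eq[of y]) simp_all
  show "rassoc_pair y \<cdot> fmap3 \<phi> = fmap2 \<phi> \<cdot> rassoc_pair x"
    by (rule chain2_eq[of y]) simp_all
qed

lemma tcat_iff:
  "is_tcat V T x \<longleftrightarrow> precat x \<and> tcomp x \<cdot> lid_pair x = Ident V (tob1 x) \<and>
     tcomp x \<cdot> rid_pair x = Ident V (tob1 x) \<and> tcomp x \<cdot> lassoc_pair x = tcomp x \<cdot> rassoc_pair x"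
proof -
  \<comment> \<open>The definition of \<open>is_tcat\<close> brackets this composite to the left,
    \<open>rassoc_pair\<close> to the right.\<close>
  have "MMult T (tob1 x) \<cdot> (MArr T (pi2 x) \<cdot> rho3 x) = MMult T (tob1 x) \<cdot> MArr T (pi2 x) \<cdot> rho3 x" if "precat x"
    using that by simp
  then show ?thesis
    unfolding is_tcat_def precat_def tgraph_def lid_pair_def rid_pair_def lassoc_pair_def rassoc_pair_def
    by (simp only: conj_assoc cong: conj_cong)
qed

lemma tfun_iff:
  "is_tfun V T x y \<phi> \<longleftrightarrow> prefun \<phi> \<and> tsrc \<phi> = x \<and> ttgt \<phi> = y \<and> is_tcat V T x \<and> is_tcat V T y"
  unfolding is_tfun_def prefun_def graph_map_def using tcat_iff precat_tgraph by auto

section \<open>The category of \<open>T\<close>-categories and its pullbacks\<close>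

lemma law_natural:
  assumes [simp]: "prefun \<phi>" "tsrc \<phi> = x" "ttgt \<phi> = y"
  shows "tmap1 \<phi> \<cdot> (tcomp x \<cdot> lid_pair x) = (tcomp y \<cdot> lid_pair y) \<cdot> tmap1 \<phi>"
    "tmap1 \<phi> \<cdot> (tcomp x \<cdot> rid_pair x) = (tcomp y \<cdot> rid_pair y) \<cdot> tmap1 \<phi>"
    "tmap1 \<phi> \<cdot> (tcomp x \<cdot> lassoc_pair x) = (tcomp y \<cdot> lassoc_pair y) \<cdot> fmap3 \<phi>"
    "tmap1 \<phi> \<cdot> (tcomp x \<cdot> rassoc_pair x) = (tcomp y \<cdot> rassoc_pair y) \<cdot> fmap3 \<phi>"
proof -
  have [simp]: "graph_map \<phi>" "precat x" "precat y"
    using prefun_precat[OF assms(1)] by simp_all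
  show "tmap1 \<phi> \<cdot> (tcomp x \<cdot> lid_pair x) = (tcomp y \<cdot> lid_pair y) \<cdot> tmap1 \<phi>"
    "tmap1 \<phi> \<cdot> (tcomp x \<cdot> rid_pair x) = (tcomp y \<cdot> rid_pair y) \<cdot> tmap1 \<phi>"
    "tmap1 \<phi> \<cdot> (tcomp x \<cdot> lassoc_pair x) = (tcomp y \<cdot> lassoc_pair y) \<cdot> fmap3 \<phi>"
    "tmap1 \<phi> \<cdot> (tcomp x \<cdot> rassoc_pair x) = (tcomp y \<cdot> rassoc_pair y) \<cdot> fmap3 \<phi>"
    by (simp_all add: law_pairs_natural[of \<phi> x y])
qed

lemma tfun_eqI: "tsrc \<phi> = tsrc \<psi> \<Longrightarrow> ttgt \<phi> = ttgt \<psi> \<Longrightarrow> tmap0 \<phi> = tmap0 \<psi> \<Longrightarrow> tmap1 \<phi> = tmap1 \<psi> \<Longrightarrow> \<phi> = \<psi>"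
  for \<phi> \<psi> :: "('o, 'm) tfun"
  by simp

abbreviation "TC \<equiv> TCat V T"

lemma TCat_simps [simp]:
  "x \<in> Obj TC \<longleftrightarrow> is_tcat V T x" "\<phi> \<in> Arr TC \<longleftrightarrow> is_tfun V T (tsrc \<phi>) (ttgt \<phi>) \<phi>"
  "Dom TC = tsrc" "Cod TC = ttgt"
  "tsrc (Ident TC x) = x" "ttgt (Ident TC x) = x"
  "tmap0 (Ident TC x) = Ident V (tob0 x)" "tmap1 (Ident TC x) = Ident V (tob1 x)"
  "tsrc (\<psi> \<cdot>\<^bsub>TC\<^esub> \<phi>) = tsrc \<phi>" "ttgt (\<psi> \<cdot>\<^bsub>TC\<^esub> \<phi>) = ttgt \<psi>"
  "tmap0 (\<psi> \<cdot>\<^bsub>TC\<^esub> \<phi>) = tmap0 \<psi> \<cdot> tmap0 \<phi>" "tmap1 (\<psi> \<cdot>\<^bsub>TC\<^esub> \<phi>) = tmap1 \<psi> \<cdot> tmap1 \<phi>"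
  by (simp_all add: TCat_def)

lemma graph_map_comp [simp]:
  assumes [simp]: "graph_map \<phi>" "graph_map \<psi>" "ttgt \<phi> = tsrc \<psi>"
  shows "graph_map (\<psi> \<cdot>\<^bsub>TC\<^esub> \<phi>)"
  unfolding graph_map_def in_Hom by simp

lemma map2_comp:
  assumes [simp]: "graph_map \<phi>" "graph_map \<psi>" "ttgt \<phi> = tsrc \<psi>"
  shows "fmap2 (\<psi> \<cdot>\<^bsub>TC\<^esub> \<phi>) = fmap2 \<psi> \<cdot> fmap2 \<phi>"
  by (rule chain2_eq[of "ttgt \<psi>"]) simp_all

lemma graph_map_ident [simp]: "tgraph x \<Longrightarrow> graph_map (Ident TC x)"
  unfolding graph_map_def in_Hom by simp

lemma map2_ident:
  assumes [simp]: "tgraph x"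
  shows "fmap2 (Ident TC x) = Ident V (ob2 x)"
  by (rule chain2_eq[of x]) simp_all

lemma prefun_comp:
  assumes [simp]: "prefun \<phi>" "prefun \<psi>" "ttgt \<phi> = tsrc \<psi>"
  shows "prefun (\<psi> \<cdot>\<^bsub>TC\<^esub> \<phi>)"
proof -
  have [simp]: "precat (tsrc \<phi>)" "precat (ttgt \<psi>)" "precat (tsrc \<psi>)"
    using prefun_precat[OF assms(1)] prefun_precat[OF assms(2)] by simp_all
  have "tmap1 \<psi> \<cdot> (tmap1 \<phi> \<cdot> ts0 (tsrc \<phi>)) = tmap1 \<psi> \<cdot> (ts0 (tsrc \<psi>) \<cdot> tmap0 \<phi>)"
    "tmap1 \<psi> \<cdot> (tmap1 \<phi> \<cdot> tcomp (tsrc \<phi>)) = tmap1 \<psi> \<cdot> (tcomp (tsrc \<psi>) \<cdot> fmap2 \<phi>)"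
    by simp_all
  then show ?thesis
    unfolding prefun_def by (simp add: map2_comp)
qed

lemma tfun_comp:
  assumes "is_tfun V T x y \<phi>" "is_tfun V T y z \<psi>"
  shows "is_tfun V T x z (\<psi> \<cdot>\<^bsub>TC\<^esub> \<phi>)"
  using assms unfolding tfun_iff by (simp add: prefun_comp)

lemma tfun_ident: "is_tcat V T x \<Longrightarrow> is_tfun V T x x (Ident TC x)"
  unfolding tfun_iff prefun_def tcat_iff by (simp add: map2_ident)

lemma TCat_category: "category TC"
proof (rule categoryI, goal_cases)
  case (1 \<phi>) then show ?case by (simp add: tfun_iff)
next
  case (2 x) then show ?case by (simp add: tfun_ident)
next
  case (3 \<phi> \<psi>) then show ?case
    using tfun_comp[of "tsrc \<phi>" "ttgt \<phi>" \<phi> "ttgt \<psi>" \<psi>] by simp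
next
  case (4 \<phi>)
  then have "prefun \<phi>" by (simp add: tfun_iff)
  then have "graph_map \<phi>" by simp
  then show ?case by (intro conjI tfun_eqI) simp_all
next
  case (5 \<phi> \<psi> \<chi>)
  then have "prefun \<phi>" "prefun \<psi>" "prefun \<chi>" by (simp_all add: tfun_iff)
  then have "graph_map \<phi>" "graph_map \<psi>" "graph_map \<chi>" by simp_all
  then show ?case using 5(4,5) by (intro tfun_eqI) simp_all
qed

sublocale TC: category TC
  by (rule TCat_category)

section \<open>Levels of T-categories and levelwise pullbacks\<close>

definition "level0 = \<lparr>FObj = tob0, FArr = tmap0\<rparr>"
definition "level1 = \<lparr>FObj = tob1, FArr = tmap1\<rparr>"
definition "level2 = \<lparr>FObj = ob2, FArr = fmap2\<rparr>"

lemma level_simps [simp]: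
  "FObj level0 = tob0" "FArr level0 = tmap0" "FObj level1 = tob1" "FArr level1 = tmap1"
  "FObj level2 = ob2" "FArr level2 = fmap2"
  by (simp_all add: level0_def level1_def level2_def)

text \<open>Data are descended along levels 0 to 2. On 3-chains only equations are compared, for
  which the square of \<open>graph_pullback_level3\<close> suffices.\<close>

lemma level_functors:
  shows "cat_functor TC V level0" "cat_functor TC V level1" "cat_functor TC V level2"
  by (rule cat_functorI; simp add: TCat_category category_axioms tcat_iff tfun_iff map2_ident map2_comp)+

text \<open>Stated for graph maps, so that it applies while the composition of the apex is still to
  be constructed.\<close>

definition graph_pullback ::
    "('o, 'm) tfun \<Rightarrow> ('o, 'm) tfun \<Rightarrow> ('o, 'm) tfun \<Rightarrow> ('o, 'm) tfun \<Rightarrow> bool" where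
  "graph_pullback f g a b \<longleftrightarrow> graph_map f \<and> graph_map g \<and> graph_map a \<and> graph_map b \<and>
     ttgt g = ttgt f \<and> ttgt a = tsrc f \<and> ttgt b = tsrc g \<and> tsrc b = tsrc a \<and>
     is_pullback V (tmap0 f) (tmap0 g) (tmap0 a) (tmap0 b) \<and>
     is_pullback V (tmap1 f) (tmap1 g) (tmap1 a) (tmap1 b)"

text \<open>Limits commute: 2-chains are a pullback of level 1 and \<open>T\<close> of level 1 over
  \<open>T\<close> of level 0, and \<open>T\<close> preserves the given squares.\<close>

lemma graph_pullback_level2:
  assumes gp: "graph_pullback f g a b"
  shows "is_pullback V (fmap2 f) (fmap2 g) (fmap2 a) (fmap2 b)"
proof -
  have [simp]: "graph_map f" "graph_map g" "graph_map a" "graph_map b"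
    "ttgt g = ttgt f" "ttgt a = tsrc f" "ttgt b = tsrc g" "tsrc b = tsrc a"
    and S0: "is_pullback V (tmap0 f) (tmap0 g) (tmap0 a) (tmap0 b)"
    and S1: "is_pullback V (tmap1 f) (tmap1 g) (tmap1 a) (tmap1 b)"
    using gp unfolding graph_pullback_def by simp_all
  show ?thesis
    by (rule pullback_of_pullbacks[OF S1 T_pullback[OF S0] T_pullback[OF S1]
          pullback2[of "tsrc a"] pullback2[of "tsrc f"] pullback2[of "tsrc g"] pullback2[of "ttgt f"]])
      simp_all
qed

lemma graph_pullback_level3:
  assumes gp: "graph_pullback f g a b"
  shows "is_pullback V (fmap3 f) (fmap3 g) (fmap3 a) (fmap3 b)"
proof -
  have [simp]: "graph_map f" "graph_map g" "graph_map a" "graph_map b"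
    "ttgt g = ttgt f" "ttgt a = tsrc f" "ttgt b = tsrc g" "tsrc b = tsrc a"
    and S1: "is_pullback V (tmap1 f) (tmap1 g) (tmap1 a) (tmap1 b)"
    using gp unfolding graph_pullback_def by simp_all
  note S2 = graph_pullback_level2[OF gp]
  show ?thesis
    by (rule pullback_of_pullbacks[OF S2 T_pullback[OF S1] T_pullback[OF S2]
          pullback3[of "tsrc a"] pullback3[of "tsrc f"] pullback3[of "tsrc g"] pullback3[of "ttgt f"]])
      simp_all
qed

text \<open>The mediating arrows of levels 0 and 1 form a functor automatically: each compatibility
  is an equation into a level of \<open>P\<close>, or into its image under \<open>T\<close>, and the
  two projections detect it.\<close>

lemma TCat_pullbackI:
  assumes tf: "f \<in> Arr TC" "g \<in> Arr TC" "a \<in> Arr TC" "b \<in> Arr TC" and gp: "graph_pullback f g a b"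
  shows "is_pullback TC f g a b"
proof -
  define P A B Z where "P = tsrc a" and "A = tsrc f" and "B = tsrc g" and "Z = ttgt f"
  note [simp] = P_def[symmetric] A_def[symmetric] B_def[symmetric] Z_def[symmetric]
  have [simp]: "ttgt g = Z" "ttgt a = A" "ttgt b = B" "tsrc b = P"
    and S0: "is_pullback V (tmap0 f) (tmap0 g) (tmap0 a) (tmap0 b)"
    and S1: "is_pullback V (tmap1 f) (tmap1 g) (tmap1 a) (tmap1 b)"
    using gp unfolding graph_pullback_def by simp_all
  have [simp]: "prefun f" "prefun g" "prefun a" "prefun b" and tc: "is_tcat V T P" "is_tcat V T A" "is_tcat V T B" "is_tcat V T Z"
    using tf by (simp_all add: tfun_iff)
  have [simp]: "precat P" "precat A" "precat B" "precat Z"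
    using tc by (simp_all add: tcat_iff)
  note sq = pullback_arrs(9)[OF S0] pullback_arrs(9)[OF S1]
  show ?thesis
  proof (rule TC.pullbackI)
    show "f \<cdot>\<^bsub>TC\<^esub> a = g \<cdot>\<^bsub>TC\<^esub> b"
      by (rule tfun_eqI) (simp_all add: sq)
  next
    fix h k
    assume "h \<in> Arr TC" "k \<in> Arr TC" "Dom TC k = Dom TC h" "Cod TC h = Dom TC f" "Cod TC k = Dom TC g"
      and e: "f \<cdot>\<^bsub>TC\<^esub> h = g \<cdot>\<^bsub>TC\<^esub> k"
    then obtain W where hk: "is_tfun V T W A h" "is_tfun V T W B k"
      by simp
    have [simp]: "prefun h" "prefun k" "tsrc h = W" "ttgt h = A" "tsrc k = W" "ttgt k = B"
      and W: "is_tcat V T W"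
      using hk by (simp_all add: tfun_iff)
    have [simp]: "precat W"
      using W by (simp add: tcat_iff)
    have e': "tmap0 f \<cdot> tmap0 h = tmap0 g \<cdot> tmap0 k" "tmap1 f \<cdot> tmap1 h = tmap1 g \<cdot> tmap1 k"
      using arg_cong[OF e, of tmap0] arg_cong[OF e, of tmap1] by simp_all
    obtain u0 where u0 [simp]: "u0 \<in> Arr V" "Dom V u0 = tob0 W" "Cod V u0 = tob0 P"
      and u0e: "tmap0 a \<cdot> u0 = tmap0 h" "tmap0 b \<cdot> u0 = tmap0 k"
      using e' by - (rule pullback_ex[OF S0, of "tmap0 h" "tmap0 k" "tob0 W"], simp_all)
    obtain u1 where u1 [simp]: "u1 \<in> Arr V" "Dom V u1 = tob1 W" "Cod V u1 = tob1 P"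
      and u1e: "tmap1 a \<cdot> u1 = tmap1 h" "tmap1 b \<cdot> u1 = tmap1 k"
      using e' by - (rule pullback_ex[OF S1, of "tmap1 h" "tmap1 k" "tob1 W"], simp_all)
    note ue = u0e u1e u0e[THEN reassoc] u1e[THEN reassoc] u0e[THEN T_eq] u0e[THEN T_eq, THEN reassoc]
    define u where "u = \<lparr>tsrc = W, ttgt = P, tmap0 = u0, tmap1 = u1\<rparr>"
    have [simp]: "tsrc u = W" "ttgt u = P" "tmap0 u = u0" "tmap1 u = u1"
      by (simp_all add: u_def)
    \<comment> \<open>For \<open>a\<close> and \<open>b\<close> the functor equations are needed in
      reverse, moving structure maps of \<open>P\<close> outward to \<open>A\<close> and
      \<open>B\<close>; the default rules would undo this and are removed below.\<close>
    have ca: "tmap0 a \<cdot> td0 P = td0 A \<cdot> tmap1 a" "tmap0 b \<cdot> td0 P = td0 B \<cdot> tmap1 b"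
      "MArr T (tmap0 a) \<cdot> td1 P = td1 A \<cdot> tmap1 a" "MArr T (tmap0 b) \<cdot> td1 P = td1 B \<cdot> tmap1 b"
      "tmap1 a \<cdot> ts0 P = ts0 A \<cdot> tmap0 a" "tmap1 b \<cdot> ts0 P = ts0 B \<cdot> tmap0 b"
      "tmap1 a \<cdot> tcomp P = tcomp A \<cdot> fmap2 a" "tmap1 b \<cdot> tcomp P = tcomp B \<cdot> fmap2 b"
      by simp_all
    have ch: "td0 A \<cdot> tmap1 h = tmap0 h \<cdot> td0 W" "td0 B \<cdot> tmap1 k = tmap0 k \<cdot> td0 W"
      "td1 A \<cdot> tmap1 h = MArr T (tmap0 h) \<cdot> td1 W" "td1 B \<cdot> tmap1 k = MArr T (tmap0 k) \<cdot> td1 W"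
      "ts0 A \<cdot> tmap0 h = tmap1 h \<cdot> ts0 W" "ts0 B \<cdot> tmap0 k = tmap1 k \<cdot> ts0 W"
      "tcomp A \<cdot> fmap2 h = tmap1 h \<cdot> tcomp W" "tcomp B \<cdot> fmap2 k = tmap1 k \<cdot> tcomp W"
      by simp_all
    note re = ue ca ca[THEN reassoc] ch
    note [simp del] = graph_map_eqs_simps prefun_eqs_simps
    have "td0 P \<cdot> u1 = u0 \<cdot> td0 W"
      by (rule pullback_eq[OF S0]) (simp_all add: re)
    moreover have "td1 P \<cdot> u1 = MArr T u0 \<cdot> td1 W"
      by (rule pullback_eq[OF T_pullback[OF S0]]) (simp_all add: re)
    ultimately have u_graph [simp]: "graph_map u"
      unfolding graph_map_def in_Hom by simp
    have s: "u1 \<cdot> ts0 W = ts0 P \<cdot> u0"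
      by (rule pullback_eq[OF S1]) (simp_all add: re)
    have au: "a \<cdot>\<^bsub>TC\<^esub> u = h" "b \<cdot>\<^bsub>TC\<^esub> u = k"
      by (intro tfun_eqI; simp add: ue)+
    have u2: "fmap2 a \<cdot> fmap2 u = fmap2 h" "fmap2 b \<cdot> fmap2 u = fmap2 k"
      using map2_comp[of u a] map2_comp[of u b] by (simp_all add: au)
    have c: "u1 \<cdot> tcomp W = tcomp P \<cdot> fmap2 u"
      by (rule pullback_eq[OF S1]) (simp_all add: re u2)
    have "is_tfun V T W P u"
      unfolding tfun_iff prefun_def using W tc(1) s c by simp
    then show "\<exists>u \<in> Arr TC. Dom TC u = Dom TC h \<and> Cod TC u = Dom TC a \<and> a \<cdot>\<^bsub>TC\<^esub> u = h \<and> b \<cdot>\<^bsub>TC\<^esub> u = k"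
      using au by (intro bexI[of _ u]) simp_all
  next
    fix u v
    assume uv: "u \<in> Arr TC" "v \<in> Arr TC" "Dom TC u = Dom TC v" "Cod TC u = Dom TC a" "Cod TC v = Dom TC a"
      and e: "a \<cdot>\<^bsub>TC\<^esub> u = a \<cdot>\<^bsub>TC\<^esub> v" "b \<cdot>\<^bsub>TC\<^esub> u = b \<cdot>\<^bsub>TC\<^esub> v"
    have [simp]: "prefun u" "prefun v" "tsrc u = tsrc v" "ttgt u = P" "ttgt v = P"
      using uv by (simp_all add: tfun_iff)
    have "tmap0 u = tmap0 v"
      by (rule pullback_eq[OF S0])
        (use arg_cong[OF e(1), of tmap0] arg_cong[OF e(2), of tmap0] in simp_all)
    moreover have "tmap1 u = tmap1 v"
      by (rule pullback_eq[OF S1])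
        (use arg_cong[OF e(1), of tmap1] arg_cong[OF e(2), of tmap1] in simp_all)
    ultimately show "u = v"
      by (intro tfun_eqI) simp_all
  qed (use tf in simp_all)
qed

text \<open>The structure maps are the arrows induced between the level pullbacks, and all laws hold
  because the projections to \<open>A\<close> and \<open>B\<close> are jointly monic.\<close>

lemma graph_pullback_ex:
  assumes tf: "f \<in> Arr TC" "g \<in> Arr TC" and gf: "ttgt g = ttgt f"
  shows "\<exists>a b. a \<in> Arr TC \<and> b \<in> Arr TC \<and> graph_pullback f g a b"
proof -
  define A B Z where "A = tsrc f" and "B = tsrc g" and "Z = ttgt f"
  note [simp] = A_def[symmetric] B_def[symmetric] Z_def[symmetric]
  have [simp]: "ttgt g = Z"
    using gf by simp
  have [simp]: "prefun f" "prefun g" and tc: "is_tcat V T A" "is_tcat V T B"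
    using tf by (simp_all add: tfun_iff)
  have [simp]: "precat A" "precat B" "precat Z"
    using tc prefun_precat(3)[of f] by (simp_all add: tcat_iff)
  define a0 b0 a1 b1 where "a0 = pb_fst V (tmap0 f) (tmap0 g)" and "b0 = pb_snd V (tmap0 f) (tmap0 g)"
    and "a1 = pb_fst V (tmap1 f) (tmap1 g)" and "b1 = pb_snd V (tmap1 f) (tmap1 g)"
  have S0: "is_pullback V (tmap0 f) (tmap0 g) a0 b0"
    unfolding a0_def b0_def by (rule pb_pullback) simp_all
  have S1: "is_pullback V (tmap1 f) (tmap1 g) a1 b1"
    unfolding a1_def b1_def by (rule pb_pullback) simp_all
  note [simp] = pullback_arrs(3,4,6-8)[OF S0] pullback_arrs(3,4,6-8)[OF S1]
  note sq = pullback_arrs(9)[OF S0] pullback_arrs(9)[OF S1]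
  have ch: "tmap0 f \<cdot> td0 A = td0 Z \<cdot> tmap1 f" "tmap0 g \<cdot> td0 B = td0 Z \<cdot> tmap1 g"
      "MArr T (tmap0 f) \<cdot> td1 A = td1 Z \<cdot> tmap1 f" "MArr T (tmap0 g) \<cdot> td1 B = td1 Z \<cdot> tmap1 g"
      "tmap1 f \<cdot> ts0 A = ts0 Z \<cdot> tmap0 f" "tmap1 g \<cdot> ts0 B = ts0 Z \<cdot> tmap0 g"
      "tmap1 f \<cdot> tcomp A = tcomp Z \<cdot> fmap2 f" "tmap1 g \<cdot> tcomp B = tcomp Z \<cdot> fmap2 g"
    by simp_all
  obtain \<delta>0 where d0 [simp]: "\<delta>0 \<in> Arr V" "Dom V \<delta>0 = Dom V a1" "Cod V \<delta>0 = Dom V a0"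
    and d0e: "a0 \<cdot> \<delta>0 = td0 A \<cdot> a1" "b0 \<cdot> \<delta>0 = td0 B \<cdot> b1"
    by (rule pullback_ex[OF S0, of "td0 A \<cdot> a1" "td0 B \<cdot> b1" "Dom V a1"])
      (simp_all add: ch[THEN reassoc] sq del: graph_map_eqs_simps)
  obtain \<delta>1 where d1 [simp]: "\<delta>1 \<in> Arr V" "Dom V \<delta>1 = Dom V a1" "Cod V \<delta>1 = MObj T (Dom V a0)"
    and d1e: "MArr T a0 \<cdot> \<delta>1 = td1 A \<cdot> a1" "MArr T b0 \<cdot> \<delta>1 = td1 B \<cdot> b1"
    by (rule pullback_ex[OF T_pullback[OF S0], of "td1 A \<cdot> a1" "td1 B \<cdot> b1" "Dom V a1"])
      (simp_all add: ch[THEN reassoc] sq del: graph_map_eqs_simps)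
  obtain \<sigma> where s [simp]: "\<sigma> \<in> Arr V" "Dom V \<sigma> = Dom V a0" "Cod V \<sigma> = Dom V a1"
    and se: "a1 \<cdot> \<sigma> = ts0 A \<cdot> a0" "b1 \<cdot> \<sigma> = ts0 B \<cdot> b0"
    by (rule pullback_ex[OF S1, of "ts0 A \<cdot> a0" "ts0 B \<cdot> b0" "Dom V a0"])
      (simp_all add: ch[THEN reassoc] sq del: prefun_eqs_simps)
  \<comment> \<open>The composition field stays a parameter: its intended value starts at the
    2-chains of this very graph.\<close>
  define P where "P c = \<lparr>tob0 = Dom V a0, tob1 = Dom V a1, td1 = \<delta>1, td0 = \<delta>0, ts0 = \<sigma>, tcomp = c\<rparr>" for c
  have P [simp]: "tob0 (P c) = Dom V a0" "tob1 (P c) = Dom V a1" "td1 (P c) = \<delta>1" "td0 (P c) = \<delta>0"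
    "ts0 (P c) = \<sigma>" "tcomp (P c) = c" for c
    by (simp_all add: P_def)
  define a b where "a c = \<lparr>tsrc = P c, ttgt = A, tmap0 = a0, tmap1 = a1\<rparr>"
    and "b c = \<lparr>tsrc = P c, ttgt = B, tmap0 = b0, tmap1 = b1\<rparr>" for c
  have ab [simp]: "tsrc (a c) = P c" "ttgt (a c) = A" "tmap0 (a c) = a0" "tmap1 (a c) = a1"
    "tsrc (b c) = P c" "ttgt (b c) = B" "tmap0 (b c) = b0" "tmap1 (b c) = b1" for c
    by (simp_all add: a_def b_def)
  have [simp]: "tgraph (P c)" for c
    unfolding tgraph_def in_Hom by simp
  have [simp]: "graph_map (a c)" "graph_map (b c)" for c
    unfolding graph_map_def in_Hom by (simp_all add: d0e d1e)
  have gp: "graph_pullback f g (a c) (b c)" for c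
    unfolding graph_pullback_def using S0 S1 by simp
  note S2 = graph_pullback_level2[OF gp]
  \<comment> \<open>Chains ignore the composition field, so those of \<open>P undefined\<close>
    serve to construct \<open>c\<close> and coincide with those of \<open>P c\<close>.\<close>
  have indep: "ob2 (P c) = ob2 (P undefined)" "fmap2 (a c) = fmap2 (a undefined)" "fmap2 (b c) = fmap2 (b undefined)"
    "pi0 (P c) = pi0 (P undefined)" "pi2 (P c) = pi2 (P undefined)" for c
    by (simp_all add: tob2_def tmap2_def tpair2_def tpi0_def tpi2_def)
  let ?P = "P undefined" and ?a = "a undefined" and ?b = "b undefined"
  have "tcomp Z \<cdot> (fmap2 f \<cdot> fmap2 ?a) = tcomp Z \<cdot> (fmap2 g \<cdot> fmap2 ?b)"
    using pullback_arrs(9)[OF S2[of undefined]] by simp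
  then obtain c where c [simp]: "c \<in> Arr V" "Dom V c = ob2 ?P" "Cod V c = Dom V a1"
    and ce: "a1 \<cdot> c = tcomp A \<cdot> fmap2 ?a" "b1 \<cdot> c = tcomp B \<cdot> fmap2 ?b"
    by - (rule pullback_ex[OF S1, of "tcomp A \<cdot> fmap2 ?a" "tcomp B \<cdot> fmap2 ?b" "ob2 ?P"],
        simp_all add: ch[THEN reassoc] del: prefun_eqs_simps)
  note e = d0e d1e se ce
  note e' = e e[THEN reassoc] d0e[THEN T_eq, simplified] d0e[THEN T_eq, THEN reassoc, simplified]
    d1e[symmetric, THEN T_eq, simplified] d1e[symmetric, THEN T_eq, THEN reassoc, simplified]
  have "\<delta>0 \<cdot> \<sigma> = Ident V (Dom V a0)"
    by (rule pullback_eq[OF S0]) (simp_all add: e')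
  moreover have "\<delta>1 \<cdot> \<sigma> = MUnit T (Dom V a0)"
    by (rule pullback_eq[OF T_pullback[OF S0]]) (simp_all add: e')
  moreover have "\<delta>0 \<cdot> c = \<delta>0 \<cdot> pi0 ?P"
    by (rule pullback_eq[OF S0]) (simp_all add: e')
  moreover have "\<delta>1 \<cdot> c = MMult T (Dom V a0) \<cdot> (MArr T \<delta>1 \<cdot> pi2 ?P)"
    by (rule pullback_eq[OF T_pullback[OF S0]]) (simp_all add: e')
  ultimately have P_pre [simp]: "precat (P c)"
    unfolding precat_def in_Hom by (simp add: indep[of c])
  have ab_pre [simp]: "prefun (a c)" "prefun (b c)"
    unfolding prefun_def by (simp_all add: e indep[of c])
  have la: "tcomp A \<cdot> lid_pair A = Ident V (tob1 A)" "tcomp A \<cdot> rid_pair A = Ident V (tob1 A)"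
      "tcomp A \<cdot> lassoc_pair A = tcomp A \<cdot> rassoc_pair A"
    and lb: "tcomp B \<cdot> lid_pair B = Ident V (tob1 B)" "tcomp B \<cdot> rid_pair B = Ident V (tob1 B)"
      "tcomp B \<cdot> lassoc_pair B = tcomp B \<cdot> rassoc_pair B"
    using tc unfolding tcat_iff by blast+
  \<comment> \<open>From here on the domain of \<open>c\<close> is expressed through
    \<open>P c\<close>, the form in which the rules for precategories speak of it.\<close>
  have dom_c: "Dom V c = ob2 (P c)"
    unfolding indep(1)[of c] by (rule c(2))
  note [simp del] = c(2)
  note [simp] = dom_c
  have laws: "a1 \<cdot> (c \<cdot> lid_pair (P c)) = a1" "b1 \<cdot> (c \<cdot> lid_pair (P c)) = b1"
    "a1 \<cdot> (c \<cdot> rid_pair (P c)) = a1" "b1 \<cdot> (c \<cdot> rid_pair (P c)) = b1"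
    "a1 \<cdot> (c \<cdot> lassoc_pair (P c)) = a1 \<cdot> (c \<cdot> rassoc_pair (P c))"
    "b1 \<cdot> (c \<cdot> lassoc_pair (P c)) = b1 \<cdot> (c \<cdot> rassoc_pair (P c))"
    using law_natural[of "a c" "P c" A] law_natural[of "b c" "P c" B] by (simp_all add: la lb)
  have "c \<cdot> lid_pair (P c) = Ident V (Dom V a1)" "c \<cdot> rid_pair (P c) = Ident V (Dom V a1)"
    "c \<cdot> lassoc_pair (P c) = c \<cdot> rassoc_pair (P c)"
    by (rule pullback_eq[OF S1]; simp add: laws)+
  then have "is_tcat V T (P c)"
    unfolding tcat_iff by simp
  then have "a c \<in> Arr TC" "b c \<in> Arr TC"
    using tc by (simp_all add: tfun_iff)
  then show ?thesis
    using gp by blast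
qed

lemma TCat_has_pullbacks: "has_pullbacks TC"
  unfolding has_pullbacks_def
proof (intro ballI impI)
  fix f g assume fg: "f \<in> Arr TC" "g \<in> Arr TC" "Cod TC f = Cod TC g"
  have "ttgt g = ttgt f"
    using fg(3) by simp
  from graph_pullback_ex[OF fg(1,2) this] obtain a b
    where "a \<in> Arr TC" "b \<in> Arr TC" "graph_pullback f g a b"
    by blast
  then show "\<exists>a b. is_pullback TC f g a b"
    using TCat_pullbackI[OF fg(1,2)] by blast
qed

sublocale TC: category_pb TC
  by unfold_locales (rule TCat_has_pullbacks)

text \<open>An abstract pullback is isomorphic to the levelwise one, and the isomorphism restricts
  to each level.\<close>

lemma TCat_pullback_levels:
  assumes pb: "is_pullback TC f g a b"
  shows "graph_pullback f g a b"
proof -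
  have A: "f \<in> Arr TC" "g \<in> Arr TC" "a \<in> Arr TC" "b \<in> Arr TC" and E [simp]: "ttgt g = ttgt f"
    "ttgt a = tsrc f" "ttgt b = tsrc g" "tsrc b = tsrc a"
    using TC.pullback_arrs[OF pb] by (simp_all del: TCat_simps(2))
  obtain a' b' where A': "a' \<in> Arr TC" "b' \<in> Arr TC" and gp: "graph_pullback f g a' b'"
    using graph_pullback_ex[OF A(1,2) E(1)] by blast
  have pb': "is_pullback TC f g a' b'"
    by (rule TCat_pullbackI[OF A(1,2) A' gp])
  obtain j i where j: "j \<in> Arr TC" "i \<in> Arr TC" "Cod TC j = Dom TC a'" "Dom TC j = Dom TC a"
    "Dom TC i = Dom TC a'" "Cod TC i = Dom TC a" "j \<cdot>\<^bsub>TC\<^esub> i = Ident TC (Dom TC a')"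
    "i \<cdot>\<^bsub>TC\<^esub> j = Ident TC (Dom TC a)" "a' \<cdot>\<^bsub>TC\<^esub> j = a" "b' \<cdot>\<^bsub>TC\<^esub> j = b"
    by (rule TC.pullback_comparison[OF pb' pb])
  have G [simp]: "graph_map f" "graph_map g" "graph_map a" "graph_map b" "graph_map j" "graph_map i" "graph_map a'" "graph_map b'"
    using A A' j(1,2) by (simp_all add: tfun_iff)
  have [simp]: "ttgt j = tsrc a'" "tsrc j = tsrc a" "tsrc i = tsrc a'" "ttgt i = tsrc a"
    using j(3-6) by simp_all
  have S: "is_pullback V (tmap0 f) (tmap0 g) (tmap0 a') (tmap0 b')" "is_pullback V (tmap1 f) (tmap1 g) (tmap1 a') (tmap1 b')"
    using gp unfolding graph_pullback_def by blast+
  have inv: "tmap0 j \<cdot> tmap0 i = Ident V (tob0 (tsrc a'))" "tmap0 i \<cdot> tmap0 j = Ident V (tob0 (tsrc a))"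
    "tmap1 j \<cdot> tmap1 i = Ident V (tob1 (tsrc a'))" "tmap1 i \<cdot> tmap1 j = Ident V (tob1 (tsrc a))"
    using arg_cong[OF j(7), of tmap0] arg_cong[OF j(8), of tmap0]
      arg_cong[OF j(7), of tmap1] arg_cong[OF j(8), of tmap1] by simp_all
  have proj: "tmap0 a' \<cdot> tmap0 j = tmap0 a" "tmap0 b' \<cdot> tmap0 j = tmap0 b"
    "tmap1 a' \<cdot> tmap1 j = tmap1 a" "tmap1 b' \<cdot> tmap1 j = tmap1 b"
    using arg_cong[OF j(9), of tmap0] arg_cong[OF j(10), of tmap0]
      arg_cong[OF j(9), of tmap1] arg_cong[OF j(10), of tmap1] by simp_all
  show ?thesis
    unfolding graph_pullback_def
    using pullback_iso[OF S(1), of "tmap0 j" "tmap0 i"] pullback_iso[OF S(2), of "tmap1 j" "tmap1 i"]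
    by (simp add: inv proj)
qed

lemma level_preserves_pullbacks:
  "preserves_pullbacks TC V level0" "preserves_pullbacks TC V level1" "preserves_pullbacks TC V level2"
  using TCat_pullback_levels graph_pullback_level2 unfolding preserves_pullbacks_def graph_pullback_def
  by simp_all

end

section \<open>Descent along functors of \<open>T\<close>-categories\<close>

text \<open>Constancy on fibres amounts to agreement on the kernel pair of \<open>e\<close>, which
  \<open>F\<close> preserves.\<close>

lemma fibrewise_constant_functor:
  assumes "cat_functor C D F" and pres: "preserves_pullbacks C D F" and "has_pullbacks C"
    and [simp]: "e \<in> Arr C" "t \<in> Arr C" "Dom C t = Dom C e" and fc: "fibrewise_constant C e t"
  shows "fibrewise_constant D (FArr F e) (FArr F t)"
proof -
  interpret F: cat_functor C D F by fact
  interpret C: category_pb C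
    by unfold_locales fact
  define k l where "k = pb_fst C e e" and "l = pb_snd C e e"
  have K: "is_pullback C e e k l"
    unfolding k_def l_def by (rule C.pb_pullback) simp_all
  note [simp] = F.dom.pullback_arrs(3,4,6-8)[OF K]
  have "t \<cdot>\<^bsub>C\<^esub> k = t \<cdot>\<^bsub>C\<^esub> l"
    by (rule F.dom.fibrewise_constantD[OF fc]) (simp_all add: F.dom.pullback_arrs(9)[OF K])
  then have eq: "FArr F t \<cdot>\<^bsub>D\<^esub> FArr F k = FArr F t \<cdot>\<^bsub>D\<^esub> FArr F l"
    using F.FArr_comp[of t k] F.FArr_comp[of t l] by simp
  have FK: "is_pullback D (FArr F e) (FArr F e) (FArr F k) (FArr F l)"
    using pres K unfolding preserves_pullbacks_def by blast
  show ?thesis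
    unfolding fibrewise_constant_def
  proof (intro allI impI)
    fix r r' assume [simp]: "r \<in> Arr D" "r' \<in> Arr D" "Dom D r = Dom D r'" "Cod D r = Dom D (FArr F e)"
      "Cod D r' = Dom D (FArr F e)" and e: "FArr F e \<cdot>\<^bsub>D\<^esub> r = FArr F e \<cdot>\<^bsub>D\<^esub> r'"
    obtain n where [simp]: "n \<in> Arr D" "Dom D n = Dom D r'" "Cod D n = Dom D (FArr F k)"
      and n: "FArr F k \<cdot>\<^bsub>D\<^esub> n = r" "FArr F l \<cdot>\<^bsub>D\<^esub> n = r'"
      by (rule F.cod.pullback_ex[OF FK, of r r' "Dom D r'"]) (simp_all add: e)
    show "FArr F t \<cdot>\<^bsub>D\<^esub> r = FArr F t \<cdot>\<^bsub>D\<^esub> r'"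
      unfolding n[symmetric] by (simp add: eq[THEN F.cod.reassoc])
  qed
qed

text \<open>By \<open>kernel_transport\<close> a single equation decides constancy on the fibres of
  \<open>\<pi>\<close>. This supplies the premise for descending the structure maps.\<close>

lemma (in category) fibrewise_constant_transport:
  assumes pb: "is_pullback C q z f \<pi>" and m: "is_pullback C q (q \<cdot> f) m1 m2"
    and xi: "\<xi> \<in> Arr C" "Dom C \<xi> = Dom C m1" "Cod C \<xi> = Dom C f" "f \<cdot> \<xi> = m1" "\<pi> \<cdot> \<xi> = \<pi> \<cdot> m2"
    and t [simp]: "t \<in> Arr C" "Dom C t = Dom C \<pi>" and eq: "t \<cdot> \<xi> = t \<cdot> m2"
  shows "fibrewise_constant C \<pi> t"
  unfolding fibrewise_constant_def
proof (intro allI impI)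
  fix r r' assume r: "r \<in> Arr C" "r' \<in> Arr C" "Dom C r = Dom C r'" "Cod C r = Dom C \<pi>"
    "Cod C r' = Dom C \<pi>" "\<pi> \<cdot> r = \<pi> \<cdot> r'"
  note [simp] = pullback_arrs(1-8)[OF pb] xi(1-3)
  have [simp]: "m1 \<in> Arr C" "m2 \<in> Arr C" "Cod C m1 = Dom C q" "Cod C m2 = Dom C f" "Dom C m2 = Dom C m1"
    using pullback_arrs[OF m] by simp_all
  obtain u where [simp]: "u \<in> Arr C" "Dom C u = Dom C r'" "Cod C u = Dom C m1"
    and u: "m2 \<cdot> u = r" "\<xi> \<cdot> u = r'"
    by (rule kernel_transport[OF pb m xi r])
  show "t \<cdot> r = t \<cdot> r'"
    unfolding u[symmetric] by (simp add: eq[THEN reassoc])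
qed

text \<open>A variant for verifying laws: the composite with \<open>\<gamma>\<close> is computed for
  the simpler side only, and the other side is compared with it.\<close>

lemma (in category_pb) stable_epi_cancel':
  assumes q: "stable_epi C q" and pb: "is_pullback C q \<alpha> k q'"
    and "\<gamma> \<in> Arr C" "\<beta> \<in> Arr C" "Cod C \<beta> = Cod C \<gamma>" "Dom C \<beta> = Cod C q" "u \<in> Arr C" "v \<in> Arr C"
    "Dom C u = Dom C \<alpha>" "Dom C v = Dom C \<alpha>" "Cod C u = Dom C \<gamma>" "Cod C v = Dom C \<gamma>"
    "\<gamma> \<cdot> u = \<beta> \<cdot> \<alpha>" "\<gamma> \<cdot> u = \<gamma> \<cdot> v" "u \<cdot> q' = v \<cdot> q'"
  shows "u = v"
  using stable_epi_cancel[OF assms(1-12)] assms(13-15) by simp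

context cartesian_setup
begin

section \<open>From the levels of p to p itself\<close>

context
  fixes x y :: "('o, 'm) tcat" and p :: "('o, 'm) tfun"
  assumes p: "is_tfun V T x y p"
    and ed1': "effective_descent V (MArr T (tmap1 p))"
    and d2': "descent V (MArr T (fmap2 p))"
    and ad3: "almost_descent V (fmap3 p)"
begin

lemma p_simps [simp]: "prefun p" "tsrc p = x" "ttgt p = y" "is_tcat V T x" "is_tcat V T y"
  "precat x" "precat y" "graph_map p"
  using p prefun_precat[of p] unfolding tfun_iff by simp_all

lemma ed1: "effective_descent V (tmap1 p)"
  by (rule effective_descent_pullback[OF ed1' unit_pullback]) simp

lemma d2: "descent V (fmap2 p)"
  by (rule descent_pullback[OF d2' unit_pullback]) simp

text \<open>A point of the pullback of p_1 along \<open>ts0 y\<close> is an arrow of x lying over an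
  identity of y. Taking its codomain gives an object of x over the same object of y, and identity
  arrows give the section, so p_0 is a retract of this pullback.\<close>

lemma ed0: "effective_descent V (tmap0 p)"
proof -
  define h q where "h = pb_fst V (tmap1 p) (ts0 y)" and "q = pb_snd V (tmap1 p) (ts0 y)"
  have pb: "is_pullback V (tmap1 p) (ts0 y) h q"
    unfolding h_def q_def by (rule pb_pullback) simp_all
  note [simp] = pullback_arrs(3,4,6-8)[OF pb]
  note sq = pullback_arrs(9)[OF pb]
  obtain i where i [simp]: "i \<in> Arr V" "Dom V i = tob0 x" "Cod V i = Dom V h" and ie: "h \<cdot> i = ts0 x" "q \<cdot> i = tmap0 p"
    by (rule pullback_ex[OF pb, of "ts0 x" "tmap0 p" "tob0 x"]) simp_all
  have "(td0 y \<cdot> tmap1 p) \<cdot> h = td0 y \<cdot> (ts0 y \<cdot> q)"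
    by (simp add: sq del: graph_map_eqs_simps precat_eqs_simps)
  then have r: "tmap0 p \<cdot> (td0 x \<cdot> h) = q"
    by (simp add: precat_eqs(1)[THEN reassoc])
  show ?thesis
    by (rule effective_descent_retract[OF effective_descent_pullback[OF ed1 pb], of _ i "td0 x \<cdot> h"])
      (simp_all add: ie r)
qed

lemma stable:
  "stable_epi V (tmap0 p)" "stable_epi V (tmap1 p)" "stable_epi V (fmap2 p)" "stable_epi V (fmap3 p)"
  "stable_quot V (tmap0 p)" "stable_quot V (tmap1 p)" "stable_quot V (fmap2 p)"
  "effective V (tmap0 p)" "effective V (tmap1 p)"
  using ed0 ed1 d2 ad3 unfolding effective_descent_iff descent_iff almost_descent_iff by blast+

lemma stable_epi_TC: "stable_epi TC p"
  unfolding stable_epi_def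
proof (intro allI impI)
  fix \<alpha> k q \<gamma> u v
  assume pb: "is_pullback TC p \<alpha> k q" and arrs: "\<gamma> \<in> Arr TC" "u \<in> Arr TC" "v \<in> Arr TC"
    and ty: "Dom TC u = Dom TC \<alpha>" "Dom TC v = Dom TC \<alpha>" "Cod TC u = Dom TC \<gamma>" "Cod TC v = Dom TC \<gamma>"
    and g: "\<gamma> \<cdot>\<^bsub>TC\<^esub> u = \<alpha>" "\<gamma> \<cdot>\<^bsub>TC\<^esub> v = \<alpha>" and e: "u \<cdot>\<^bsub>TC\<^esub> q = v \<cdot>\<^bsub>TC\<^esub> q"
  have S: "is_pullback V (tmap0 p) (tmap0 \<alpha>) (tmap0 k) (tmap0 q)" "is_pullback V (tmap1 p) (tmap1 \<alpha>) (tmap1 k) (tmap1 q)"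
    and [simp]: "graph_map \<alpha>"
    using TCat_pullback_levels[OF pb] unfolding graph_pullback_def by blast+
  have [simp]: "graph_map \<gamma>" "graph_map u" "graph_map v"
    using arrs by (simp_all add: tfun_iff)
  have [simp]: "tsrc u = tsrc \<alpha>" "tsrc v = tsrc \<alpha>" "ttgt u = tsrc \<gamma>" "ttgt v = tsrc \<gamma>"
    using ty by simp_all
  have "tmap0 u = tmap0 v"
    by (rule stable_epiD[OF stable(1) S(1), of "tmap0 \<gamma>"])
      (use arg_cong[OF g(1), of tmap0] arg_cong[OF g(2), of tmap0] arg_cong[OF e, of tmap0] in simp_all)
  moreover have "tmap1 u = tmap1 v"
    by (rule stable_epiD[OF stable(2) S(2), of "tmap1 \<gamma>"])
      (use arg_cong[OF g(1), of tmap1] arg_cong[OF g(2), of tmap1] arg_cong[OF e, of tmap1] in simp_all)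
  ultimately show "u = v"
    by (intro tfun_eqI) simp_all
qed

text \<open>The factorizations at levels 0 and 1 form a functor because each compatibility can be
  cancelled at the level where it starts: level 1 for \<open>td0\<close> and \<open>td1\<close>,
  level 0 for \<open>ts0\<close>, level 2 for \<open>tcomp\<close>.\<close>

lemma stable_quot_TC: "stable_quot TC p"
  unfolding stable_quot_def
proof (intro allI impI)
  fix \<alpha> k q \<gamma> t
  assume pb: "is_pullback TC p \<alpha> k q" and arrs: "\<gamma> \<in> Arr TC" "t \<in> Arr TC"
    and ty: "Dom TC t = Dom TC q" "Cod TC t = Dom TC \<gamma>"
    and g: "\<gamma> \<cdot>\<^bsub>TC\<^esub> t = \<alpha> \<cdot>\<^bsub>TC\<^esub> q" and fc: "fibrewise_constant TC q t"
  note gp = TCat_pullback_levels[OF pb]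
  note S2 = graph_pullback_level2[OF gp]
  have S0: "is_pullback V (tmap0 p) (tmap0 \<alpha>) (tmap0 k) (tmap0 q)"
    and S1: "is_pullback V (tmap1 p) (tmap1 \<alpha>) (tmap1 k) (tmap1 q)"
    using gp unfolding graph_pullback_def by blast+
  define A G Q where "A = tsrc \<alpha>" and "G = tsrc \<gamma>" and "Q = tsrc q"
  have qa: "q \<in> Arr TC" "\<alpha> \<in> Arr TC" "Cod TC \<alpha> = Cod TC p" "Cod TC q = Dom TC \<alpha>"
    by (rule TC.pullback_arrs[OF pb])+
  have [simp]: "tsrc \<alpha> = A" "tsrc \<gamma> = G" "tsrc q = Q" "tsrc t = Q" "ttgt t = G" "ttgt \<alpha> = y" "ttgt q = A"
    using ty qa(3,4) by (simp_all add: A_def G_def Q_def)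
  have gy: "ttgt \<gamma> = ttgt \<alpha>"
    using arg_cong[OF g, of ttgt] by simp
  then have [simp]: "ttgt \<gamma> = y"
    by simp
  have [simp]: "prefun \<gamma>" "prefun t" "prefun q" "prefun \<alpha>" and tc: "is_tcat V T A" "is_tcat V T G" "is_tcat V T Q"
    using arrs qa(1,2) by (simp_all add: tfun_iff)
  have [simp]: "precat A" "precat G" "precat Q"
    using tc by (simp_all add: tcat_iff)
  have "fibrewise_constant V (tmap0 q) (tmap0 t)"
    using fibrewise_constant_functor[OF level_functors(1) level_preserves_pullbacks(1) TCat_has_pullbacks qa(1) arrs(2) ty(1) fc]
    by simp
  then obtain u0 where u0 [simp]: "u0 \<in> Arr V" "Dom V u0 = tob0 A" "Cod V u0 = tob0 G"
    and u0e: "u0 \<cdot> tmap0 q = tmap0 t" "tmap0 \<gamma> \<cdot> u0 = tmap0 \<alpha>"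
    using arg_cong[OF g, of tmap0] by - (rule stable_quotD[OF stable(5) S0, of "tmap0 \<gamma>" "tmap0 t"], simp_all)
  have "fibrewise_constant V (tmap1 q) (tmap1 t)"
    using fibrewise_constant_functor[OF level_functors(2) level_preserves_pullbacks(2) TCat_has_pullbacks qa(1) arrs(2) ty(1) fc]
    by simp
  then obtain u1 where u1 [simp]: "u1 \<in> Arr V" "Dom V u1 = tob1 A" "Cod V u1 = tob1 G"
    and u1e: "u1 \<cdot> tmap1 q = tmap1 t" "tmap1 \<gamma> \<cdot> u1 = tmap1 \<alpha>"
    using arg_cong[OF g, of tmap1] by - (rule stable_quotD[OF stable(6) S1, of "tmap1 \<gamma>" "tmap1 t"], simp_all)
  define u where "u = \<lparr>tsrc = A, ttgt = G, tmap0 = u0, tmap1 = u1\<rparr>"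
  have [simp]: "tsrc u = A" "ttgt u = G" "tmap0 u = u0" "tmap1 u = u1"
    by (simp_all add: u_def)
  \<comment> \<open>Reversed for \<open>\<gamma>\<close> only, so that both sides of each
    compatibility are pushed down to y.\<close>
  have c\<gamma>: "tmap0 \<gamma> \<cdot> td0 G = td0 y \<cdot> tmap1 \<gamma>" "MArr T (tmap0 \<gamma>) \<cdot> td1 G = td1 y \<cdot> tmap1 \<gamma>"
    "tmap1 \<gamma> \<cdot> ts0 G = ts0 y \<cdot> tmap0 \<gamma>" "tmap1 \<gamma> \<cdot> tcomp G = tcomp y \<cdot> fmap2 \<gamma>"
    by simp_all
  have fw: "td0 y \<cdot> tmap1 \<alpha> = tmap0 \<alpha> \<cdot> td0 A" "td1 y \<cdot> tmap1 \<alpha> = MArr T (tmap0 \<alpha>) \<cdot> td1 A"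
    "ts0 y \<cdot> tmap0 \<alpha> = tmap1 \<alpha> \<cdot> ts0 A" "tcomp y \<cdot> fmap2 \<alpha> = tmap1 \<alpha> \<cdot> tcomp A"
    "td0 A \<cdot> tmap1 q = tmap0 q \<cdot> td0 Q" "td1 A \<cdot> tmap1 q = MArr T (tmap0 q) \<cdot> td1 Q"
    "ts0 A \<cdot> tmap0 q = tmap1 q \<cdot> ts0 Q" "tcomp A \<cdot> fmap2 q = tmap1 q \<cdot> tcomp Q"
    "td0 G \<cdot> tmap1 t = tmap0 t \<cdot> td0 Q" "td1 G \<cdot> tmap1 t = MArr T (tmap0 t) \<cdot> td1 Q"
    "ts0 G \<cdot> tmap0 t = tmap1 t \<cdot> ts0 Q" "tcomp G \<cdot> fmap2 t = tmap1 t \<cdot> tcomp Q"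
    by simp_all
  note re = u0e u1e u0e[THEN reassoc] u1e[THEN reassoc] u0e[THEN T_eq] u0e[THEN T_eq, THEN reassoc]
    c\<gamma> c\<gamma>[THEN reassoc] fw
  note [simp del] = graph_map_eqs_simps prefun_eqs_simps
  have "td0 G \<cdot> u1 = u0 \<cdot> td0 A"
    by (rule stable_epi_cancel[OF stable(2) S1, of "tmap0 \<gamma>" "td0 y"]) (simp_all add: re)
  moreover have "td1 G \<cdot> u1 = MArr T u0 \<cdot> td1 A"
    by (rule stable_epi_cancel[OF stable(2) S1, of "MArr T (tmap0 \<gamma>)" "td1 y"]) (simp_all add: re)
  ultimately have [simp]: "graph_map u"
    unfolding graph_map_def in_Hom using tc by simp
  have s: "u1 \<cdot> ts0 A = ts0 G \<cdot> u0"
    by (rule stable_epi_cancel[OF stable(1) S0, of "tmap1 \<gamma>" "ts0 y"]) (simp_all add: re)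
  have uq: "u \<cdot>\<^bsub>TC\<^esub> q = t" "\<gamma> \<cdot>\<^bsub>TC\<^esub> u = \<alpha>"
    by (intro tfun_eqI; simp add: re)+
  have u2: "fmap2 u \<cdot> fmap2 q = fmap2 t" "fmap2 \<gamma> \<cdot> fmap2 u = fmap2 \<alpha>"
    using map2_comp[of q u] map2_comp[of u \<gamma>] by (simp_all add: uq)
  have c: "u1 \<cdot> tcomp A = tcomp G \<cdot> fmap2 u"
    by (rule stable_epi_cancel[OF stable(3) S2, of "tmap1 \<gamma>" "tcomp y"]) (simp_all add: re u2)
  have "is_tfun V T A G u"
    unfolding tfun_iff prefun_def using tc s c by simp
  then show "\<exists>u \<in> Arr TC. Dom TC u = Dom TC \<alpha> \<and> Cod TC u = Dom TC \<gamma> \<and> u \<cdot>\<^bsub>TC\<^esub> q = t \<and> \<gamma> \<cdot>\<^bsub>TC\<^esub> u = \<alpha>"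
    using uq by (intro bexI[of _ u]) simp_all
qed

lemma effective_TC: "effective TC p"
  unfolding effective_def
proof (intro allI impI)
  fix f m1 m2 \<xi> assume d: "descent_datum TC p f m1 m2 \<xi>"
  have fA: "f \<in> Arr TC" "ttgt f = x" and M: "is_pullback TC p (p \<cdot>\<^bsub>TC\<^esub> f) m1 m2"
    and xiA: "\<xi> \<in> Arr TC" "tsrc \<xi> = tsrc m1" "ttgt \<xi> = tsrc f"
    using TC.datumD[OF d] by (simp_all del: TCat_simps(2))
  have mA: "m1 \<in> Arr TC" "m2 \<in> Arr TC" "ttgt m1 = x" "ttgt m2 = tsrc f" "tsrc m2 = tsrc m1"
    using TC.pullback_arrs[OF M] by (simp_all del: TCat_simps(2))
  define w m where "w = tsrc f" and "m = tsrc m1"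
  have [simp]: "tsrc f = w" "ttgt f = x" "tsrc \<xi> = m" "ttgt \<xi> = w" "tsrc m1 = m" "ttgt m1 = x" "tsrc m2 = m" "ttgt m2 = w"
    using fA(2) xiA(2,3) mA(3-5) by (simp_all add: w_def m_def)
  have [simp]: "prefun f" "prefun \<xi>" "prefun m1" "prefun m2" and tw [simp]: "is_tcat V T w" "is_tcat V T m"
    using fA(1) xiA(1) mA(1,2) by (simp_all add: tfun_iff)
  have [simp]: "precat w" "precat m"
    using tw by (simp_all add: tcat_iff)
  have D0: "descent_datum V (tmap0 p) (tmap0 f) (tmap0 m1) (tmap0 m2) (tmap0 \<xi>)"
    using descent_datum_functor[OF level_functors(1) level_preserves_pullbacks(1) TCat_has_pullbacks d] by simp
  have D1: "descent_datum V (tmap1 p) (tmap1 f) (tmap1 m1) (tmap1 m2) (tmap1 \<xi>)"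
    using descent_datum_functor[OF level_functors(2) level_preserves_pullbacks(2) TCat_has_pullbacks d] by simp
  have D2: "descent_datum V (fmap2 p) (fmap2 f) (fmap2 m1) (fmap2 m2) (fmap2 \<xi>)"
    using descent_datum_functor[OF level_functors(3) level_preserves_pullbacks(3) TCat_has_pullbacks d] by simp
  \<comment> \<open>\<open>\<zeta>0\<close> and \<open>\<zeta>1\<close> will be the levels of the
    functor from z to y, \<open>\<pi>0\<close> and \<open>\<pi>1\<close> those of the functor from w
    to z.\<close>
  obtain \<zeta>0 \<pi>0 where S0: "is_pullback V (tmap0 p) \<zeta>0 (tmap0 f) \<pi>0" and e0: "\<pi>0 \<cdot> tmap0 \<xi> = \<pi>0 \<cdot> tmap0 m2"
    using stable(8) D0 unfolding effective_def by blast
  obtain \<zeta>1 \<pi>1 where S1: "is_pullback V (tmap1 p) \<zeta>1 (tmap1 f) \<pi>1" and e1: "\<pi>1 \<cdot> tmap1 \<xi> = \<pi>1 \<cdot> tmap1 m2"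
    using stable(9) D1 unfolding effective_def by blast
  have [simp]: "\<zeta>0 \<in> Arr V" "\<pi>0 \<in> Arr V" "Cod V \<zeta>0 = tob0 y" "Dom V \<pi>0 = tob0 w" "Cod V \<pi>0 = Dom V \<zeta>0"
    "\<zeta>1 \<in> Arr V" "\<pi>1 \<in> Arr V" "Cod V \<zeta>1 = tob1 y" "Dom V \<pi>1 = tob1 w" "Cod V \<pi>1 = Dom V \<zeta>1"
    using pullback_arrs[OF S0] pullback_arrs[OF S1] by simp_all
  note sq = pullback_arrs(9)[OF S0, symmetric] pullback_arrs(9)[OF S1, symmetric]
  note sqr = sq sq[THEN reassoc] sq[THEN T_eq, simplified] sq[THEN T_eq, THEN reassoc, simplified]
  note er = e0 e1 e0[THEN reassoc] e1[THEN reassoc] e0[THEN T_eq, simplified] e0[THEN T_eq, THEN reassoc, simplified]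
    e1[THEN T_eq, simplified] e1[THEN T_eq, THEN reassoc, simplified]
  \<comment> \<open>An arrow out of w descends once it does not distinguish \<open>\<xi>\<close>
    from \<open>m2\<close>. The structure maps of w followed by the projections pass this test since
    \<open>\<xi>\<close> and \<open>m2\<close> are functors.\<close>
  have fc0: "fibrewise_constant V \<pi>0 t" if "t \<in> Arr V" "Dom V t = tob0 w" "t \<cdot> tmap0 \<xi> = t \<cdot> tmap0 m2" for t
    by (rule fibrewise_constant_transport[OF S0 datumD(3-7)[OF D0] e0]) (use that in simp_all)
  have fc1: "fibrewise_constant V \<pi>1 t" if "t \<in> Arr V" "Dom V t = tob1 w" "t \<cdot> tmap1 \<xi> = t \<cdot> tmap1 m2" for t
    by (rule fibrewise_constant_transport[OF S1 datumD(3-7)[OF D1] e1]) (use that in simp_all)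
  have sqs: "\<zeta>0 \<cdot> (\<pi>0 \<cdot> td0 w) = td0 y \<cdot> (\<zeta>1 \<cdot> \<pi>1)" "MArr T \<zeta>0 \<cdot> (MArr T \<pi>0 \<cdot> td1 w) = td1 y \<cdot> (\<zeta>1 \<cdot> \<pi>1)"
    "\<zeta>1 \<cdot> (\<pi>1 \<cdot> ts0 w) = ts0 y \<cdot> (\<zeta>0 \<cdot> \<pi>0)" "\<zeta>1 \<cdot> (\<pi>1 \<cdot> tcomp w) = tcomp y \<cdot> (fmap2 p \<cdot> fmap2 f)"
    by (simp_all add: sqr)
  \<comment> \<open>The base arrow \<open>td0 y\<close> moves the problem from level 1 to level 0 of
    y; \<open>td1 y\<close> and \<open>ts0 y\<close> play this part for the next two maps.\<close>
  obtain \<delta>0 where d0 [simp]: "\<delta>0 \<in> Arr V" "Dom V \<delta>0 = Dom V \<zeta>1" "Cod V \<delta>0 = Dom V \<zeta>0"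
    and d0e: "\<delta>0 \<cdot> \<pi>1 = \<pi>0 \<cdot> td0 w" "\<zeta>0 \<cdot> \<delta>0 = td0 y \<cdot> \<zeta>1"
    by (rule stable_quot_factor[OF stable(6) S1, of \<zeta>0 "td0 y" "\<pi>0 \<cdot> td0 w"])
      (simp_all add: fc1 er sqs)
  obtain \<delta>1 where d1 [simp]: "\<delta>1 \<in> Arr V" "Dom V \<delta>1 = Dom V \<zeta>1" "Cod V \<delta>1 = MObj T (Dom V \<zeta>0)"
    and d1e: "\<delta>1 \<cdot> \<pi>1 = MArr T \<pi>0 \<cdot> td1 w" "MArr T \<zeta>0 \<cdot> \<delta>1 = td1 y \<cdot> \<zeta>1"
    by (rule stable_quot_factor[OF stable(6) S1, of "MArr T \<zeta>0" "td1 y" "MArr T \<pi>0 \<cdot> td1 w"])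
      (simp_all add: fc1 er sqs)
  obtain \<sigma> where s [simp]: "\<sigma> \<in> Arr V" "Dom V \<sigma> = Dom V \<zeta>0" "Cod V \<sigma> = Dom V \<zeta>1"
    and se: "\<sigma> \<cdot> \<pi>0 = \<pi>1 \<cdot> ts0 w" "\<zeta>1 \<cdot> \<sigma> = ts0 y \<cdot> \<zeta>0"
    by (rule stable_quot_factor[OF stable(5) S0, of \<zeta>1 "ts0 y" "\<pi>1 \<cdot> ts0 w"])
      (simp_all add: fc0 er sqs)
  \<comment> \<open>As for pullbacks, the composition is left open until the 2-chains are
    available.\<close>
  define z where "z c = \<lparr>tob0 = Dom V \<zeta>0, tob1 = Dom V \<zeta>1, td1 = \<delta>1, td0 = \<delta>0, ts0 = \<sigma>, tcomp = c\<rparr>" for c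
  have z [simp]: "tob0 (z c) = Dom V \<zeta>0" "tob1 (z c) = Dom V \<zeta>1" "td1 (z c) = \<delta>1" "td0 (z c) = \<delta>0"
    "ts0 (z c) = \<sigma>" "tcomp (z c) = c" for c
    by (simp_all add: z_def)
  define \<pi> \<zeta> where "\<pi> c = \<lparr>tsrc = w, ttgt = z c, tmap0 = \<pi>0, tmap1 = \<pi>1\<rparr>"
    and "\<zeta> c = \<lparr>tsrc = z c, ttgt = y, tmap0 = \<zeta>0, tmap1 = \<zeta>1\<rparr>" for c
  have ab [simp]: "tsrc (\<pi> c) = w" "ttgt (\<pi> c) = z c" "tmap0 (\<pi> c) = \<pi>0" "tmap1 (\<pi> c) = \<pi>1"
    "tsrc (\<zeta> c) = z c" "ttgt (\<zeta> c) = y" "tmap0 (\<zeta> c) = \<zeta>0" "tmap1 (\<zeta> c) = \<zeta>1" for c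
    by (simp_all add: \<pi>_def \<zeta>_def)
  have [simp]: "tgraph (z c)" for c
    unfolding tgraph_def in_Hom by simp
  have [simp]: "graph_map (\<pi> c)" "graph_map (\<zeta> c)" for c
    unfolding graph_map_def in_Hom by (simp_all add: d0e d1e)
  \<comment> \<open>This holds for every \<open>c\<close> and already provides the pullback squares
    of 2- and 3-chains: z_2 and z_3 arise as limits of the descended levels.\<close>
  have gp: "graph_pullback p (\<zeta> c) f (\<pi> c)" for c
    unfolding graph_pullback_def using S0 S1 by simp
  note S2 = graph_pullback_level2[OF gp] and S3 = graph_pullback_level3[OF gp]
  have indep: "ob2 (z c) = ob2 (z undefined)" "fmap2 (\<pi> c) = fmap2 (\<pi> undefined)" "fmap2 (\<zeta> c) = fmap2 (\<zeta> undefined)"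
    "pi0 (z c) = pi0 (z undefined)" "pi2 (z c) = pi2 (z undefined)" for c
    by (simp_all add: tob2_def tmap2_def tpair2_def tpi0_def tpi2_def)
  let ?z = "z undefined" and ?\<pi> = "\<pi> undefined" and ?\<zeta> = "\<zeta> undefined"
  \<comment> \<open>The 2-chains of z are jointly detected by their components, where the equation
    is that of level 1 and its image under \<open>T\<close>. It is what lets the composition of w
    descend.\<close>
  have e2: "fmap2 ?\<pi> \<cdot> fmap2 \<xi> = fmap2 ?\<pi> \<cdot> fmap2 m2"
    by (rule chain2_eq[of ?z]) (simp_all add: map2_eqs[where y = ?z, THEN reassoc] er)
  have fc2: "fibrewise_constant V (fmap2 ?\<pi>) (\<pi>1 \<cdot> tcomp w)"
    by (rule fibrewise_constant_transport[OF S2 datumD(3-7)[OF D2] e2]) (simp_all add: er)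
  obtain c where c [simp]: "c \<in> Arr V" "Dom V c = ob2 ?z" "Cod V c = Dom V \<zeta>1"
    and ce: "c \<cdot> fmap2 ?\<pi> = \<pi>1 \<cdot> tcomp w" "\<zeta>1 \<cdot> c = tcomp y \<cdot> fmap2 ?\<zeta>"
    by (rule stable_quot_factor[OF stable(7) S2[of undefined], of \<zeta>1 "tcomp y" "\<pi>1 \<cdot> tcomp w"])
      (use sqs(4) pullback_arrs(9)[OF S2[of undefined]] in \<open>simp_all add: fc2 del: prefun_eqs_simps\<close>)
  have fw: "td0 y \<cdot> \<zeta>1 = \<zeta>0 \<cdot> \<delta>0" "td1 y \<cdot> \<zeta>1 = MArr T \<zeta>0 \<cdot> \<delta>1" "ts0 y \<cdot> \<zeta>0 = \<zeta>1 \<cdot> \<sigma>"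
    "tcomp y \<cdot> fmap2 ?\<zeta> = \<zeta>1 \<cdot> c"
    using d0e(2) d1e(2) se(2) ce(2) by simp_all
  note f1 = d0e(1) d1e(1) se(1) ce(1) fw
  note fws = f1 f1[THEN reassoc] d0e(1)[THEN T_eq, simplified] d0e(1)[THEN T_eq, THEN reassoc, simplified]
    d1e(1)[THEN T_eq, simplified] d1e(1)[THEN T_eq, THEN reassoc, simplified]
    fw(1,2)[THEN T_eq, simplified] fw(1,2)[THEN T_eq, THEN reassoc, simplified]
  have pz: "pi0 y \<cdot> fmap2 ?\<zeta> = \<zeta>1 \<cdot> pi0 ?z" "pi2 y \<cdot> fmap2 ?\<zeta> = MArr T \<zeta>1 \<cdot> pi2 ?z"
    "pi0 ?z \<cdot> fmap2 ?\<pi> = \<pi>1 \<cdot> pi0 w" "pi2 ?z \<cdot> fmap2 ?\<pi> = MArr T \<pi>1 \<cdot> pi2 w"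
    using map2_eqs[of ?\<zeta> y] map2_eqs[of ?\<pi> ?z] by simp_all
  note ye = precat_eqs[of y]
  \<comment> \<open>The laws of y, restricted along the functor to y, become the laws of z seen
    after that functor. This is the over-the-base premise of the cancellations below.\<close>
  have t1: "\<zeta>0 \<cdot> (\<delta>0 \<cdot> \<sigma>) = \<zeta>0"
    using arg_cong[OF ye(1), of "\<lambda>u. u \<cdot> \<zeta>0"] by (simp add: fws del: precat_eqs_simps)
  have t2: "MArr T \<zeta>0 \<cdot> (\<delta>1 \<cdot> \<sigma>) = MArr T \<zeta>0 \<cdot> MUnit T (Dom V \<zeta>0)"
    using arg_cong[OF ye(2), of "\<lambda>u. u \<cdot> \<zeta>0"] by (simp add: fws del: precat_eqs_simps)
  have t3: "\<zeta>0 \<cdot> (\<delta>0 \<cdot> c) = \<zeta>0 \<cdot> (\<delta>0 \<cdot> pi0 ?z)"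
    using arg_cong[OF ye(3), of "\<lambda>u. u \<cdot> fmap2 ?\<zeta>"] by (simp add: fws pz del: precat_eqs_simps)
  have t4: "MArr T \<zeta>0 \<cdot> (\<delta>1 \<cdot> c) = MArr T \<zeta>0 \<cdot> (MMult T (Dom V \<zeta>0) \<cdot> (MArr T \<delta>1 \<cdot> pi2 ?z))"
    using arg_cong[OF ye(4), of "\<lambda>u. u \<cdot> fmap2 ?\<zeta>"] by (simp add: fws pz del: precat_eqs_simps)
  \<comment> \<open>Each law of z is cancelled on the object where it starts; the premise about
    composites with the projection from w is the same law of w. The last two start at
    2-chains.\<close>
  have "Ident V (Dom V \<zeta>0) = \<delta>0 \<cdot> \<sigma>"
    by (rule stable_epi_cancel'[OF stable(1) S0, of \<zeta>0 "Ident V (tob0 y)"]) (simp_all add: t1 fws)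
  moreover have "MUnit T (Dom V \<zeta>0) = \<delta>1 \<cdot> \<sigma>"
    by (rule stable_epi_cancel'[OF stable(1) S0, of "MArr T \<zeta>0" "MUnit T (tob0 y)"]) (simp_all add: t2 fws)
  moreover have "\<delta>0 \<cdot> pi0 ?z = \<delta>0 \<cdot> c"
    by (rule stable_epi_cancel'[OF stable(3) S2[of undefined], of \<zeta>0 "td0 y \<cdot> pi0 y"])
      (simp_all add: t3 fws pz)
  moreover have "MMult T (Dom V \<zeta>0) \<cdot> (MArr T \<delta>1 \<cdot> pi2 ?z) = \<delta>1 \<cdot> c"
    by (rule stable_epi_cancel'[OF stable(3) S2[of undefined], of "MArr T \<zeta>0"
          "MMult T (tob0 y) \<cdot> (MArr T (td1 y) \<cdot> pi2 y)"])
      (simp_all add: t4 fws pz)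
  ultimately have z_pre [simp]: "precat (z c)"
    unfolding precat_def in_Hom by (simp add: indep[of c])
  have [simp]: "prefun (\<pi> c)" "prefun (\<zeta> c)"
    unfolding prefun_def by (simp_all add: f1 fw indep[of c])
  have dom_c: "Dom V c = ob2 (z c)"
    unfolding indep(1)[of c] by (rule c(2))
  note [simp del] = c(2)
  note [simp] = dom_c
  have lw: "tcomp w \<cdot> lid_pair w = Ident V (tob1 w)" "tcomp w \<cdot> rid_pair w = Ident V (tob1 w)"
      "tcomp w \<cdot> lassoc_pair w = tcomp w \<cdot> rassoc_pair w"
    and ly: "tcomp y \<cdot> lid_pair y = Ident V (tob1 y)" "tcomp y \<cdot> rid_pair y = Ident V (tob1 y)"
      "tcomp y \<cdot> lassoc_pair y = tcomp y \<cdot> rassoc_pair y"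
    using tw(1) p_simps(5) unfolding tcat_iff by blast+
  \<comment> \<open>Naturality of the laws in both directions: towards y it gives equality over the
    base, from w it gives equality after the projection.\<close>
  note laws = law_natural[of "\<zeta> c" "z c" y] law_natural[of "\<pi> c" w "z c"]
  have "Ident V (Dom V \<zeta>1) = c \<cdot> lid_pair (z c)"
    by (rule stable_epi_cancel'[OF stable(2) S1, of \<zeta>1 "Ident V (tob1 y)"])
      (use laws(1,5) in \<open>simp_all add: lw ly\<close>)
  moreover have "Ident V (Dom V \<zeta>1) = c \<cdot> rid_pair (z c)"
    by (rule stable_epi_cancel'[OF stable(2) S1, of \<zeta>1 "Ident V (tob1 y)"])
      (use laws(2,6) in \<open>simp_all add: lw ly\<close>)
  \<comment> \<open>The equation on 3-chains, where the hypothesis on \<open>fmap3 p\<close>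
    enters.\<close>
  moreover have "c \<cdot> lassoc_pair (z c) = c \<cdot> rassoc_pair (z c)"
    by (rule stable_epi_cancel'[OF stable(4) S3[of c], of \<zeta>1 "tcomp y \<cdot> lassoc_pair y"])
      (use laws(3,4,7,8) in \<open>simp_all add: lw ly\<close>)
  ultimately have "is_tcat V T (z c)"
    unfolding tcat_iff by simp
  then have A: "\<zeta> c \<in> Arr TC" "\<pi> c \<in> Arr TC"
    by (simp_all add: tfun_iff)
  have "is_pullback TC p (\<zeta> c) f (\<pi> c)"
    by (rule TCat_pullbackI[OF _ A(1) fA(1) A(2) gp]) (simp add: p)
  moreover have "\<pi> c \<cdot>\<^bsub>TC\<^esub> \<xi> = \<pi> c \<cdot>\<^bsub>TC\<^esub> m2"
    by (rule tfun_eqI) (simp_all add: e0 e1)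
  ultimately show "\<exists>z \<pi>. is_pullback TC p z f \<pi> \<and> \<pi> \<cdot>\<^bsub>TC\<^esub> \<xi> = \<pi> \<cdot>\<^bsub>TC\<^esub> m2"
    by blast
qed

lemma effective_descent_TC: "effective_descent TC p"
  unfolding TC.effective_descent_iff TC.descent_iff
  using p stable_epi_TC stable_quot_TC effective_TC by simp

end

end

theorem theorem4p3p6:
  fixes V :: "('o, 'm) cat" and T :: "('o, 'm) monad"
    and x y :: "('o, 'm) tcat" and p :: "('o, 'm) tfun"
  assumes "category V" and "has_pullbacks V" and "cartesian_monad V T"
    and "is_tcat V T x" and "is_tcat V T y" and "is_tfun V T x y p"
    and "effective_descent V (MArr T (tmap1 p))"
    and "descent V (MArr T (tmap2 V T p))"
    and "almost_descent V (tmap3 V T p)"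
  shows "effective_descent (TCat V T) p"
proof -
  interpret category V by fact
  interpret cartesian_setup V T
    by unfold_locales fact+
  show ?thesis
    using assms(6-9) by (rule effective_descent_TC)
qed

end
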